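(* Let $(\Delta,\mathbf L)$ be a labelled rational Delzant polytope in $\mathfrak t^*\cong\mathbb R^m$ and $f$ an affine function positive on $\Delta$. If the equation $$-\sum_{i,j=1}^m\Big(\frac1{f^{2m-1}}\mathbf H^u_{ij}\Big)_{,ij}=\frac{c_{\Delta,\mathbf L,f}}{f^{2m+1}}$$ admits a solution $u\in\mathcal S(\Delta,\mathbf L)$, then $(\Delta,\mathbf L,f)$ is $K$-polystable.
   Context: $\mathfrak t$ is the Lie algebra of an $m$-dimensional torus ($m\ge2$) with lattice of circle subgroups $\Lambda\subset\mathfrak t$. A labelled rational Delzant polytope $(\Delta,\mathbf L)$ consists of a compact convex polytope $\Delta=\{L_j\ge0,\ j=1,\dots,d\}\subset\mathfrak t^*$ with $d$ facets $F_j=\Delta\cap\{L_j=0\}$, $\mathbf L=(L_1,\dots,L_d)$ affine functions with inward normals $u_j=dL_j\in\Lambda$, such that the normals of the facets meeting at any vertex form a basis of $\mathfrak t$. Identify $\mathfrak t\cong\mathbb R^m$ with coordinates $\mu_1,\dots,\mu_m$ on $\mathfrak t^*$; $\varphi_{,i}=\partial\varphi/\partial\mu_i$. $d\mu$ is Lebesgue measure, and $d\sigma$ is the measure on each facet $F_i$ with $dL_i\wedge d\sigma=-d\mu$. $\mathcal S(\Delta,\mathbf L)$ is the set of smooth strictly convex functions $u$ on the interior $\Delta^0$ (positive definite Hessian) such that $\mathbf H^u:=(\mathrm{Hess}\,u)^{-1}$, viewed as an $S^2\mathfrak t^*$-valued function, (i) extends smoothly to $\Delta$; (ii) satisfies $\mathbf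 H^u_\xi(u_j,\cdot)=0$ and $(d\mathbf H^u)_\xi(u_j,u_j)=2u_j$ for $\xi\in F_j$; (iii) at each point $\xi$ in the interior of any face $F$, is positive definite on $\mathfrak t/\mathfrak t_F$, where $\mathfrak t_F$ is the span of the normals of the facets containing $F$. $$c_{\Delta,\mathbf L,f}=2\Big(\int_{\partial\Delta}\tfrac1{f^{2m-1}}d\sigma\Big)\Big/\Big(\int_\Delta\tfrac1{f^{2m+1}}d\mu\Big),\qquad \mathfrak F_{\Delta,\mathbf L,f}(\varphi)=2\int_{\partial\Delta}\frac{\varphi}{f^{2m-1}}d\sigma-c_{\Delta,\mathbf L,f}\int_\Delta\frac\varphi{f^{2m+1}}d\mu,$$ the latter for continuous $\varphi$ on $\Delta$. $(\Delta,\mathbf L,f)$ is $K$-polystable if $\mathfrak F_{\Delta,\mathbf L,f}(\varphi)\ge0$ for every piecewise affine linear convex function $\varphi$ on $\Delta$ (maximum of finitely many affine functions), with equality only if $\varphi$ is affine. *)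

theory Defs
  imports "HOL-Analysis.Analysis"
begin

text \<open>
  Both the Lie algebra of the torus and its dual are represented by \<open>real ^ 'n\<close>, with the inner
  product as the duality pairing; the dimension \<open>m\<close> is \<open>CARD('n)\<close>.  An affine function on the dual
  is represented by the pair consisting of its linear part (a vector of the Lie algebra) and its
  constant term.
\<close>

type_synonym 'n affine_fun = "(real ^ 'n) \<times> real"

definition aff :: "'n::finite affine_fun \<Rightarrow> real ^ 'n \<Rightarrow> real" where
  "aff p x = fst p \<bullet> x + snd p"

definition affine_on :: "(real ^ 'n::finite) set \<Rightarrow> (real ^ 'n \<Rightarrow> real) \<Rightarrow> bool" where
  "affine_on S g \<longleftrightarrow> (\<exists>p. \<forall>x\<in>S. g x = aff p x)"

definition is_lattice :: "(real ^ 'n::finite) set \<Rightarrow> bool" where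
  "is_lattice \<Lambda> \<longleftrightarrow>
     (\<exists>B. independent B \<and> span B = UNIV \<and> \<Lambda> = range (\<lambda>z. \<Sum>b\<in>B. of_int (z b) *\<^sub>R b))"


subsection \<open>Labelled rational Delzant polytopes\<close>

definition Delta :: "('d::finite \<Rightarrow> 'n::finite affine_fun) \<Rightarrow> (real ^ 'n) set" where
  "Delta L = {x. \<forall>j. 0 \<le> aff (L j) x}"

definition normal_vec :: "('d::finite \<Rightarrow> 'n::finite affine_fun) \<Rightarrow> 'd \<Rightarrow> real ^ 'n" where
  "normal_vec L j = fst (L j)"

definition facet :: "('d::finite \<Rightarrow> 'n::finite affine_fun) \<Rightarrow> 'd \<Rightarrow> (real ^ 'n) set" where
  "facet L j = Delta L \<inter> {x. aff (L j) x = 0}"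

definition labelled_rational_Delzant ::
    "(real ^ 'n::finite) set \<Rightarrow> ('d::finite \<Rightarrow> 'n affine_fun) \<Rightarrow> bool" where
  "labelled_rational_Delzant \<Lambda> L \<longleftrightarrow>
     polytope (Delta L) \<and> interior (Delta L) \<noteq> {} \<and>
     bij_betw (facet L) UNIV {F. F facet_of Delta L} \<and>
     (\<forall>j. normal_vec L j \<in> \<Lambda>) \<and>
     (\<forall>v. v extreme_point_of Delta L \<longrightarrow>
        (let J = {j. v \<in> facet L j} in
           inj_on (normal_vec L) J \<and> independent (normal_vec L ` J) \<and>
           span (normal_vec L ` J) = UNIV))"


subsection \<open>Smooth functions\<close>

definition pderivative :: "'n::finite \<Rightarrow> (real ^ 'n \<Rightarrow> real) \<Rightarrow> real ^ 'n \<Rightarrow> real" where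
  "pderivative i g x = deriv (\<lambda>t. g (x + t *\<^sub>R axis i 1)) 0"

text \<open>\<open>Ck_on k U g\<close> is meant for open \<open>U\<close>.\<close>

primrec Ck_on :: "nat \<Rightarrow> (real ^ 'n::finite) set \<Rightarrow> (real ^ 'n \<Rightarrow> real) \<Rightarrow> bool" where
  "Ck_on 0 U g \<longleftrightarrow> continuous_on U g"
| "Ck_on (Suc k) U g \<longleftrightarrow> g differentiable_on U \<and> (\<forall>i. Ck_on k U (pderivative i g))"

definition smooth_on :: "(real ^ 'n::finite) set \<Rightarrow> (real ^ 'n \<Rightarrow> real) \<Rightarrow> bool" where
  "smooth_on U g \<longleftrightarrow> (\<forall>k. Ck_on k U g)"


subsection \<open>Symplectic potentials\<close>

definition Hess :: "(real ^ 'n::finite \<Rightarrow> real) \<Rightarrow> real ^ 'n \<Rightarrow> real ^ 'n ^ 'n" where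
  "Hess u x = (\<chi> i j. pderivative j (pderivative i u) x)"

definition HH :: "(real ^ 'n::finite \<Rightarrow> real) \<Rightarrow> real ^ 'n \<Rightarrow> real ^ 'n ^ 'n" where
  "HH u x = matrix_inv (Hess u x)"

definition normal_span ::
    "('d::finite \<Rightarrow> 'n::finite affine_fun) \<Rightarrow> (real ^ 'n) set \<Rightarrow> (real ^ 'n) set" where
  "normal_span L F = span {normal_vec L j | j. F \<subseteq> facet L j}"

text \<open>
  Condition (i) asks for an extension \<open>H\<close> of \<open>HH u\<close> that is smooth on an open neighbourhood of the
  polytope; since the interior is dense in the polytope, the values and first derivatives of \<open>H\<close>
  on the polytope do not depend on the choice of \<open>H\<close>.  In (ii), the covector
  \<open>(dH)\<^sub>\<xi>(u\<^sub>j, u\<^sub>j)\<close> on the dual space is identified with a vector of the Lie algebra.  In (iii), the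
  form induced by \<open>H \<xi>\<close> on the quotient by \<open>normal_span L F\<close> (which is in the kernel of the
  symmetric matrix \<open>H \<xi>\<close> by (ii)) is positive definite iff \<open>H \<xi>\<close> is positive on all vectors
  representing a nonzero class.
\<close>

definition potentials ::
    "('d::finite \<Rightarrow> 'n::finite affine_fun) \<Rightarrow> (real ^ 'n \<Rightarrow> real) set" where
  "potentials L =
     {u. smooth_on (interior (Delta L)) u \<and>
         (\<forall>x\<in>interior (Delta L). \<forall>v. v \<noteq> 0 \<longrightarrow> 0 < v \<bullet> (Hess u x *v v)) \<and>
         (\<exists>U H. open U \<and> Delta L \<subseteq> U \<and>
            (\<forall>i j. smooth_on U (\<lambda>x. H x $ i $ j)) \<and>
            (\<forall>x\<in>interior (Delta L). H x = HH u x) \<and>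
            (\<forall>j. \<forall>\<xi>\<in>facet L j.
               H \<xi> *v normal_vec L j = 0 \<and>
               ((\<lambda>x. normal_vec L j \<bullet> (H x *v normal_vec L j))
                  has_derivative (\<lambda>h. (2 *\<^sub>R normal_vec L j) \<bullet> h)) (at \<xi>)) \<and>
            (\<forall>F. F face_of Delta L \<longrightarrow>
               (\<forall>\<xi>\<in>rel_interior F. \<forall>v. v \<notin> normal_span L F \<longrightarrow> 0 < v \<bullet> (H \<xi> *v v))))}"


subsection \<open>The facet measures\<close>

text \<open>
  For an affine function \<open>\<ell>\<close> with linear part \<open>a \<noteq> 0\<close>, this is the measure on the hyperplane
  \<open>\<ell> = 0\<close> giving a subset \<open>A\<close> the volume of \<open>{x + t w | x \<in> A, 0 \<le> t \<le> 1}\<close>, where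
  \<open>w = a / |a|\<^sup>2\<close>, so that \<open>d\<ell>(w) = 1\<close>.  The two lemmas below show that it is concentrated on the
  hyperplane and that its product with \<open>dt = d\<ell>\<close> is Lebesgue measure, which is the relation
  \<open>d\<ell> \<and> d\<sigma> = - d\<mu>\<close> between the densities (the sign only fixes the orientation of the facet).
\<close>

definition transversal :: "'n::finite affine_fun \<Rightarrow> real ^ 'n" where
  "transversal p = (1 / (fst p \<bullet> fst p)) *\<^sub>R fst p"

definition hyperplane_measure :: "'n::finite affine_fun \<Rightarrow> (real ^ 'n) measure" where
  "hyperplane_measure p =
     distr (restrict_space lborel {y. 0 \<le> aff p y \<and> aff p y \<le> 1}) borel
       (\<lambda>y. y - aff p y *\<^sub>R transversal p)"

lemma aff_measurable [measurable]: "aff p \<in> borel_measurable borel"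
  unfolding aff_def by measurable

lemma hyperplane_measure_concentrated:
  assumes "fst p \<noteq> 0"
  shows "AE x in hyperplane_measure p. aff p x = 0"
proof -
  have "aff p (y - aff p y *\<^sub>R transversal p) = 0" for y
    using assms by (simp add: aff_def transversal_def inner_diff_right)
  then show ?thesis
    unfolding hyperplane_measure_def
    by (subst AE_distr_iff) (auto intro!: measurable_restrict_space1)
qed

lemma hyperplane_measure_disintegration:
  assumes "fst p \<noteq> 0"
  shows "distr (hyperplane_measure p \<Otimes>\<^sub>M lborel) borel (\<lambda>(x, t). x + t *\<^sub>R transversal p) = lborel"
proof (rule measure_eqI)
  define w where "w = transversal p"
  define S where "S = {y. 0 \<le> aff p y \<and> aff p y \<le> 1}"
  have aff_w: "aff p (y + t *\<^sub>R w) = aff p y + t" for y t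
    using assms by (simp add: aff_def w_def transversal_def inner_add_right)
  have S [measurable]: "S \<in> sets borel"
    unfolding S_def by measurable
  fix B assume "B \<in> sets (distr (hyperplane_measure p \<Otimes>\<^sub>M lborel) borel (\<lambda>(x, t). x + t *\<^sub>R transversal p))"
  then have B [measurable]: "B \<in> sets borel" by simp
  have sh: "sets (hyperplane_measure p) = sets borel"
    by (simp add: hyperplane_measure_def)
  have sp [measurable_cong]: "sets (hyperplane_measure p \<Otimes>\<^sub>M lborel) = sets (borel \<Otimes>\<^sub>M borel)"
    by (rule sets_pair_measure_cong) (simp_all add: sh)
  have "emeasure (distr (hyperplane_measure p \<Otimes>\<^sub>M lborel) borel (\<lambda>(x, t). x + t *\<^sub>R w)) B
      = (\<integral>\<^sup>+z. indicator B (fst z + snd z *\<^sub>R w) \<partial>(hyperplane_measure p \<Otimes>\<^sub>M lborel))"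
    by (subst nn_integral_indicator [symmetric], simp, subst nn_integral_distr)
       (auto simp: case_prod_beta)
  also have "\<dots> = (\<integral>\<^sup>+x. \<integral>\<^sup>+t. indicator B (x + t *\<^sub>R w) \<partial>lborel \<partial>hyperplane_measure p)"
    by (subst lborel.nn_integral_fst [symmetric]) auto
  also have "\<dots> = (\<integral>\<^sup>+y. \<integral>\<^sup>+t. indicator B (y - aff p y *\<^sub>R w + t *\<^sub>R w) \<partial>lborel \<partial>restrict_space lborel S)"
    unfolding hyperplane_measure_def S_def[symmetric] w_def[symmetric]
    by (subst nn_integral_distr) (auto intro!: measurable_restrict_space1)
  also have "\<dots> = (\<integral>\<^sup>+y. (\<integral>\<^sup>+t. indicator B (y - aff p y *\<^sub>R w + t *\<^sub>R w) \<partial>lborel) * indicator S y \<partial>lborel)"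
    by (subst nn_integral_restrict_space) auto
  also have "\<dots> = (\<integral>\<^sup>+y. (\<integral>\<^sup>+t. indicator B (y + t *\<^sub>R w) \<partial>lborel) * indicator S y \<partial>lborel)"
  proof (rule nn_integral_cong, rule arg_cong2[where f = "(*)", OF _ refl])
    fix y :: "real ^ 'a"
    show "(\<integral>\<^sup>+t. indicator B (y - aff p y *\<^sub>R w + t *\<^sub>R w) \<partial>lborel)
        = (\<integral>\<^sup>+t. indicator B (y + t *\<^sub>R w) \<partial>lborel)"
      using nn_integral_real_affine
        [where f = "\<lambda>t. indicator B (y - aff p y *\<^sub>R w + t *\<^sub>R w)" and c = 1 and t = "aff p y"]
      by (simp add: scaleR_add_left)
  qed
  also have "\<dots> = (\<integral>\<^sup>+y. \<integral>\<^sup>+t. indicator B (y + t *\<^sub>R w) * indicator S y \<partial>lborel \<partial>lborel)"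
    by (intro nn_integral_cong nn_integral_multc [symmetric]) measurable
  also have "\<dots> = (\<integral>\<^sup>+t. \<integral>\<^sup>+y. indicator B (y + t *\<^sub>R w) * indicator S y \<partial>lborel \<partial>lborel)"
    by (rule lborel_pair.Fubini') measurable
  also have "\<dots> = (\<integral>\<^sup>+t. \<integral>\<^sup>+z. indicator B z * indicator S (z - t *\<^sub>R w) \<partial>lborel \<partial>lborel)"
  proof (rule nn_integral_cong)
    fix t :: real
    have "(\<integral>\<^sup>+z. indicator B z * indicator S (z - t *\<^sub>R w) \<partial>lborel)
        = (\<integral>\<^sup>+z. indicator B z * indicator S (z - t *\<^sub>R w) \<partial>distr lborel borel ((+) (t *\<^sub>R w)))"
      by (simp add: lborel_distr_plus)
    also have "\<dots> = (\<integral>\<^sup>+y. indicator B (y + t *\<^sub>R w) * indicator S y \<partial>lborel)"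
      by (subst nn_integral_distr) (auto simp: add.commute)
    finally show "(\<integral>\<^sup>+y. indicator B (y + t *\<^sub>R w) * indicator S y \<partial>lborel)
      = (\<integral>\<^sup>+z. indicator B z * indicator S (z - t *\<^sub>R w) \<partial>lborel)" ..
  qed
  also have "\<dots> = (\<integral>\<^sup>+z. \<integral>\<^sup>+t. indicator B z * indicator S (z - t *\<^sub>R w) \<partial>lborel \<partial>lborel)"
    by (rule lborel_pair.Fubini') measurable
  also have "\<dots> = (\<integral>\<^sup>+z. indicator B z \<partial>lborel)"
  proof (rule nn_integral_cong)
    fix z :: "real ^ 'a"
    have "indicator S (z - t *\<^sub>R w) = (indicator {aff p z - 1 .. aff p z} t :: ennreal)" for t
      using aff_w[of z "- t"] by (auto simp: S_def indicator_def)
    then show "(\<integral>\<^sup>+t. indicator B z * indicator S (z - t *\<^sub>R w) \<partial>lborel) = indicator B z"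
      by (simp add: nn_integral_cmult)
  qed
  also have "\<dots> = emeasure lborel B"
    by simp
  finally show "emeasure (distr (hyperplane_measure p \<Otimes>\<^sub>M lborel) borel (\<lambda>(x, t). x + t *\<^sub>R transversal p)) B = emeasure lborel B"
    by (simp add: w_def)
qed simp


subsection \<open>K-polystability\<close>

definition boundary_integral ::
    "('d::finite \<Rightarrow> 'n::finite affine_fun) \<Rightarrow> (real ^ 'n \<Rightarrow> real) \<Rightarrow> real" where
  "boundary_integral L g = (\<Sum>j\<in>UNIV. LINT x:facet L j|hyperplane_measure (L j). g x)"

definition c_const ::
    "('d::finite \<Rightarrow> 'n::finite affine_fun) \<Rightarrow> (real ^ 'n \<Rightarrow> real) \<Rightarrow> real" where
  "c_const L f =
     2 * boundary_integral L (\<lambda>x. 1 / f x ^ (2 * CARD('n) - 1)) /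
     (LINT x:Delta L|lborel. 1 / f x ^ (2 * CARD('n) + 1))"

definition Futaki ::
    "('d::finite \<Rightarrow> 'n::finite affine_fun) \<Rightarrow> (real ^ 'n \<Rightarrow> real) \<Rightarrow> (real ^ 'n \<Rightarrow> real) \<Rightarrow> real" where
  "Futaki L f \<phi> =
     2 * boundary_integral L (\<lambda>x. \<phi> x / f x ^ (2 * CARD('n) - 1)) -
     c_const L f * (LINT x:Delta L|lborel. \<phi> x / f x ^ (2 * CARD('n) + 1))"

definition PL_convex_on :: "(real ^ 'n::finite) set \<Rightarrow> (real ^ 'n \<Rightarrow> real) \<Rightarrow> bool" where
  "PL_convex_on S \<phi> \<longleftrightarrow>
     (\<exists>A. finite A \<and> A \<noteq> {} \<and> (\<forall>x\<in>S. \<phi> x = Max ((\<lambda>p. aff p x) ` A)))"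

definition K_polystable ::
    "('d::finite \<Rightarrow> 'n::finite affine_fun) \<Rightarrow> (real ^ 'n \<Rightarrow> real) \<Rightarrow> bool" where
  "K_polystable L f \<longleftrightarrow>
     (\<forall>\<phi>. PL_convex_on (Delta L) \<phi> \<longrightarrow>
        0 \<le> Futaki L f \<phi> \<and> (Futaki L f \<phi> = 0 \<longrightarrow> affine_on (Delta L) \<phi>))"

end

theory Submission
  imports Defs
begin

text \<open>
  Write \<open>w = 1 / f\<^sup>2\<^sup>m\<^sup>-\<^sup>1\<close> and \<open>G = w H\<close>, with \<open>H\<close> the inverse Hessian of the solution \<open>u\<close>.  The theorem
  rests on the identity
  \<open>Futaki L f \<phi> = \<integral>\<^sub>\<Delta> w \<Sum> H\<^sub>i\<^sub>j \<partial>\<^sub>i\<partial>\<^sub>j\<phi>\<close> for \<open>\<phi>\<close> of class \<open>C\<^sup>2\<close>, obtained by integrating the equation against \<open>\<phi>\<close>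
  by parts twice (\<open>Hessian_integration_by_parts\<close>).  The boundary conditions on \<open>H\<close> are made for this:
  on a facet \<open>H u\<^sub>j = 0\<close> removes the term in \<open>d\<phi>\<close>, and \<open>dH(u\<^sub>j, u\<^sub>j) = 2 u\<^sub>j\<close> turns the flux of the divergence
  of \<open>G\<close> into \<open>2 w\<close> (\<open>boundary_flux\<close>), which is the boundary term of the Futaki functional.  As \<open>w H\<close> is
  positive definite in the interior, the functional is nonnegative on smooth convex functions.

  A maximum \<open>\<phi>\<close> of finitely many affine functions is not \<open>C\<^sup>2\<close>, but it is the uniform limit of the smooth
  convex functions \<open>g\<^sub>n = (1/n) ln (\<Sum> exp (n p))\<close>, and the Futaki functional is continuous under uniform
  convergence; hence \<open>Futaki L f \<phi> \<ge> 0\<close>.  If \<open>Futaki L f \<phi> = 0\<close>, then, because \<open>w H\<close> is bounded below on compact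
  subsets of the interior, the integrals of the Laplacians of \<open>g\<^sub>n\<close> over such subsets tend to \<open>0\<close>.
  These integrals dominate the integrals of the second differences
  \<open>g\<^sub>n (x + h) + g\<^sub>n (x - h) - 2 g\<^sub>n x\<close> over small balls, so the nonnegative second differences of \<open>\<phi>\<close> itself vanish
  (\<open>vanishing_laplacian_imp_midpoint\<close>), and \<open>\<phi>\<close> is affine (\<open>midpoint_affine_imp_affine\<close>).

  The integration by parts needs a divergence theorem for the polytope with the measures \<open>d\<sigma>\<close> on the
  facets (\<open>divergence_theorem_Delta\<close>).  It is proved by multiplying the vector field by a \<open>C\<^sup>1\<close> cutoff
  that vanishes outside the polytope, so that the divergence of the product has integral \<open>0\<close> by
  translation invariance, and letting the cutoff tend to the indicator function: its gradient
  concentrates on the facets (\<open>boundary_layer_limit\<close>).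
\<close>

section \<open>Partial derivatives and functions of class \<open>C\<^sup>k\<close>\<close>

lemma has_real_derivative_along_line:
  fixes g :: "'a::real_normed_vector \<Rightarrow> real"
  assumes "(g has_derivative g') (at (x + t *\<^sub>R e))"
  shows "((\<lambda>s. g (x + s *\<^sub>R e)) has_real_derivative g' e) (at t)"
proof -
  have "((\<lambda>s. x + s *\<^sub>R e) has_derivative (\<lambda>s. s *\<^sub>R e)) (at t)"
    by (auto intro!: derivative_eq_intros)
  from diff_chain_at[OF this assms]
  have "((\<lambda>s. g (x + s *\<^sub>R e)) has_derivative (\<lambda>s. g' (s *\<^sub>R e))) (at t)"
    by (simp add: o_def)
  moreover have "g' (s *\<^sub>R e) = g' e * s" for s
    using assms by (metis has_derivative_linear linear_cmul mult.commute real_scaleR_def)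
  ultimately show ?thesis
    by (simp add: has_field_derivative_def mult_commute_abs)
qed

lemma pderivative_eq:
  assumes "(g has_derivative g') (at x)"
  shows "pderivative i g x = g' (axis i 1)"
  unfolding pderivative_def
  by (rule DERIV_imp_deriv, rule has_real_derivative_along_line) (use assms in simp)

lemma has_derivative_gradient:
  fixes g :: "real ^ 'n::finite \<Rightarrow> real"
  assumes "g differentiable (at x)"
  shows "(g has_derivative (\<lambda>h. \<Sum>i\<in>UNIV. h $ i * pderivative i g x)) (at x)"
proof -
  obtain g' where g': "(g has_derivative g') (at x)"
    using assms by (auto simp: differentiable_def)
  have "g' h = (\<Sum>i\<in>UNIV. h $ i * pderivative i g x)" for h
  proof -
    have lin: "linear g'" using g' by (rule has_derivative_linear)
    have "g' h = g' (\<Sum>i\<in>UNIV. h $ i *s axis i 1)" by (simp add: basis_expansion)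
    also have "\<dots> = (\<Sum>i\<in>UNIV. h $ i * pderivative i g x)"
      by (simp add: linear_sum[OF lin] scalar_mult_eq_scaleR linear_cmul[OF lin] pderivative_eq[OF g'])
    finally show ?thesis .
  qed
  then show ?thesis using g' by presburger
qed

lemma pderivative_cong:
  fixes g :: "real ^ 'n::finite \<Rightarrow> real"
  assumes "open U" "x \<in> U" "\<And>y. y \<in> U \<Longrightarrow> g y = h y"
  shows "pderivative i g x = pderivative i h x"
  unfolding pderivative_def
proof (rule deriv_cong_ev)
  have "((\<lambda>t. x + t *\<^sub>R axis i (1::real)) \<longlongrightarrow> x + 0 *\<^sub>R axis i 1) (nhds 0)"
    by (intro tendsto_intros filterlim_ident)
  then have "eventually (\<lambda>t. x + t *\<^sub>R axis i (1::real) \<in> U) (nhds 0)"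
    using assms(1,2) by (simp add: topological_tendstoD)
  then show "\<forall>\<^sub>F t in nhds 0. g (x + t *\<^sub>R axis i 1) = h (x + t *\<^sub>R axis i 1)"
    by eventually_elim (rule assms(3))
qed simp

lemma Ck_on_cong:
  fixes g :: "real ^ 'n::finite \<Rightarrow> real"
  assumes "open U" "\<And>y. y \<in> U \<Longrightarrow> g y = h y" "Ck_on k U g"
  shows "Ck_on k U h"
  using assms(2,3)
proof (induction k arbitrary: g h)
  case 0
  then show ?case using continuous_on_cong[of U U g h] by simp
next
  case (Suc k)
  have "h differentiable_on U"
    unfolding differentiable_on_def
  proof
    fix x assume "x \<in> U"
    then show "h differentiable at x within U"
      using Suc.prems differentiable_transform_within[of g x U 1 h]
      by (auto simp: differentiable_on_def)
  qed
  moreover have "Ck_on k U (pderivative i h)" for i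
    by (rule Suc.IH[of "pderivative i g"])
      (use Suc.prems pderivative_cong[OF assms(1), of _ g h] in auto)
  ultimately show ?case by simp
qed

lemma Ck_on_continuous: "Ck_on k U g \<Longrightarrow> continuous_on U g"
  by (cases k) (auto intro: differentiable_imp_continuous_on)

lemma Ck_on_SucD: "Ck_on (Suc k) U g \<Longrightarrow> Ck_on k U g"
proof (induction k arbitrary: g)
  case (Suc k)
  have "g differentiable_on U" "Ck_on (Suc k) U (pderivative i g)" for i
    using Suc.prems unfolding Ck_on.simps(2)[of "Suc k"] by auto
  then show ?case using Suc.IH by simp
qed (auto intro: differentiable_imp_continuous_on)

lemma Ck_on_pderivative: "Ck_on (Suc k) U g \<Longrightarrow> Ck_on k U (pderivative i g)"
  by simp

lemma Ck_on_subset: "Ck_on k U g \<Longrightarrow> V \<subseteq> U \<Longrightarrow> Ck_on k V g"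
  by (induction k arbitrary: g) (auto intro: continuous_on_subset differentiable_on_subset)

lemma Ck_on_differentiable:
  assumes "Ck_on (Suc k) U g" "open U" "x \<in> U"
  shows "g differentiable (at x)"
  using assms by (simp add: differentiable_on_eq_differentiable_at)

lemma Ck_on_has_derivative:
  assumes "Ck_on (Suc k) U g" "open U" "x \<in> U"
  shows "(g has_derivative (\<lambda>h. \<Sum>i\<in>UNIV. h $ i * pderivative i g x)) (at x)"
  using Ck_on_differentiable[OF assms] by (rule has_derivative_gradient)



lemma Ck_on_SucI:
  fixes g :: "real ^ 'n::finite \<Rightarrow> real"
  assumes "open U" "\<And>x. x \<in> U \<Longrightarrow> (g has_derivative g' x) (at x)"
    and "\<And>i. Ck_on k U (\<lambda>x. g' x (axis i 1))"
  shows "Ck_on (Suc k) U g"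
proof -
  have "g differentiable_on U"
    using assms(1,2) by (auto simp: differentiable_on_eq_differentiable_at differentiable_def)
  moreover have "Ck_on k U (pderivative i g)" for i
    by (rule Ck_on_cong[OF assms(1) _ assms(3)[of i]]) (simp add: pderivative_eq[OF assms(2)])
  ultimately show ?thesis by simp
qed

lemma Ck_on_const: "open U \<Longrightarrow> Ck_on k U (\<lambda>_. c)"
proof (induction k arbitrary: c)
  case (Suc k)
  show ?case
    by (rule Ck_on_SucI[where g'="\<lambda>_ _. 0"]) (use Suc in auto)
qed simp

lemma sum_axis_mult [simp]: "(\<Sum>j\<in>UNIV. axis i 1 $ j * c j) = (c i :: real)"
  by (simp add: axis_def if_distrib[of "\<lambda>t. t * _"] cong: if_cong)

lemma pderivative_mult:
  fixes g :: "real ^ 'n::finite \<Rightarrow> real"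
  assumes "g differentiable (at x)" "h differentiable (at x)"
  shows "pderivative i (\<lambda>y. g y * h y) x = g x * pderivative i h x + pderivative i g x * h x"
  using pderivative_eq[OF has_derivative_mult[OF has_derivative_gradient[OF assms(1)]
      has_derivative_gradient[OF assms(2)]], of i] by simp

lemma pderivative_diff:
  fixes g :: "real ^ 'n::finite \<Rightarrow> real"
  assumes "g differentiable (at x)" "h differentiable (at x)"
  shows "pderivative i (\<lambda>y. g y - h y) x = pderivative i g x - pderivative i h x"
  using pderivative_eq[OF has_derivative_diff[OF has_derivative_gradient[OF assms(1)]
      has_derivative_gradient[OF assms(2)]], of i] by simp

lemma pderivative_sum:
  fixes g :: "'k \<Rightarrow> real ^ 'n::finite \<Rightarrow> real"
  assumes "\<And>k. k \<in> K \<Longrightarrow> g k differentiable (at x)"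
  shows "pderivative i (\<lambda>y. \<Sum>k\<in>K. g k y) x = (\<Sum>k\<in>K. pderivative i (g k) x)"
  using pderivative_eq[OF has_derivative_sum[of K g, OF has_derivative_gradient[OF assms]], of i]
  by simp

lemma Ck_on_add:
  assumes "open U"
  shows "Ck_on k U g \<Longrightarrow> Ck_on k U h \<Longrightarrow> Ck_on k U (\<lambda>x. g x + h x)"
proof (induction k arbitrary: g h)
  case (Suc k)
  have "Ck_on k U (\<lambda>x. pderivative i g x + pderivative i h x)" for i
    using Suc by auto
  then show ?case
    by (intro Ck_on_SucI[OF assms has_derivative_add[OF
        Ck_on_has_derivative[OF Suc.prems(1) assms] Ck_on_has_derivative[OF Suc.prems(2) assms]]])
      simp_all
qed (simp add: continuous_on_add)

lemma Ck_on_mult: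
  assumes "open U"
  shows "Ck_on k U g \<Longrightarrow> Ck_on k U h \<Longrightarrow> Ck_on k U (\<lambda>x. g x * h x)"
proof (induction k arbitrary: g h)
  case (Suc k)
  have "Ck_on k U g" "Ck_on k U h"
    using Suc.prems by (auto intro: Ck_on_SucD simp del: Ck_on.simps)
  then have "Ck_on k U (\<lambda>x. g x * pderivative i h x + pderivative i g x * h x)" for i
    using Suc by (intro Ck_on_add[OF assms] Suc.IH) auto
  then show ?case
    by (intro Ck_on_SucI[OF assms has_derivative_mult[OF
        Ck_on_has_derivative[OF Suc.prems(1) assms] Ck_on_has_derivative[OF Suc.prems(2) assms]]])
      simp_all
qed (simp add: continuous_on_mult)

lemma Ck_on_uminus: "open U \<Longrightarrow> Ck_on k U g \<Longrightarrow> Ck_on k U (\<lambda>x. - g x)"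
  using Ck_on_mult[OF _ Ck_on_const[of U k "-1"], of g] by simp

lemma Ck_on_diff: "open U \<Longrightarrow> Ck_on k U g \<Longrightarrow> Ck_on k U h \<Longrightarrow> Ck_on k U (\<lambda>x. g x - h x)"
  using Ck_on_add[OF _ _ Ck_on_uminus, of U k g h] by simp

lemma Ck_on_sum:
  assumes "open U" "\<And>k. k \<in> K \<Longrightarrow> Ck_on n U (g k)"
  shows "Ck_on n U (\<lambda>x. \<Sum>k\<in>K. g k x)"
  using assms(2)
  by (induction K rule: infinite_finite_induct)
    (auto intro!: Ck_on_const[OF assms(1)] Ck_on_add[OF assms(1)])

lemma aff_has_derivative [derivative_intros]:
  "(aff p has_derivative (\<lambda>h. fst p \<bullet> h)) (at x)"
  unfolding aff_def[abs_def] by (auto intro!: derivative_eq_intros)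

lemma continuous_on_aff [continuous_intros]: "continuous_on S (aff p)"
  unfolding aff_def by (intro continuous_intros)

text \<open>
  The statement for all exponents at once makes the induction on \<open>k\<close> go through: each derivative is a
  constant multiple of the next power.
\<close>

lemma Ck_on_inverse_aff_power:
  assumes "open U" "\<And>x. x \<in> U \<Longrightarrow> aff p x \<noteq> 0"
  shows "Ck_on k U (\<lambda>x. inverse (aff p x) ^ N)"
proof (induction k arbitrary: N)
  case 0
  then show ?case using assms by (auto intro!: continuous_intros)
next
  case (Suc k)
  show ?case
  proof (rule Ck_on_SucI[OF assms(1)])
    fix x assume "x \<in> U"
    then have "aff p x \<noteq> 0" by (rule assms)
    then have "((\<lambda>y. inverse y ^ N) has_real_derivative - N * inverse (aff p x) ^ Suc N)
        (at (aff p x))"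
      using DERIV_power_Suc[OF DERIV_inverse, of "aff p x" "N - 1" UNIV]
      by (cases N) (simp_all add: algebra_simps del: power_inverse)
    from has_derivative_compose[OF aff_has_derivative this[unfolded has_field_derivative_def]]
    show "((\<lambda>x. inverse (aff p x) ^ N) has_derivative
        (\<lambda>h. - (N * (fst p \<bullet> h)) * inverse (aff p x) ^ Suc N)) (at x)"
      by (rule has_derivative_eq_rhs) (simp add: fun_eq_iff)
  next
    fix i
    show "Ck_on k U (\<lambda>x. - (N * (fst p \<bullet> axis i 1)) * inverse (aff p x) ^ Suc N)"
      by (rule Ck_on_mult[OF assms(1) Ck_on_const[OF assms(1)] Suc])
  qed
qed

section \<open>Integrals of derivatives and the cutoff function\<close>

lemma lborel_integral_translate:
  fixes g :: "'a::euclidean_space \<Rightarrow> real"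
  assumes [measurable]: "g \<in> borel_measurable borel"
  shows "(\<integral>x. g (x + c) \<partial>lborel) = (\<integral>x. g x \<partial>lborel)"
proof -
  have "(\<integral>x. g x \<partial>lborel) = (\<integral>x. g x \<partial>distr lborel borel ((+) c))"
    by (simp add: lborel_distr_plus)
  also have "\<dots> = (\<integral>x. g (x + c) \<partial>lborel)"
    by (subst integral_distr) (auto simp: add.commute)
  finally show ?thesis ..
qed

lemma lborel_integrable_translate:
  fixes g :: "'a::euclidean_space \<Rightarrow> real"
  assumes "integrable lborel g"
  shows "integrable lborel (\<lambda>x. g (x + c))"
proof -
  have "integrable (distr lborel borel ((+) c)) g"
    using assms by (simp add: lborel_distr_plus)
  then show ?thesis
    by (subst (asm) integrable_distr_eq) (use assms in \<open>auto simp: add.commute\<close>)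
qed

text \<open>
  The difference quotients of \<open>g\<close> in the direction \<open>e\<close> have integral \<open>0\<close> by translation invariance, and they
  converge boundedly, with supports in a common ball, to the directional derivative.
\<close>

lemma integral_directional_derivative:
  fixes g g' :: "'a::euclidean_space \<Rightarrow> real"
  assumes cont: "continuous_on UNIV g"
    and K: "bounded K" "\<And>x. x \<notin> K \<Longrightarrow> g x = 0"
    and der: "\<And>x. ((\<lambda>t. g (x + t *\<^sub>R e)) has_real_derivative g' x) (at 0)"
    and bd: "\<And>x. \<bar>g' x\<bar> \<le> M"
  shows "integrable lborel g'" "(\<integral>x. g' x \<partial>lborel) = 0"
proof -
  define q where "q n x = real (Suc n) * (g (x + inverse (real (Suc n)) *\<^sub>R e) - g x)" for n x
  have [measurable]: "g \<in> borel_measurable borel"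
    using cont by (rule borel_measurable_continuous_onI)
  have q_meas [measurable]: "q n \<in> borel_measurable borel" for n
    unfolding q_def by measurable
  have lim: "(\<lambda>n. q n x) \<longlonglongrightarrow> g' x" for x
  proof -
    have "((\<lambda>h. (g (x + (0 + h) *\<^sub>R e) - g (x + 0 *\<^sub>R e)) / h) \<longlongrightarrow> g' x) (at 0)"
      using der[of x] by (simp add: DERIV_def)
    moreover have "filterlim (\<lambda>n. inverse (real (Suc n))) (at 0) sequentially"
      by (rule filterlim_atI[OF LIMSEQ_inverse_real_of_nat]) auto
    ultimately have "(\<lambda>n. (g (x + (0 + inverse (real (Suc n))) *\<^sub>R e) - g (x + 0 *\<^sub>R e))
        / inverse (real (Suc n))) \<longlonglongrightarrow> g' x"
      by (rule filterlim_compose)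
    then show ?thesis
      by (simp add: q_def divide_inverse mult.commute)
  qed
  have g'_meas [measurable]: "g' \<in> borel_measurable borel"
    by (rule borel_measurable_LIMSEQ_real[OF lim q_meas])
  have line: "((\<lambda>s. g (x + s *\<^sub>R e)) has_real_derivative g' (x + t *\<^sub>R e)) (at t)" for x t
    using DERIV_shift[of "\<lambda>s. g (x + s *\<^sub>R e)" "g' (x + t *\<^sub>R e)" 0 t] der[of "x + t *\<^sub>R e"]
    by (simp add: algebra_simps)
  have lip: "\<bar>g (x + t *\<^sub>R e) - g x\<bar> \<le> M * \<bar>t\<bar>" for x t
    using field_differentiable_bound[of UNIV "\<lambda>s. g (x + s *\<^sub>R e)" "\<lambda>t. g' (x + t *\<^sub>R e)" M t 0]
      line[of x] bd by simp
  obtain R where R: "\<And>x. x \<in> K \<Longrightarrow> norm x \<le> R"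
    using K(1) by (auto simp: bounded_iff)
  have supp: "q n x = 0" if "x \<notin> cball 0 (R + norm e)" for n x
  proof -
    have "norm (inverse (real (Suc n)) *\<^sub>R e) \<le> norm e"
      by (simp add: field_simps mult_le_cancel_right1)
    then have "norm x \<le> norm (x + inverse (real (Suc n)) *\<^sub>R e) + norm e"
      using norm_triangle_ineq4[of "x + inverse (real (Suc n)) *\<^sub>R e" "inverse (real (Suc n)) *\<^sub>R e"]
      by simp
    then have "x \<notin> K" "x + inverse (real (Suc n)) *\<^sub>R e \<notin> K"
      using that R[of x] R[of "x + inverse (real (Suc n)) *\<^sub>R e"] norm_ge_zero[of e] by auto
    then show ?thesis by (simp add: q_def K(2))
  qed
  have bound: "norm (q n x) \<le> M * indicator (cball 0 (R + norm e)) x" for n x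
  proof (cases "x \<in> cball 0 (R + norm e)")
    case True
    have "\<bar>q n x\<bar> \<le> real (Suc n) * (M * inverse (real (Suc n)))"
      unfolding q_def abs_mult using lip[of x "inverse (real (Suc n))"]
      by (intro mult_mono) auto
    also have "\<dots> = M" by simp
    finally show ?thesis using True by simp
  qed (simp add: supp)
  have dom: "integrable lborel (\<lambda>x. M * indicator (cball 0 (R + norm e)) x)"
    using emeasure_lborel_cball_finite[of 0 "R + norm e"] by (auto simp: less_top)
  show "integrable lborel g'"
    by (rule integrable_dominated_convergence[OF _ _ dom, where s = q])
      (use lim bound in auto)
  have lim_int: "(\<lambda>n. \<integral>x. q n x \<partial>lborel) \<longlonglongrightarrow> (\<integral>x. g' x \<partial>lborel)"
    by (rule integral_dominated_convergence[OF _ _ dom]) (use lim bound in auto)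
  have "integrable lborel (\<lambda>x. indicator (closure K) x *\<^sub>R g x)"
    using K(1) by (intro borel_integrable_compact) (auto intro: continuous_on_subset[OF cont])
  moreover have "(\<lambda>x. indicator (closure K) x *\<^sub>R g x) = g"
    using K(2) closure_subset[of K] by (auto simp: indicator_def fun_eq_iff)
  ultimately have "integrable lborel g" by simp
  then have "(\<integral>x. q n x \<partial>lborel) = 0" for n
    by (simp add: q_def lborel_integrable_translate lborel_integral_translate)
  then show "(\<integral>x. g' x \<partial>lborel) = 0"
    using lim_int by (simp add: LIMSEQ_const_iff)
qed

text \<open>
  A \<open>C\<^sup>1\<close> function that is \<open>0\<close> on the nonpositive half-line and increases to \<open>1\<close>.  Vanishing together with its
  derivative at \<open>0\<close> makes \<open>ramp (c * aff p x)\<close> differentiable across the hyperplane where \<open>aff p\<close> is \<open>0\<close>.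
\<close>

definition ramp :: "real \<Rightarrow> real" where
  "ramp s = (max 0 s)\<^sup>2 / (1 + (max 0 s)\<^sup>2)"

definition ramp' :: "real \<Rightarrow> real" where
  "ramp' s = 2 * max 0 s / (1 + (max 0 s)\<^sup>2)\<^sup>2"

lemma one_plus_square_pos: "0 < 1 + (x::real)\<^sup>2"
  by (simp add: add_pos_nonneg)

text \<open>
  Squaring smooths the corner of \<open>max 0 s\<close>: the difference quotients at \<open>0\<close> are bounded by \<open>\<bar>h\<bar>\<close>.
\<close>

lemma DERIV_max_0_square: "((\<lambda>s. (max 0 s)\<^sup>2) has_real_derivative 2 * max 0 s) (at (s::real))"
proof -
  consider "s < 0" | "s > 0" | "s = 0" by linarith
  then show ?thesis
  proof cases
    case 1
    have "((\<lambda>s. 0) has_real_derivative 2 * max 0 s) (at s)" using 1 by simp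
    then show ?thesis
      by (rule DERIV_cong_ev[THEN iffD1, rotated 3])
        (use eventually_nhds_in_open[of "{..<0}" s] 1 in \<open>auto elim!: eventually_mono\<close>)
  next
    case 2
    have "((\<lambda>s. s\<^sup>2) has_real_derivative 2 * max 0 s) (at s)"
      using 2 by (auto intro!: derivative_eq_intros)
    then show ?thesis
      by (rule DERIV_cong_ev[THEN iffD1, rotated 3])
        (use eventually_nhds_in_open[of "{0<..}" s] 2 in \<open>auto elim!: eventually_mono\<close>)
  next
    case 3
    have "((\<lambda>h. (max 0 h)\<^sup>2 / h) \<longlongrightarrow> 0) (at (0::real))"
    proof (rule Lim_null_comparison)
      show "((\<lambda>h. \<bar>h\<bar>) \<longlongrightarrow> 0) (at (0::real))"
        by (rule tendsto_rabs_zero) simp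
      show "\<forall>\<^sub>F h in at (0::real). norm ((max 0 h)\<^sup>2 / h) \<le> \<bar>h\<bar>"
        by (rule always_eventually) (auto simp: max_def power2_eq_square)
    qed
    then show ?thesis using 3 by (simp add: DERIV_def)
  qed
qed

lemma DERIV_ramp: "(ramp has_real_derivative ramp' s) (at s)"
  unfolding ramp_def[abs_def] ramp'_def
  by (rule derivative_eq_intros DERIV_max_0_square refl)+
    (use one_plus_square_pos[of "max 0 s"] in \<open>auto simp: field_simps power2_eq_square\<close>)

lemma ramp_nonneg: "0 \<le> ramp s" and ramp_le_1: "ramp s \<le> 1"
  using one_plus_square_pos[of "max 0 s"] by (auto simp: ramp_def)

lemma ramp_eq_0: "s \<le> 0 \<Longrightarrow> ramp s = 0" and ramp'_eq_0: "s \<le> 0 \<Longrightarrow> ramp' s = 0"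
  by (auto simp: ramp_def ramp'_def max_def)

lemma ramp'_nonneg: "0 \<le> ramp' s"
  by (simp add: ramp'_def)

lemma continuous_on_ramp: "continuous_on S ramp"
  by (rule DERIV_continuous_on[OF DERIV_subset[OF DERIV_ramp]]) simp

lemma continuous_on_ramp': "continuous_on S ramp'"
  unfolding ramp'_def using one_plus_square_pos by (intro continuous_intros) (simp add: less_imp_neq[symmetric])

lemma ramp_at_top: "(ramp \<longlongrightarrow> 1) at_top"
proof -
  have "((\<lambda>s::real. 1 - 1 / (1 + (max 0 s)\<^sup>2)) \<longlongrightarrow> 1 - 0) at_top"
  proof (intro tendsto_diff tendsto_const tendsto_divide_0[OF tendsto_const])
    have "filterlim (\<lambda>s::real. 1 + s\<^sup>2) at_top at_top"
      by (intro filterlim_tendsto_add_at_top[OF tendsto_const] filterlim_pow_at_top filterlim_ident) simp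
    then have "filterlim (\<lambda>s::real. 1 + (max 0 s)\<^sup>2) at_top at_top"
      by (rule filterlim_mono_eventually)
        (auto intro!: eventually_mono[OF eventually_ge_at_top[of 0]] simp: max_def)
    then show "filterlim (\<lambda>s::real. 1 + (max 0 s)\<^sup>2) at_infinity at_top"
      by (rule filterlim_at_top_imp_at_infinity)
  qed
  moreover have "1 - 1 / (1 + (max 0 s)\<^sup>2) = ramp s" for s
    using one_plus_square_pos[of "max 0 s"] by (simp add: ramp_def field_simps)
  ultimately show ?thesis by simp
qed

lemma integrable_ramp': "integrable lborel ramp'"
  and integral_ramp': "(\<integral>s. ramp' s \<partial>lborel) = 1"
proof -
  have [measurable]: "ramp' \<in> borel_measurable borel"
    by (rule borel_measurable_continuous_onI[OF continuous_on_ramp'])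
  have "(\<integral>\<^sup>+s. ennreal (ramp' s) \<partial>lborel) = (\<integral>\<^sup>+s. ennreal (ramp' s) * indicator {0..} s \<partial>lborel)"
    by (rule nn_integral_cong) (auto simp: indicator_def ramp'_eq_0)
  also have "\<dots> = ennreal (1 - ramp 0)"
    by (rule nn_integral_FTC_atLeast) (use DERIV_ramp ramp'_nonneg ramp_at_top in auto)
  finally have *: "(\<integral>\<^sup>+s. ennreal (ramp' s) \<partial>lborel) = ennreal 1"
    by (simp add: ramp_eq_0)
  show "integrable lborel ramp'"
    by (rule integrableI_nonneg) (use * ramp'_nonneg in auto)
  show "(\<integral>s. ramp' s \<partial>lborel) = 1"
    by (rule integral_eq_nn_integral[THEN trans]) (use * ramp'_nonneg in auto)
qed

section \<open>Integration over the facets\<close>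

lemma sets_hyperplane_measure [simp, measurable_cong]: "sets (hyperplane_measure p) = sets borel"
  by (simp add: hyperplane_measure_def)

lemma space_hyperplane_measure [simp]: "space (hyperplane_measure p) = UNIV"
  by (simp add: hyperplane_measure_def)

lemma aff_transversal:
  "fst p \<noteq> 0 \<Longrightarrow> aff p (x + t *\<^sub>R transversal p) = aff p x + t"
  by (simp add: aff_def transversal_def inner_add_right)

lemma emeasure_hyperplane_measure:
  assumes [measurable]: "A \<in> sets borel"
  shows "emeasure (hyperplane_measure p) A =
    emeasure lborel {y. 0 \<le> aff p y \<and> aff p y \<le> 1 \<and> y - aff p y *\<^sub>R transversal p \<in> A}"
proof -
  define S where "S = {y. 0 \<le> aff p y \<and> aff p y \<le> 1}"
  have [measurable]: "S \<in> sets borel" unfolding S_def by measurable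
  have meas: "(\<lambda>y. y - aff p y *\<^sub>R transversal p) \<in> borel \<rightarrow>\<^sub>M borel"
    by measurable
  then have meas': "(\<lambda>y. y - aff p y *\<^sub>R transversal p) \<in> restrict_space lborel S \<rightarrow>\<^sub>M borel"
    by (intro measurable_restrict_space1) simp
  have "emeasure (hyperplane_measure p) A =
    emeasure lborel ((\<lambda>y. y - aff p y *\<^sub>R transversal p) -` A \<inter> S)"
    unfolding hyperplane_measure_def S_def[symmetric]
    by (subst emeasure_distr[OF meas' assms], subst emeasure_restrict_space)
      (auto simp: space_restrict_space)
  also have "(\<lambda>y. y - aff p y *\<^sub>R transversal p) -` A \<inter> S =
      {y. 0 \<le> aff p y \<and> aff p y \<le> 1 \<and> y - aff p y *\<^sub>R transversal p \<in> A}"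
    by (auto simp: S_def)
  finally show ?thesis .
qed

lemma emeasure_hyperplane_measure_bounded:
  assumes "A \<in> sets borel" "bounded A"
  shows "emeasure (hyperplane_measure p) A < \<infinity>"
proof -
  obtain R where R: "\<And>x. x \<in> A \<Longrightarrow> norm x \<le> R"
    using assms(2) by (auto simp: bounded_iff)
  have "norm y \<le> R + norm (transversal p)"
    if "0 \<le> aff p y" "aff p y \<le> 1" "y - aff p y *\<^sub>R transversal p \<in> A" for y
  proof -
    have "norm y \<le> norm (y - aff p y *\<^sub>R transversal p) + norm (aff p y *\<^sub>R transversal p)"
      using norm_triangle_ineq[of "y - aff p y *\<^sub>R transversal p" "aff p y *\<^sub>R transversal p"] by simp
    also have "\<dots> \<le> R + norm (transversal p)"
      using R[OF that(3)] that(1,2) by (intro add_mono) (auto intro: mult_left_le_one_le)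
    finally show ?thesis .
  qed
  then have "bounded {y. 0 \<le> aff p y \<and> aff p y \<le> 1 \<and> y - aff p y *\<^sub>R transversal p \<in> A}"
    unfolding bounded_iff by blast
  then show ?thesis
    using emeasure_bounded_finite by (simp add: emeasure_hyperplane_measure[OF assms(1)])
qed

lemma sigma_finite_hyperplane_measure:
  "sigma_finite_measure (hyperplane_measure (p :: 'n::finite affine_fun))"
  unfolding sigma_finite_measure_def
proof (intro exI conjI ballI)
  show "countable (range (\<lambda>n::nat. cball (0::real ^ 'n) n))" by simp
  show "\<Union> (range (\<lambda>n::nat. cball (0::real ^ 'n) n)) = space (hyperplane_measure p)"
    by (auto simp: real_arch_simple)
  fix A assume "A \<in> range (\<lambda>n::nat. cball (0::real ^ 'n) n)"
  then show "emeasure (hyperplane_measure p) A \<noteq> \<infinity>"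
    using emeasure_hyperplane_measure_bounded[of A p] by auto
qed auto

lemma set_integrable_hyperplane_measure:
  fixes g :: "real ^ 'n::finite \<Rightarrow> real"
  assumes "compact S" "continuous_on S g"
  shows "set_integrable (hyperplane_measure p) S g"
proof -
  obtain B where B: "\<And>x. x \<in> S \<Longrightarrow> \<bar>g x\<bar> \<le> B"
    using compact_imp_bounded[OF compact_continuous_image[OF assms(2,1)]]
    by (auto simp: bounded_iff)
  have S: "S \<in> sets borel" using assms(1) by (rule borel_compact)
  have fin: "emeasure (hyperplane_measure p) S < \<infinity>"
    using emeasure_hyperplane_measure_bounded[OF S compact_imp_bounded[OF assms(1)]] .
  show ?thesis
    unfolding set_integrable_def
  proof (rule integrableI_bounded_set[where A=S and B=B])
    show "(\<lambda>x. indicator S x *\<^sub>R g x) \<in> borel_measurable (hyperplane_measure p)"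
      using borel_measurable_continuous_on_indicator[OF S assms(2)]
      by (simp add: measurable_cong_sets[OF sets_hyperplane_measure refl])
  qed (use S fin B in \<open>auto intro!: AE_I2 simp: indicator_def\<close>)
qed

lemma closed_Delta: "closed (Delta L)"
proof -
  have "closed (\<Inter>j. {x. 0 \<le> aff (L j) x})"
    by (intro closed_INT ballI closed_Collect_le continuous_on_aff continuous_on_const)
  then show ?thesis by (simp add: Delta_def Collect_all_eq)
qed

lemma closed_facet: "closed (facet L j)"
  unfolding facet_def
  by (intro closed_Int closed_Delta closed_Collect_eq continuous_on_aff continuous_on_const)

text \<open>
  Disintegrate Lebesgue measure along the hyperplane of the facet and rescale the transversal
  coordinate \<open>t = s / (n + 1)\<close>.  The factor \<open>n + 1\<close> is absorbed, the integrand becomes \<open>ramp' s\<close>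
  times a function that converges to \<open>h\<close> on the relative interior of the facet and to \<open>0\<close> off the
  facet, and \<open>ramp'\<close> has integral \<open>1\<close>.
\<close>

lemma boundary_layer_limit:
  fixes L :: "'d::finite \<Rightarrow> 'n::finite affine_fun"
  assumes bounded: "bounded (Delta L)" and nz: "fst (L j) \<noteq> 0"
    and generic: "\<And>k. k \<noteq> j \<Longrightarrow> AE x in hyperplane_measure (L j). aff (L k) x \<noteq> 0"
    and h: "continuous_on (Delta L) h"
  shows "(\<lambda>n. \<integral>y. indicator (Delta L) y * (h y * (real (Suc n) * ramp' (real (Suc n) * aff (L j) y)
      * (\<Prod>k\<in>UNIV - {j}. ramp (real (Suc n) * aff (L k) y)))) \<partial>lborel)
    \<longlonglongrightarrow> (LINT x:facet L j|hyperplane_measure (L j). h x)"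
proof -
  define w where "w = transversal (L j)"
  define \<sigma> where "\<sigma> = hyperplane_measure (L j)"
  define \<Phi> where "\<Phi> n y = indicator (Delta L) y * (h y * (real (Suc n) * ramp' (real (Suc n) * aff (L j) y)
      * (\<Prod>k\<in>UNIV - {j}. ramp (real (Suc n) * aff (L k) y))))" for n y
  interpret \<sigma>: sigma_finite_measure \<sigma>
    unfolding \<sigma>_def by (rule sigma_finite_hyperplane_measure)
  interpret P: pair_sigma_finite \<sigma> lborel ..
  have [measurable_cong]: "sets \<sigma> = sets borel" by (simp add: \<sigma>_def)
  have sp [measurable_cong]: "sets (\<sigma> \<Otimes>\<^sub>M lborel) = sets (borel \<Otimes>\<^sub>M borel)"
    by (rule sets_pair_measure_cong) (simp_all add: \<sigma>_def)
  have space [simp]: "space \<sigma> = UNIV" by (simp add: \<sigma>_def)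
  have aff_w: "aff (L j) (x + t *\<^sub>R w) = aff (L j) x + t" for x t
    unfolding w_def by (rule aff_transversal[OF nz])
  have cpt: "compact (Delta L)"
    using bounded closed_Delta by (simp add: compact_eq_bounded_closed)
  have [measurable]: "Delta L \<in> sets borel" "facet L j \<in> sets borel"
    using closed_Delta closed_facet by (auto intro: borel_closed)
  have h_meas [measurable]: "(\<lambda>y. indicator (Delta L) y * h y) \<in> borel_measurable borel"
    using borel_measurable_continuous_on_indicator[OF _ h] by simp
  have [measurable]: "ramp \<in> borel_measurable borel" "ramp' \<in> borel_measurable borel"
    by (auto intro!: borel_measurable_continuous_onI continuous_on_ramp continuous_on_ramp')
  \<comment> \<open>The integrand regrouped so that each factor is Borel measurable on the whole space: nothing is known about \<open>h\<close> off the polytope.\<close>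
  have \<Phi>_eq: "\<Phi> n y = (indicator (Delta L) y * h y) * (real (Suc n) * ramp' (real (Suc n) * aff (L j) y)
      * (\<Prod>k\<in>UNIV - {j}. ramp (real (Suc n) * aff (L k) y)))" for n y
    by (simp add: \<Phi>_def)
  have \<Phi>_meas [measurable]: "\<Phi> n \<in> borel_measurable borel" for n
    unfolding \<Phi>_eq by measurable
  have \<Phi>_int: "integrable lborel (\<Phi> n)" for n
  proof -
    have "integrable lborel (\<lambda>y. indicator (Delta L) y *\<^sub>R (h y * (real (Suc n) * ramp' (real (Suc n) * aff (L j) y)
      * (\<Prod>k\<in>UNIV - {j}. ramp (real (Suc n) * aff (L k) y)))))"
      by (intro borel_integrable_compact cpt continuous_intros h
          continuous_on_compose2[OF continuous_on_ramp] continuous_on_compose2[OF continuous_on_ramp']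
          continuous_on_aff) auto
    then show ?thesis by (simp add: \<Phi>_def[abs_def] del: of_nat_Suc)
  qed
  obtain M where M0: "0 < M" and M: "\<And>y. y \<in> Delta L \<Longrightarrow> \<bar>h y\<bar> \<le> M"
    using compact_imp_bounded[OF compact_continuous_image[OF h cpt]] by (auto simp: bounded_pos)
  have "compact ((\<lambda>y. y - aff (L j) y *\<^sub>R w) ` Delta L)"
    by (intro compact_continuous_image cpt continuous_intros continuous_on_aff)
  then have "\<exists>R. \<forall>y\<in>Delta L. norm (y - aff (L j) y *\<^sub>R w) \<le> R"
    by (auto dest!: compact_imp_bounded simp: bounded_iff)
  then obtain R where R: "\<And>y. y \<in> Delta L \<Longrightarrow> norm (y - aff (L j) y *\<^sub>R w) \<le> R"
    by blast
  have prod_le_1: "0 \<le> (\<Prod>k\<in>UNIV - {j}. ramp (f k))" "(\<Prod>k\<in>UNIV - {j}. ramp (f k)) \<le> 1" for f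
    by (auto intro!: prod_nonneg prod_le_1 ramp_nonneg ramp_le_1)
  \<comment> \<open>The integrand in the coordinates \<open>(x, s)\<close>, with the Jacobian \<open>1 / (n + 1)\<close> of \<open>t = s / (n + 1)\<close>.\<close>
  define \<Psi> where "\<Psi> n = (\<lambda>(x, s). \<Phi> n (x + (s / real (Suc n)) *\<^sub>R w) / real (Suc n))" for n
  have [measurable]: "\<Psi> n \<in> borel_measurable (\<sigma> \<Otimes>\<^sub>M lborel)" for n
    unfolding \<Psi>_def by measurable
  have AE: "AE z in \<sigma> \<Otimes>\<^sub>M lborel. aff (L j) (fst z) = 0 \<and> (\<forall>k. k \<noteq> j \<longrightarrow> aff (L k) (fst z) \<noteq> 0)"
  proof (rule P.AE_pair_measure)
    show "{z \<in> space (\<sigma> \<Otimes>\<^sub>M lborel). aff (L j) (fst z) = 0 \<and> (\<forall>k. k \<noteq> j \<longrightarrow> aff (L k) (fst z) \<noteq> 0)}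
        \<in> sets (\<sigma> \<Otimes>\<^sub>M lborel)" by measurable
    have "AE x in \<sigma>. \<forall>k. k \<noteq> j \<longrightarrow> aff (L k) x \<noteq> 0"
      unfolding \<sigma>_def AE_all_countable using generic by auto
    moreover have "AE x in \<sigma>. aff (L j) x = 0"
      unfolding \<sigma>_def by (rule hyperplane_measure_concentrated[OF nz])
    ultimately show "AE x in \<sigma>. AE y in lborel. aff (L j) (fst (x, y)) = 0 \<and>
        (\<forall>k. k \<noteq> j \<longrightarrow> aff (L k) (fst (x, y)) \<noteq> 0)"
      by eventually_elim auto
  qed
  have bound: "\<bar>\<Psi> n (x, s)\<bar> \<le> M * (indicator (cball 0 R) x * ramp' s)"
    if "aff (L j) x = 0" for n x s
  proof (cases "x + (s / real (Suc n)) *\<^sub>R w \<in> Delta L")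
    case True
    have x: "x \<in> cball 0 R"
      using R[OF True] that by (simp add: aff_w)
    have "\<bar>\<Psi> n (x, s)\<bar> = \<bar>h (x + (s / real (Suc n)) *\<^sub>R w)\<bar> * ramp' s *
        (\<Prod>k\<in>UNIV - {j}. ramp (real (Suc n) * aff (L k) (x + (s / real (Suc n)) *\<^sub>R w)))"
      using True that prod_le_1(1) ramp'_nonneg
      by (simp add: \<Psi>_def \<Phi>_def aff_w abs_mult abs_prod ramp_nonneg del: of_nat_Suc)
    also have "\<dots> \<le> M * ramp' s * 1"
      by (intro mult_mono mult_nonneg_nonneg M[OF True] prod_le_1 ramp'_nonneg less_imp_le[OF M0])
        (rule order_refl abs_ge_zero)+
    finally show ?thesis using x by simp
  next
    case False

    then have "\<Psi> n (x, s) = 0" by (simp add: \<Psi>_def \<Phi>_def)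
    moreover have "0 \<le> M * (indicator (cball 0 R) x * ramp' s)"
      using M0 ramp'_nonneg[of s] by simp
    ultimately show ?thesis by linarith
  qed
  have cball_int: "integrable \<sigma> (\<lambda>x. indicator (cball 0 R) x :: real)"
    using emeasure_hyperplane_measure_bounded[of "cball 0 R" "L j"]
    by (auto simp: \<sigma>_def less_top)
  have dom: "integrable (\<sigma> \<Otimes>\<^sub>M lborel) (\<lambda>(x, s). M * (indicator (cball 0 R) x * ramp' s))"
  proof (rule P.Fubini_integrable)
    have "integrable \<sigma> (\<lambda>x. M * indicator (cball 0 R) x)"
      using cball_int by simp
    moreover have "(\<integral>s. norm (M * (indicator (cball 0 R) x * ramp' s)) \<partial>lborel)
        = M * indicator (cball 0 R) x" for x :: "real ^ 'n"
      using M0 ramp'_nonneg integral_ramp' integrable_ramp' by (simp add: abs_mult)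
    ultimately show "integrable \<sigma> (\<lambda>x. \<integral>s. norm (case (x, s) of (x, s) \<Rightarrow>
        M * (indicator (cball 0 R) x * ramp' s)) \<partial>lborel)" by (simp only: prod.case)
    have [measurable]: "cball (0 :: real ^ 'n) R \<in> sets borel" by simp
    show "(\<lambda>(x, s). M * (indicator (cball 0 R) x * ramp' s)) \<in> borel_measurable (\<sigma> \<Otimes>\<^sub>M lborel)"
      by measurable
  qed (use integrable_ramp' in auto)
  \<comment> \<open>The points \<open>x\<close> where another \<open>L\<^sub>k\<close> vanishes are excluded: there the product of ramps need not converge to \<open>0\<close> or \<open>1\<close>.\<close>
  have lim: "(\<lambda>n. \<Psi> n (x, s)) \<longlonglongrightarrow> indicator (facet L j) x * h x * ramp' s"
    if x: "aff (L j) x = 0" "\<And>k. k \<noteq> j \<Longrightarrow> aff (L k) x \<noteq> 0" for x s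
  proof (cases "s \<le> 0")
    case True
    then show ?thesis using x(1) by (simp add: \<Psi>_def \<Phi>_def aff_w ramp'_eq_0)
  next
    case False
    define y where "y n = x + (s / real (Suc n)) *\<^sub>R w" for n
    have \<Psi>_eq: "\<Psi> n (x, s) = \<Phi> n (y n) / real (Suc n)" for n
      by (simp add: \<Psi>_def y_def)
    have "(\<lambda>n. x + (s * inverse (real (Suc n))) *\<^sub>R w) \<longlonglongrightarrow> x + (s * 0) *\<^sub>R w"
      by (intro tendsto_intros LIMSEQ_inverse_real_of_nat)
    then have y: "y \<longlonglongrightarrow> x" by (simp add: y_def[abs_def] divide_inverse)
    have aff_y: "(\<lambda>n. aff p (y n)) \<longlonglongrightarrow> aff p x" for p
      using y by (auto simp: aff_def intro!: tendsto_intros)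
    show ?thesis
    proof (cases "\<exists>k. aff (L k) x < 0")
      case True
      then obtain k where k: "aff (L k) x < 0" by blast
      have "\<forall>\<^sub>F n in sequentially. aff (L k) (y n) < 0"
        using order_tendstoD(2)[OF aff_y k] .
      then have "\<forall>\<^sub>F n in sequentially. \<Psi> n (x, s) = 0"
      proof eventually_elim
        case (elim n)
        then have "y n \<notin> Delta L" by (auto simp: Delta_def not_le)
        then show ?case by (simp add: \<Psi>_eq \<Phi>_def)
      qed
      moreover have "x \<notin> facet L j"
        using k by (auto simp: facet_def Delta_def not_le)
      ultimately show ?thesis by (simp add: tendsto_eventually)
    next
      case nonneg: False
      then have pos: "aff (L k) x > 0" if "k \<noteq> j" for k
        using x(2)[OF that] by (meson linorder_neqE_linordered_idom)
      have x_facet: "x \<in> facet L j"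
        using nonneg x(1) by (auto simp: facet_def Delta_def not_less)
      have "\<forall>\<^sub>F n in sequentially. \<forall>k. k \<noteq> j \<longrightarrow> aff (L k) (y n) > 0"
        using order_tendstoD(1)[OF aff_y pos] by (intro eventually_all_finite) auto
      then have y_Delta: "\<forall>\<^sub>F n in sequentially. y n \<in> Delta L"
      proof eventually_elim
        case (elim n)
        have "0 \<le> aff (L k) (y n)" for k
          using elim \<open>\<not> s \<le> 0\<close> x(1) by (cases "k = j") (auto simp: y_def aff_w less_imp_le)
        then show ?case by (simp add: Delta_def)
      qed
      have "(\<lambda>n. h (y n)) \<longlonglongrightarrow> h x"
        using continuous_on_tendsto_compose[OF h y _ y_Delta] x_facet by (simp add: facet_def)
      moreover have "(\<lambda>n. ramp (real (Suc n) * aff (L k) (y n))) \<longlonglongrightarrow> 1" if "k \<noteq> j" for k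
      proof (rule filterlim_compose[OF ramp_at_top])
        have "filterlim (\<lambda>n. real (Suc n)) at_top sequentially"
          using filterlim_compose[OF filterlim_real_sequentially filterlim_Suc] .
        then show "filterlim (\<lambda>n. real (Suc n) * aff (L k) (y n)) at_top sequentially"
          using filterlim_tendsto_pos_mult_at_top[OF aff_y pos[OF that]] by (simp add: mult.commute)
      qed
      ultimately have "(\<lambda>n. 1 * (h (y n) * (ramp' s * (\<Prod>k\<in>UNIV - {j}. ramp (real (Suc n) * aff (L k) (y n))))))
        \<longlonglongrightarrow> 1 * (h x * (ramp' s * (\<Prod>k\<in>UNIV - {j}. 1)))"
        by (intro tendsto_intros) auto
      moreover have "\<forall>\<^sub>F n in sequentially. \<Psi> n (x, s) =
          1 * (h (y n) * (ramp' s * (\<Prod>k\<in>UNIV - {j}. ramp (real (Suc n) * aff (L k) (y n)))))"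
        using y_Delta
      proof eventually_elim
        case (elim n)
        have "real (Suc n) * aff (L j) (y n) = s" using x(1) by (simp add: y_def aff_w)
        with elim show ?case
          by (simp add: \<Psi>_eq \<Phi>_def del: of_nat_Suc)
      qed
      ultimately show ?thesis
        using x_facet by (simp add: tendsto_cong)
    qed
  qed
  have h_facet: "integrable \<sigma> (\<lambda>x. indicator (facet L j) x * h x)"
    using set_integrable_hyperplane_measure[of "facet L j" h "L j"] cpt closed_facet[of L j] h
    by (auto simp: set_integrable_def \<sigma>_def facet_def compact_Int_closed
        closed_Collect_eq continuous_on_aff continuous_on_const intro: continuous_on_subset)
  have limit_meas: "(\<lambda>(x, s). indicator (facet L j) x * h x * ramp' s) \<in> borel_measurable (\<sigma> \<Otimes>\<^sub>M lborel)"
    using borel_measurable_integrable[OF h_facet] by measurable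
  have AE_bound: "AE z in \<sigma> \<Otimes>\<^sub>M lborel. norm (\<Psi> n z) \<le> (case z of (x, s) \<Rightarrow> M * (indicator (cball 0 R) x * ramp' s))" for n
    using AE by eventually_elim (use bound in auto)
  have AE_lim: "AE z in \<sigma> \<Otimes>\<^sub>M lborel. (\<lambda>n. \<Psi> n z) \<longlonglongrightarrow> (case z of (x, s) \<Rightarrow> indicator (facet L j) x * h x * ramp' s)"
    using AE by eventually_elim (use lim in auto)
  note DCT = limit_meas _ dom AE_lim AE_bound
  have \<Psi>_int: "integrable (\<sigma> \<Otimes>\<^sub>M lborel) (\<Psi> n)" for n
    by (rule integrable_dominated_convergence2[OF DCT]) simp
  have lim_int: "(\<lambda>n. integral\<^sup>L (\<sigma> \<Otimes>\<^sub>M lborel) (\<Psi> n))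
      \<longlonglongrightarrow> (\<integral>(x, s). indicator (facet L j) x * h x * ramp' s \<partial>(\<sigma> \<Otimes>\<^sub>M lborel))"
    by (rule integral_dominated_convergence[OF DCT]) simp
  have "(\<integral>(x, s). indicator (facet L j) x * h x * ramp' s \<partial>(\<sigma> \<Otimes>\<^sub>M lborel))
      = (\<integral>x. (\<integral>s. indicator (facet L j) x * h x * ramp' s \<partial>lborel) \<partial>\<sigma>)"
    by (subst P.integral_fst'[symmetric])
      (use integrable_dominated_convergence[OF DCT] in auto)
  also have "\<dots> = (LINT x:facet L j|hyperplane_measure (L j). h x)"
    by (simp add: integral_ramp' set_lebesgue_integral_def \<sigma>_def)
  finally have lim_val: "(\<integral>(x, s). indicator (facet L j) x * h x * ramp' s \<partial>(\<sigma> \<Otimes>\<^sub>M lborel))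
      = (LINT x:facet L j|hyperplane_measure (L j). h x)" .
  have "(\<integral>y. \<Phi> n y \<partial>lborel) = integral\<^sup>L (\<sigma> \<Otimes>\<^sub>M lborel) (\<Psi> n)" for n
  proof -
    have map: "(\<lambda>(x, t). x + t *\<^sub>R w) \<in> \<sigma> \<Otimes>\<^sub>M lborel \<rightarrow>\<^sub>M borel" by measurable
    have lb: "lborel = distr (\<sigma> \<Otimes>\<^sub>M lborel) borel (\<lambda>(x, t). x + t *\<^sub>R w)"
      unfolding \<sigma>_def w_def by (rule hyperplane_measure_disintegration[OF nz, symmetric])
    have int: "integrable (\<sigma> \<Otimes>\<^sub>M lborel) (\<lambda>z. \<Phi> n (case z of (x, t) \<Rightarrow> x + t *\<^sub>R w))"
      using \<Phi>_int[of n] by (subst (asm) lb) (simp add: integrable_distr_eq[OF map])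
    have "(\<integral>y. \<Phi> n y \<partial>lborel) = (\<integral>z. \<Phi> n (case z of (x, t) \<Rightarrow> x + t *\<^sub>R w) \<partial>(\<sigma> \<Otimes>\<^sub>M lborel))"
      by (subst lb) (simp add: integral_distr[OF map])
    also have "\<dots> = (\<integral>x. (\<integral>t. \<Phi> n (x + t *\<^sub>R w) \<partial>lborel) \<partial>\<sigma>)"
      using P.integral_fst'[OF int] by simp
    also have "\<dots> = (\<integral>x. (\<integral>s. \<Psi> n (x, s) \<partial>lborel) \<partial>\<sigma>)"
    proof (rule Bochner_Integration.integral_cong[OF refl])
      fix x
      show "(\<integral>t. \<Phi> n (x + t *\<^sub>R w) \<partial>lborel) = (\<integral>s. \<Psi> n (x, s) \<partial>lborel)"
        using lborel_integral_real_affine[of "inverse (real (Suc n))" "\<lambda>t. \<Phi> n (x + t *\<^sub>R w)" 0]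
        by (simp add: \<Psi>_def divide_inverse mult.commute del: of_nat_Suc)
    qed
    also have "\<dots> = integral\<^sup>L (\<sigma> \<Otimes>\<^sub>M lborel) (\<Psi> n)"
      by (rule P.integral_fst'[OF \<Psi>_int])
    finally show ?thesis .
  qed
  then show ?thesis
    using lim_int by (simp add: lim_val \<Phi>_def)
qed

section \<open>The divergence theorem on the polytope\<close>

lemma AE_aff_neq_0:
  assumes "fst p \<noteq> 0"
  shows "AE x in lborel. aff p x \<noteq> 0"
proof (rule AE_I')
  have "negligible {x. fst p \<bullet> x = - snd p}"
    using assms by (intro negligible_hyperplane) auto
  then show "{x. aff p x = 0} \<in> null_sets lborel"
    by (simp add: negligible_iff_null_sets null_sets_completion_iff aff_def eq_neg_iff_add_eq_0)
qed auto

lemma interior_Delta: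
  fixes L :: "'d::finite \<Rightarrow> 'n::finite affine_fun"
  assumes "\<And>j. fst (L j) \<noteq> 0"
  shows "interior (Delta L) = {x. \<forall>j. 0 < aff (L j) x}"
proof -
  have "interior {x. 0 \<le> aff (L j) x} = {x. 0 < aff (L j) x}" for j
  proof -
    have "{x. 0 \<le> aff (L j) x} = {x. fst (L j) \<bullet> x \<ge> - snd (L j)}"
      "{x. 0 < aff (L j) x} = {x. fst (L j) \<bullet> x > - snd (L j)}"
      by (auto simp: aff_def)
    then show ?thesis using interior_halfspace_ge[OF assms] by simp
  qed
  note halfspace = this
  show ?thesis
  proof
    have "Delta L \<subseteq> {x. 0 \<le> aff (L j) x}" for j by (auto simp: Delta_def)
    from interior_mono[OF this] show "interior (Delta L) \<subseteq> {x. \<forall>j. 0 < aff (L j) x}"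
      by (auto simp: halfspace)
    have "open (\<Inter>j. {x. 0 < aff (L j) x})"
      by (intro open_INT ballI open_Collect_less continuous_on_aff continuous_on_const) auto
    then have "open {x. \<forall>j. 0 < aff (L j) x}" by (simp add: Collect_all_eq)
    then show "{x. \<forall>j. 0 < aff (L j) x} \<subseteq> interior (Delta L)"
      by (intro interior_maximal) (auto simp: Delta_def less_imp_le)
  qed
qed

lemma AE_interior_Delta:
  fixes L :: "'d::finite \<Rightarrow> 'n::finite affine_fun"
  assumes "\<And>j. fst (L j) \<noteq> 0"
  shows "AE x in lborel. x \<in> Delta L \<longleftrightarrow> x \<in> interior (Delta L)"
proof -
  have "AE x in lborel. \<forall>j. aff (L j) x \<noteq> 0"
    using AE_aff_neq_0[OF assms] by (simp add: AE_all_countable)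
  then show ?thesis
    by eventually_elim (unfold interior_Delta[OF assms], auto simp: Delta_def less_le)
qed

text \<open>
  The vector field times the product of the cutoffs is a \<open>C\<^sup>1\<close> field with compact support, so its divergence
  has integral \<open>0\<close>.  The derivative falls either on the field, which gives the volume integral in the
  limit, or on the cutoff of one \<open>L\<^sub>j\<close>, which gives the integral over the facet \<open>j\<close>.  The minus sign appears
  since the normals \<open>dL\<^sub>j\<close> point inward.
\<close>

theorem divergence_theorem_Delta:
  fixes L :: "'d::finite \<Rightarrow> 'n::finite affine_fun" and V :: "'n \<Rightarrow> real ^ 'n \<Rightarrow> real"
  assumes bounded: "bounded (Delta L)" and nz: "\<And>j. fst (L j) \<noteq> 0"
    and generic: "\<And>j k. k \<noteq> j \<Longrightarrow> AE x in hyperplane_measure (L j). aff (L k) x \<noteq> 0"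
    and U: "open U" "Delta L \<subseteq> U" and V: "\<And>i. Ck_on 1 U (V i)"
  shows "(LINT x:Delta L|lborel. \<Sum>i\<in>UNIV. pderivative i (V i) x)
    = - (\<Sum>j\<in>UNIV. LINT x:facet L j|hyperplane_measure (L j). \<Sum>i\<in>UNIV. V i x * fst (L j) $ i)"
proof -
  define cut where "cut n x = (\<Prod>j\<in>UNIV. ramp (real (Suc n) * aff (L j) x))" for n x
  \<comment> \<open>\<open>E n j\<close> times \<open>dL\<^sub>j\<close> is the part of the gradient of the cutoff that comes from the facet \<open>j\<close>.\<close>
  define E where "E n j x = real (Suc n) * ramp' (real (Suc n) * aff (L j) x)
      * (\<Prod>k\<in>UNIV - {j}. ramp (real (Suc n) * aff (L k) x))" for n j x
  define G where "G n i x = cut n x * pderivative i (V i) x + V i x * (\<Sum>j\<in>UNIV. fst (L j) $ i * E n j x)" for n i x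
  have cpt: "compact (Delta L)"
    using bounded closed_Delta by (simp add: compact_eq_bounded_closed)
  have V_cont: "continuous_on (Delta L) (V i)" for i
    using Ck_on_continuous[OF V] U(2) by (rule continuous_on_subset)
  have dV_cont: "continuous_on (Delta L) (pderivative i (V i))" for i
    using V[of i] U(2) by (auto intro: continuous_on_subset)
  have cut_cont: "continuous_on S (cut n)" for S n
    unfolding cut_def by (intro continuous_intros continuous_on_compose2[OF continuous_on_ramp] continuous_on_aff) auto
  have E_cont: "continuous_on S (E n j)" for S n j
    unfolding E_def by (intro continuous_intros continuous_on_compose2[OF continuous_on_ramp]
        continuous_on_compose2[OF continuous_on_ramp'] continuous_on_aff) auto
  have cut_out: "cut n x = 0" and E_out: "E n j x = 0" if out: "x \<notin> Delta L" for n j x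
  proof -
    obtain k where "aff (L k) x < 0" using out by (auto simp: Delta_def not_le)
    then have *: "real (Suc n) * aff (L k) x \<le> 0" by (simp add: mult_le_0_iff)
    then show "cut n x = 0" unfolding cut_def by (intro prod_zero) (auto intro: ramp_eq_0)
    show "E n j x = 0"
    proof (cases "k = j")
      case True
      then show ?thesis using * by (simp add: E_def ramp'_eq_0 del: of_nat_Suc)
    next
      case False
      then have "(\<Prod>k\<in>UNIV - {j}. ramp (real (Suc n) * aff (L k) x)) = 0"
        using * by (intro prod_zero) (auto intro: ramp_eq_0)
      then show ?thesis by (simp add: E_def)
    qed
  qed
  have cut_bounds: "0 \<le> cut n x" "cut n x \<le> 1" for n x
    unfolding cut_def by (auto intro!: prod_nonneg prod_le_1 ramp_nonneg ramp_le_1)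
  have cut_der: "(cut n has_derivative (\<lambda>h. \<Sum>j\<in>UNIV. (fst (L j) \<bullet> h) * E n j x)) (at x)" for n x
  proof -
    have "((\<lambda>x. ramp (real (Suc n) * aff (L j) x)) has_derivative
        (\<lambda>h. ramp' (real (Suc n) * aff (L j) x) * (real (Suc n) * (fst (L j) \<bullet> h)))) (at x)" for j
      by (rule has_derivative_compose[OF _ DERIV_ramp[unfolded has_field_derivative_def]])
        (auto intro!: derivative_eq_intros)
    from has_derivative_prod[of UNIV "\<lambda>j x. ramp (real (Suc n) * aff (L j) x)", OF this]
    show ?thesis
      unfolding cut_def[abs_def] E_def
      by (rule has_derivative_eq_rhs) (simp add: mult_ac)
  qed
  \<comment> \<open>Off \<open>U\<close> nothing is known about \<open>V\<close>, but there the product vanishes on a neighbourhood of the point.\<close>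
  have der: "\<exists>D. ((\<lambda>x. cut n x * V i x) has_derivative D) (at x) \<and> D (axis i 1) = G n i x" for n i x
  proof (cases "x \<in> U")
    case True
    have "(V i has_derivative (\<lambda>h. \<Sum>k\<in>UNIV. h $ k * pderivative k (V i) x)) (at x)"
      by (rule Ck_on_has_derivative[OF _ U(1) True, of 0]) (use V in simp)
    from has_derivative_mult[OF cut_der[of n] this] show ?thesis
      by - (rule exI, rule conjI, assumption, simp only: sum_axis_mult,
        simp add: G_def inner_axis mult_ac)
  next
    case False
    then have x: "x \<in> - Delta L" using U(2) by auto
    have "((\<lambda>x. cut n x * V i x) has_derivative (\<lambda>_. 0)) (at x)"
      by (rule has_derivative_transform_within_open[OF has_derivative_const open_Compl[OF closed_Delta] x])
        (simp add: cut_out)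
    then show ?thesis
      using x by (intro exI[of _ "\<lambda>_. 0"]) (simp add: G_def cut_out E_out)
  qed
  have G_int: "integrable lborel (G n i)" and G_0: "(\<integral>x. G n i x \<partial>lborel) = 0" for n i
  proof -
    have "continuous_on (Delta L) (G n i)"
      unfolding G_def by (intro continuous_intros cut_cont E_cont V_cont dV_cont)
    from compact_imp_bounded[OF compact_continuous_image[OF this cpt]]
    obtain M where M0: "0 < M" and M: "\<And>x. x \<in> Delta L \<Longrightarrow> \<bar>G n i x\<bar> \<le> M"
      by (auto simp: bounded_pos)
    have bd: "\<bar>G n i x\<bar> \<le> M" for x
      using M[of x] M0 by (cases "x \<in> Delta L") (auto simp: G_def cut_out E_out)
    have cont: "continuous_on UNIV (\<lambda>x. cut n x * V i x)"
      unfolding continuous_on_eq_continuous_at[OF open_UNIV]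
      by (metis der has_derivative_continuous)
    have line: "((\<lambda>t. cut n (x + t *\<^sub>R axis i 1) * V i (x + t *\<^sub>R axis i 1)) has_real_derivative G n i x) (at 0)" for x
    proof -
      obtain D where "((\<lambda>x. cut n x * V i x) has_derivative D) (at (x + 0 *\<^sub>R axis i 1))"
          "D (axis i 1) = G n i x"
        using der[of n i x] by auto
      with has_real_derivative_along_line[of "\<lambda>x. cut n x * V i x" D x 0 "axis i 1"]
      show ?thesis by simp
    qed
    show "integrable lborel (G n i)" "(\<integral>x. G n i x \<partial>lborel) = 0"
      by (rule integral_directional_derivative[OF cont bounded _ line bd]; simp add: cut_out)+
  qed
  define D where "D x = (\<Sum>i\<in>UNIV. pderivative i (V i) x)" for x
  define N where "N j x = (\<Sum>i\<in>UNIV. V i x * fst (L j) $ i)" for j x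
  have D_cont: "continuous_on (Delta L) D"
    unfolding D_def by (intro continuous_intros dV_cont)
  have N_cont: "continuous_on (Delta L) (N j)" for j
    unfolding N_def by (intro continuous_intros V_cont)
  have int1: "integrable lborel (\<lambda>x. indicator (Delta L) x * (cut n x * D x))" for n
    using borel_integrable_compact[OF cpt, of "\<lambda>x. cut n x * D x"]
    by (simp add: continuous_on_mult cut_cont D_cont)
  have int2: "integrable lborel (\<lambda>x. indicator (Delta L) x * (N j x * E n j x))" for n j
    using borel_integrable_compact[OF cpt, of "\<lambda>x. N j x * E n j x"]
    by (simp add: continuous_on_mult E_cont N_cont)
  have balance: "(\<integral>x. indicator (Delta L) x * (cut n x * D x) \<partial>lborel)
      = - (\<Sum>j\<in>UNIV. \<integral>x. indicator (Delta L) x * (N j x * E n j x) \<partial>lborel)" for n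
  proof -
    have "(\<Sum>i\<in>UNIV. G n i x) = indicator (Delta L) x * (cut n x * D x)
        + (\<Sum>j\<in>UNIV. indicator (Delta L) x * (N j x * E n j x))" for x
    proof (cases "x \<in> Delta L")
      case True
      have "(\<Sum>i\<in>UNIV. \<Sum>j\<in>UNIV. V i x * (fst (L j) $ i * E n j x)) = (\<Sum>j\<in>UNIV. N j x * E n j x)"
        unfolding N_def sum_distrib_right by (subst sum.swap) (simp add: mult_ac)
      then show ?thesis
        using True by (simp add: G_def D_def sum.distrib sum_distrib_left)
    qed (simp add: G_def cut_out E_out)
    then have "(\<Sum>i\<in>UNIV. \<integral>x. G n i x \<partial>lborel) =
        (\<integral>x. indicator (Delta L) x * (cut n x * D x)
        + (\<Sum>j\<in>UNIV. indicator (Delta L) x * (N j x * E n j x)) \<partial>lborel)"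
      using G_int by (simp flip: Bochner_Integration.integral_sum)
    also have "\<dots> = (\<integral>x. indicator (Delta L) x * (cut n x * D x) \<partial>lborel)
        + (\<Sum>j\<in>UNIV. \<integral>x. indicator (Delta L) x * (N j x * E n j x) \<partial>lborel)"
      by (simp only: Bochner_Integration.integral_add[OF int1 Bochner_Integration.integrable_sum[OF int2]]
          Bochner_Integration.integral_sum[OF int2])
    finally show ?thesis by (simp add: G_0)
  qed
  have lim1: "(\<lambda>n. \<integral>x. indicator (Delta L) x * (cut n x * D x) \<partial>lborel)
      \<longlonglongrightarrow> (\<integral>x. indicator (Delta L) x * D x \<partial>lborel)"
  proof (rule integral_dominated_convergence)
    have D_int: "integrable lborel (\<lambda>x. indicator (Delta L) x * D x)"
      using borel_integrable_compact[OF cpt D_cont] by simp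
    then show "integrable lborel (\<lambda>x. \<bar>indicator (Delta L) x * D x\<bar>)"
      by (rule integrable_abs)
    from D_int show "(\<lambda>x. indicator (Delta L) x * D x) \<in> borel_measurable lborel" by simp
    show "(\<lambda>x. indicator (Delta L) x * (cut n x * D x)) \<in> borel_measurable lborel" for n
      using int1 by simp
    show "AE x in lborel. norm (indicator (Delta L) x * (cut n x * D x)) \<le> \<bar>indicator (Delta L) x * D x\<bar>" for n
      using cut_bounds[of n] by (intro AE_I2) (auto simp: abs_mult indicator_def intro: mult_left_le_one_le)
    have lim: "(\<lambda>n. cut n x) \<longlonglongrightarrow> 1" if "\<And>j. 0 < aff (L j) x" for x
    proof -
      have "(\<lambda>n. ramp (real (Suc n) * aff (L j) x)) \<longlonglongrightarrow> 1" for j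
      proof (rule filterlim_compose[OF ramp_at_top])
        have "filterlim (\<lambda>n. real (Suc n)) at_top sequentially"
          using filterlim_compose[OF filterlim_real_sequentially filterlim_Suc] .
        then show "filterlim (\<lambda>n. real (Suc n) * aff (L j) x) at_top sequentially"
          by (rule filterlim_at_top_mult_tendsto_pos[OF tendsto_const that[of j]])
      qed
      then have "(\<lambda>n. cut n x) \<longlonglongrightarrow> (\<Prod>j\<in>(UNIV::'d set). 1)"
        unfolding cut_def by (intro tendsto_prod) 
      then show ?thesis by simp
    qed
    show "AE x in lborel. (\<lambda>n. indicator (Delta L) x * (cut n x * D x)) \<longlonglongrightarrow> indicator (Delta L) x * D x"
      using AE_interior_Delta[of L, OF nz]
    proof eventually_elim
      case (elim x)
      show ?case
      proof (cases "x \<in> Delta L")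
        case True
        then have "\<And>j. 0 < aff (L j) x"
          using elim by (simp add: interior_Delta[OF nz])
        then have "(\<lambda>n. indicator (Delta L) x * (cut n x * D x)) \<longlonglongrightarrow> indicator (Delta L) x * (1 * D x)"
          by (intro tendsto_intros lim)
        then show ?thesis by simp
      qed simp
    qed
  qed
  have "(\<lambda>n. - (\<Sum>j\<in>UNIV. \<integral>x. indicator (Delta L) x * (N j x * E n j x) \<partial>lborel))
      \<longlonglongrightarrow> - (\<Sum>j\<in>UNIV. LINT x:facet L j|hyperplane_measure (L j). N j x)"
    unfolding E_def
    by (intro tendsto_minus tendsto_sum boundary_layer_limit bounded nz generic N_cont)
  then have "(\<lambda>n. \<integral>x. indicator (Delta L) x * (cut n x * D x) \<partial>lborel)
      \<longlonglongrightarrow> - (\<Sum>j\<in>UNIV. LINT x:facet L j|hyperplane_measure (L j). N j x)"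
    by (simp only: balance)
  from LIMSEQ_unique[OF lim1 this] show ?thesis
    by (simp add: set_lebesgue_integral_def D_def N_def)
qed

text \<open>
  The properties of a labelled Delzant polytope that enter the analysis.  The last one says that distinct
  facets lie in distinct hyperplanes: if \<open>L\<^sub>k\<close> vanished on a non-null subset of \<open>L\<^sub>j = 0\<close>, then
  \<open>L\<^sub>k\<close> would be a multiple of \<open>L\<^sub>j\<close> and the two facets would coincide.
\<close>

lemma Delzant_facts:
  fixes L :: "'d::finite \<Rightarrow> 'n::finite affine_fun"
  assumes "labelled_rational_Delzant \<Lambda> L"
  shows "bounded (Delta L)" "convex (Delta L)" "interior (Delta L) \<noteq> {}" "fst (L j) \<noteq> 0"
    and "k \<noteq> j \<Longrightarrow> AE x in hyperplane_measure (L j). aff (L k) x \<noteq> 0"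
proof -
  have poly: "polytope (Delta L)" and int: "interior (Delta L) \<noteq> {}"
    and bij: "bij_betw (facet L) UNIV {F. F facet_of Delta L}"
    using assms by (auto simp: labelled_rational_Delzant_def)
  show "bounded (Delta L)" "convex (Delta L)" "interior (Delta L) \<noteq> {}"
    using poly int by (auto intro: polytope_imp_bounded polytope_imp_convex)
  have "facet L j facet_of Delta L" for j
    using bij by (auto simp: bij_betw_def)
  then have facet: "facet L j \<noteq> {}" "facet L j \<noteq> Delta L" for j
    by (auto simp: facet_of_def dest: spec[of _ j])
      (metis add.right_neutral add_diff_cancel_left' diff_diff_eq2 zero_neq_one)
  show nz: "fst (L j) \<noteq> 0" for j
  proof
    assume "fst (L j) = 0"
    then have "facet L j = {} \<or> facet L j = Delta L"
      by (auto simp: facet_def aff_def)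
    then show False using facet by blast
  qed
  assume kj: "k \<noteq> j"
  \<comment> \<open>The linear part of \<open>L\<^sub>k\<close> composed with the projection that defines \<open>hyperplane_measure (L j)\<close>; it is \<open>0\<close> iff the normals are parallel.\<close>
  define a where "a = fst (L k) - (fst (L k) \<bullet> transversal (L j)) *\<^sub>R fst (L j)"
  show "AE x in hyperplane_measure (L j). aff (L k) x \<noteq> 0"
  proof (cases "a = 0")
    case False
    have aff_eq: "aff (L k) (y - aff (L j) y *\<^sub>R transversal (L j))
        = aff (a, snd (L k) - snd (L j) * (fst (L k) \<bullet> transversal (L j))) y" for y
      by (simp add: aff_def a_def algebra_simps inner_simps)
    have "AE y in lborel. aff (a, snd (L k) - snd (L j) * (fst (L k) \<bullet> transversal (L j))) y \<noteq> 0"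
      using False by (intro AE_aff_neq_0) simp
    then show ?thesis
      unfolding hyperplane_measure_def
      by (subst AE_distr_iff) (auto intro!: measurable_restrict_space1 simp: AE_restrict_space_iff aff_eq)
  next
    case True
    define c where "c = fst (L k) \<bullet> transversal (L j)"
    have k: "fst (L k) = c *\<^sub>R fst (L j)" using True by (simp add: a_def c_def)
    define b where "b = snd (L k) - c * snd (L j)"
    have aff_k: "aff (L k) x = c * aff (L j) x + b" for x
      by (simp add: aff_def k b_def algebra_simps)
    have "b \<noteq> 0"
    proof
      assume "b = 0"
      have "c \<noteq> 0" using nz[of k] k by auto
      then have "facet L k = facet L j" using aff_k \<open>b = 0\<close> by (auto simp: facet_def)
      then show False using bij kj by (auto simp: bij_betw_def inj_on_def)
    qed
    from hyperplane_measure_concentrated[OF nz[of j]] show ?thesis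
      by eventually_elim (simp add: aff_k \<open>b \<noteq> 0\<close>)
  qed
qed

section \<open>Symmetry of the Hessian and of its inverse\<close>

text \<open>
  The mean value theorem, applied first in the direction \<open>i\<close> and then in the direction \<open>j\<close>.
\<close>

lemma mixed_second_difference:
  fixes g :: "real ^ 'n::finite \<Rightarrow> real"
  assumes U: "open U" and g: "Ck_on 2 U g" and h: "0 < h"
    and sq: "\<And>s t. 0 \<le> s \<Longrightarrow> s \<le> h \<Longrightarrow> 0 \<le> t \<Longrightarrow> t \<le> h \<Longrightarrow> x + s *\<^sub>R axis i 1 + t *\<^sub>R axis j 1 \<in> U"
  shows "\<exists>s t. 0 < s \<and> s < h \<and> 0 < t \<and> t < h \<and>
    g (x + h *\<^sub>R axis i 1 + h *\<^sub>R axis j 1) - g (x + h *\<^sub>R axis i 1) - g (x + h *\<^sub>R axis j 1) + g x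
    = h * (h * pderivative j (pderivative i g) (x + s *\<^sub>R axis i 1 + t *\<^sub>R axis j 1))"
proof -
  define a :: "real ^ 'n" where "a = axis i 1"
  define b :: "real ^ 'n" where "b = axis j 1"
  have C: "Ck_on (Suc (Suc 0)) U g" "Ck_on (Suc 0) U (pderivative i g)"
    using g by (simp_all add: numeral_2_eq_2)
  have line: "((\<lambda>s. q (y + s *\<^sub>R axis k 1)) has_real_derivative pderivative k q (y + s *\<^sub>R axis k 1)) (at s)"
    if "Ck_on (Suc n) U q" "y + s *\<^sub>R axis k 1 \<in> U" for q n y k s
    using has_real_derivative_along_line[OF Ck_on_has_derivative[OF that(1) U that(2)]] by simp
  have "\<exists>s. 0 < s \<and> s < h \<and>
      (g (x + h *\<^sub>R b + h *\<^sub>R a) - g (x + h *\<^sub>R a)) - (g (x + h *\<^sub>R b + 0 *\<^sub>R a) - g (x + 0 *\<^sub>R a))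
      = (h - 0) * (pderivative i g (x + h *\<^sub>R b + s *\<^sub>R a) - pderivative i g (x + s *\<^sub>R a))"
  proof (rule MVT2[OF h])
    fix s assume s: "0 \<le> s" "s \<le> h"
    show "((\<lambda>s. g (x + h *\<^sub>R b + s *\<^sub>R a) - g (x + s *\<^sub>R a)) has_real_derivative
        pderivative i g (x + h *\<^sub>R b + s *\<^sub>R a) - pderivative i g (x + s *\<^sub>R a)) (at s)"
      unfolding a_def
      by (intro DERIV_diff line[OF C(1)])
        (use sq[OF s, of h] sq[OF s, of 0] h in \<open>auto simp: b_def add_ac\<close>)
  qed
  then obtain s where s: "0 < s" "s < h" and eq1:
      "(g (x + h *\<^sub>R b + h *\<^sub>R a) - g (x + h *\<^sub>R a)) - (g (x + h *\<^sub>R b + 0 *\<^sub>R a) - g (x + 0 *\<^sub>R a))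
      = (h - 0) * (pderivative i g (x + h *\<^sub>R b + s *\<^sub>R a) - pderivative i g (x + s *\<^sub>R a))"
    by blast
  have "\<exists>t. 0 < t \<and> t < h \<and>
      pderivative i g (x + s *\<^sub>R a + h *\<^sub>R b) - pderivative i g (x + s *\<^sub>R a + 0 *\<^sub>R b)
      = (h - 0) * pderivative j (pderivative i g) (x + s *\<^sub>R a + t *\<^sub>R b)"
  proof (rule MVT2[OF h])
    fix t assume "0 \<le> t" "t \<le> h"
    then show "((\<lambda>t. pderivative i g (x + s *\<^sub>R a + t *\<^sub>R b)) has_real_derivative
        pderivative j (pderivative i g) (x + s *\<^sub>R a + t *\<^sub>R b)) (at t)"
      unfolding b_def by (intro line[OF C(2)]) (use sq[of s t] s in \<open>auto simp: a_def\<close>)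
  qed
  then obtain t where t: "0 < t" "t < h" and eq2:
      "pderivative i g (x + s *\<^sub>R a + h *\<^sub>R b) - pderivative i g (x + s *\<^sub>R a + 0 *\<^sub>R b)
      = (h - 0) * pderivative j (pderivative i g) (x + s *\<^sub>R a + t *\<^sub>R b)"
    by blast
  show ?thesis
    using s t eq1 eq2 by (intro exI[of _ s] exI[of _ t]) (simp add: a_def b_def add_ac)
qed

text \<open>
  Schwarz's theorem: the second difference over a small square does not depend on the order of the two
  directions, and it equals \<open>h\<^sup>2\<close> times either mixed derivative at some point of the square.
\<close>

lemma pderivative_commute:
  fixes g :: "real ^ 'n::finite \<Rightarrow> real"
  assumes U: "open U" and g: "Ck_on 2 U g" and x: "x \<in> U"
  shows "pderivative j (pderivative i g) x = pderivative i (pderivative j g) x"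
proof -
  obtain r where r: "0 < r" "ball x r \<subseteq> U"
    using U x by (auto simp: open_contains_ball)
  have near: "dist x (x + s *\<^sub>R axis i 1 + t *\<^sub>R axis j 1) < d"
    if "0 \<le> s" "s < d / 2" "0 \<le> t" "t < d / 2" for s t d i j
  proof -
    have "norm (s *\<^sub>R axis i 1 + t *\<^sub>R axis j (1::real) :: real ^ 'n) \<le> s + t"
      using norm_triangle_ineq[of "s *\<^sub>R axis i 1 :: real ^ 'n" "t *\<^sub>R axis j 1"] that by simp
    moreover have "x - (x + s *\<^sub>R axis i 1 + t *\<^sub>R axis j 1) = - (s *\<^sub>R axis i 1 + t *\<^sub>R axis j (1::real))"
      by simp
    ultimately show ?thesis using that unfolding dist_norm by (simp only: norm_minus_cancel)
  qed
  have cont: "isCont (pderivative k (pderivative l g)) x" for k l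
    using g x U by (simp add: numeral_2_eq_2 continuous_on_eq_continuous_at)
  have "\<bar>pderivative j (pderivative i g) x - pderivative i (pderivative j g) x\<bar> < e" if "0 < e" for e
  proof -
    have e2: "0 < e / 2" using that by simp
    obtain d1 where d1: "0 < d1" "\<And>y. dist y x < d1 \<Longrightarrow>
        dist (pderivative j (pderivative i g) y) (pderivative j (pderivative i g) x) < e / 2"
      using cont e2 unfolding continuous_at_eps_delta by (metis dist_commute)
    obtain d2 where d2: "0 < d2" "\<And>y. dist y x < d2 \<Longrightarrow>
        dist (pderivative i (pderivative j g) y) (pderivative i (pderivative j g) x) < e / 2"
      using cont e2 unfolding continuous_at_eps_delta by (metis dist_commute)
    define d where "d = Min {r, d1, d2}"
    have d: "0 < d" "d \<le> r" "d \<le> d1" "d \<le> d2" using r d1 d2 by (auto simp: d_def)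
    define h where "h = d / 4"
    have h: "0 < h" "h < d / 2" using d by (auto simp: h_def)
    have sq: "x + s *\<^sub>R axis i 1 + t *\<^sub>R axis j 1 \<in> U"
      if "0 \<le> s" "s \<le> h" "0 \<le> t" "t \<le> h" for s t i j
      using near[of s d t i j] that h d r by (auto simp: subset_iff)
    obtain s t where st: "0 < s" "s < h" "0 < t" "t < h" and eq1:
      "g (x + h *\<^sub>R axis i 1 + h *\<^sub>R axis j 1) - g (x + h *\<^sub>R axis i 1) - g (x + h *\<^sub>R axis j 1) + g x
      = h * (h * pderivative j (pderivative i g) (x + s *\<^sub>R axis i 1 + t *\<^sub>R axis j 1))"
      using mixed_second_difference[OF U g h(1) sq, of i j] by auto
    obtain s' t' where st': "0 < s'" "s' < h" "0 < t'" "t' < h" and eq2: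
      "g (x + h *\<^sub>R axis j 1 + h *\<^sub>R axis i 1) - g (x + h *\<^sub>R axis j 1) - g (x + h *\<^sub>R axis i 1) + g x
      = h * (h * pderivative i (pderivative j g) (x + s' *\<^sub>R axis j 1 + t' *\<^sub>R axis i 1))"
      using mixed_second_difference[OF U g h(1) sq, of j i] by auto
    have "h * (h * pderivative j (pderivative i g) (x + s *\<^sub>R axis i 1 + t *\<^sub>R axis j 1))
        = h * (h * pderivative i (pderivative j g) (x + s' *\<^sub>R axis j 1 + t' *\<^sub>R axis i 1))"
      unfolding eq1[symmetric] eq2[symmetric] by (simp add: add_ac)
    then have "pderivative j (pderivative i g) (x + s *\<^sub>R axis i 1 + t *\<^sub>R axis j 1)
        = pderivative i (pderivative j g) (x + s' *\<^sub>R axis j 1 + t' *\<^sub>R axis i 1)"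
      using h by simp
    moreover have "dist (x + s *\<^sub>R axis i 1 + t *\<^sub>R axis j 1) x < d1"
      "dist (x + s' *\<^sub>R axis j 1 + t' *\<^sub>R axis i 1) x < d2"
      using near[of s d1 t i j] near[of s' d2 t' j i] st st' h d by (auto simp: dist_commute)
    ultimately show ?thesis
      using d1(2) d2(2) by (smt (verit) dist_real_def field_sum_of_halves)
  qed
  then show ?thesis
    by (metis abs_ge_zero abs_le_zero_iff diff_eq_diff_eq diff_self less_irrefl not_le zero_less_abs_iff eq_iff_diff_eq_0)
qed

lemma inner_Sum_mult: "(x::real ^ 'n::finite) \<bullet> y = (\<Sum>i\<in>UNIV. x $ i * y $ i)"
  by (simp add: inner_vec_def)

lemma symmetric_matrix_inv:
  fixes A :: "real ^ 'n::finite ^ 'n"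
  assumes sym: "transpose A = A" and pos: "\<And>v. v \<noteq> 0 \<Longrightarrow> 0 < v \<bullet> (A *v v)"
  shows "transpose (matrix_inv A) = matrix_inv A"
proof -
  have "A *v v = 0 \<Longrightarrow> v = 0" for v
    using pos[of v] by auto
  then have inv: "invertible A"
    by (simp add: invertible_left_inverse matrix_left_invertible_ker)
  let ?B = "matrix_inv A"
  have AB: "A ** ?B = mat 1"
    using inv someI_ex[of "\<lambda>A'. A ** A' = mat 1 \<and> A' ** A = mat 1"]
    by (auto simp: invertible_def matrix_inv_def)
  then have "transpose ?B ** A = mat 1"
    by (metis matrix_transpose_mul sym transpose_mat)
  then have "transpose ?B ** (A ** ?B) = ?B"
    by (simp add: matrix_mul_assoc)
  then show ?thesis by (simp add: AB)
qed

section \<open>Double integration by parts\<close>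

text \<open>
  The vector field \<open>K = w H u\<^sub>j\<close> vanishes on the facet, so at a relative interior point its derivative
  vanishes in tangential directions and is determined by the transversal direction \<open>\<tau>\<close>.  The divergence
  of \<open>K\<close> is therefore the derivative of \<open>u\<^sub>j \<bullet> K = w H(u\<^sub>j, u\<^sub>j)\<close> in the direction \<open>\<tau>\<close>, and the
  condition on \<open>dH(u\<^sub>j, u\<^sub>j)\<close> gives \<open>2 w\<close> because \<open>u\<^sub>j \<bullet> \<tau> = 1\<close>.
\<close>

lemma boundary_flux:
  fixes L :: "'d::finite \<Rightarrow> 'n::finite affine_fun" and H :: "real ^ 'n \<Rightarrow> real ^ 'n ^ 'n"
  assumes nz: "fst (L j) \<noteq> 0"
    and U: "open U" "\<xi> \<in> U"
    and H: "\<And>i k. Ck_on 1 U (\<lambda>x. H x $ i $ k)" and w: "Ck_on 1 U w"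
    and null: "\<And>x. x \<in> facet L j \<Longrightarrow> H x *v normal_vec L j = 0"
    and der: "((\<lambda>x. normal_vec L j \<bullet> (H x *v normal_vec L j))
                  has_derivative (\<lambda>h. (2 *\<^sub>R normal_vec L j) \<bullet> h)) (at \<xi>)"
    and \<xi>: "\<xi> \<in> facet L j" "\<And>k. k \<noteq> j \<Longrightarrow> 0 < aff (L k) \<xi>"
  shows "(\<Sum>k\<in>UNIV. (\<Sum>i\<in>UNIV. pderivative i (\<lambda>x. w x * H x $ i $ k) \<xi>) * normal_vec L j $ k) = 2 * w \<xi>"
proof -
  define u where "u = normal_vec L j"
  define \<tau> where "\<tau> = transversal (L j)"
  define K where "K i y = (\<Sum>k\<in>UNIV. w y * H y $ i $ k * u $ k)" for i y
  have u_\<tau>: "u \<bullet> \<tau> = 1"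
    using nz by (simp add: u_def \<tau>_def transversal_def normal_vec_def)
  have G: "Ck_on (Suc 0) U (\<lambda>x. w x * H x $ i $ k)" for i k
    using Ck_on_mult[OF U(1) w H] by simp
  have G_diff: "(\<lambda>x. w x * H x $ i $ k) differentiable (at \<xi>)" for i k
    by (rule Ck_on_differentiable[OF G U])
  have const: "(\<lambda>x. c::real) differentiable (at \<xi>)" for c by simp
  have K_Ck: "Ck_on (Suc 0) U (K i)" for i
    unfolding K_def[abs_def] by (intro Ck_on_sum Ck_on_mult U(1) G Ck_on_const)
  define dK where "dK i h = (\<Sum>l\<in>UNIV. h $ l * pderivative l (K i) \<xi>)" for i h
  have K_der: "(K i has_derivative dK i) (at \<xi>)" for i
    using Ck_on_has_derivative[OF K_Ck U] by (simp add: dK_def[abs_def])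
  have K_eq: "K i y = w y * (H y *v u) $ i" for i y
    by (simp add: K_def matrix_vector_mult_def sum_distrib_left mult.assoc)
  have tangential: "dK i h = 0" if "u \<bullet> h = 0" for i h
  proof -
    have "\<forall>\<^sub>F t in nhds 0. \<forall>k. k \<noteq> j \<longrightarrow> 0 < aff (L k) (\<xi> + t *\<^sub>R h)"
    proof (intro eventually_all_finite)
      fix k
      have "((\<lambda>t. aff (L k) (\<xi> + t *\<^sub>R h)) \<longlongrightarrow> aff (L k) (\<xi> + 0 *\<^sub>R h)) (nhds 0)"
        unfolding aff_def by (intro tendsto_intros filterlim_ident)
      then show "\<forall>\<^sub>F t in nhds 0. k \<noteq> j \<longrightarrow> 0 < aff (L k) (\<xi> + t *\<^sub>R h)"
        using \<xi>(2)[of k] by (cases "k = j") (auto dest: order_tendstoD(1))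
    qed
    then have ev: "\<forall>\<^sub>F t in nhds 0. K i (\<xi> + t *\<^sub>R h) = 0"
    proof eventually_elim
      case (elim t)
      have "aff (L j) (\<xi> + t *\<^sub>R h) = 0"
        using \<xi>(1) that by (simp add: facet_def aff_def inner_add_right u_def normal_vec_def)
      then have "\<xi> + t *\<^sub>R h \<in> facet L j"
        using elim by (auto simp: facet_def Delta_def) (metis less_eq_real_def)
      then show ?case by (simp add: K_eq u_def null)
    qed
    have "((\<lambda>t. K i (\<xi> + t *\<^sub>R h)) has_real_derivative dK i h) (at 0)"
      using has_real_derivative_along_line[of "K i" "dK i" \<xi> 0 h] K_der by simp
    then have "((\<lambda>t. 0) has_real_derivative dK i h) (at 0)"
      using DERIV_cong_ev[OF refl ev refl] by simp
    then show ?thesis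
      using DERIV_unique DERIV_const by blast
  qed
  have dK_lin: "linear (dK i)" for i
    using K_der by (rule has_derivative_linear)
  have dK_axis: "pderivative i (K i) \<xi> = u $ i * dK i \<tau>" for i
  proof -
    have "u \<bullet> (axis i 1 - u $ i *\<^sub>R \<tau>) = 0"
      using u_\<tau> by (simp add: inner_diff_right inner_axis)
    then have "dK i (axis i 1 - u $ i *\<^sub>R \<tau>) = 0" by (rule tangential)
    then have "dK i (axis i 1) = u $ i * dK i \<tau>"
      by (simp add: linear_diff[OF dK_lin] linear_cmul[OF dK_lin])
    then show ?thesis by (simp add: dK_def)
  qed
  have "((\<lambda>y. \<Sum>i\<in>UNIV. u $ i * K i y) has_derivative (\<lambda>h. \<Sum>i\<in>UNIV. u $ i * dK i h)) (at \<xi>)"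
    by (intro has_derivative_sum has_derivative_mult_right K_der)
  moreover have "((\<lambda>y. w y * (u \<bullet> (H y *v u))) has_derivative
      (\<lambda>h. w \<xi> * ((2 *\<^sub>R u) \<bullet> h) + (\<Sum>i\<in>UNIV. h $ i * pderivative i w \<xi>) * (u \<bullet> (H \<xi> *v u)))) (at \<xi>)"
    by (rule has_derivative_mult[OF Ck_on_has_derivative[OF _ U, of 0] der[folded u_def]]) (use w in simp)
  moreover have "(\<lambda>y. \<Sum>i\<in>UNIV. u $ i * K i y) = (\<lambda>y. w y * (u \<bullet> (H y *v u)))"
    by (simp add: K_eq inner_Sum_mult sum_distrib_left mult_ac)
  moreover have "H \<xi> *v u = 0" using null[OF \<xi>(1)] by (simp add: u_def)
  ultimately have "(\<lambda>h. \<Sum>i\<in>UNIV. u $ i * dK i h) = (\<lambda>h. w \<xi> * ((2 *\<^sub>R u) \<bullet> h))"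
    by (metis (no_types, lifting) has_derivative_unique add.right_neutral inner_zero_right mult_zero_right ext)
  then have "(\<Sum>i\<in>UNIV. u $ i * dK i \<tau>) = 2 * w \<xi>"
    using u_\<tau> by (simp add: fun_eq_iff)
  moreover have "pderivative i (K i) \<xi> = (\<Sum>k\<in>UNIV. pderivative i (\<lambda>x. w x * H x $ i $ k) \<xi> * u $ k)" for i
  proof -
    have "pderivative i (K i) \<xi> = (\<Sum>k\<in>UNIV. pderivative i (\<lambda>y. w y * H y $ i $ k * u $ k) \<xi>)"
      unfolding K_def[abs_def] by (rule pderivative_sum) (intro differentiable_mult G_diff const)
    also have "pderivative i (\<lambda>y. u $ k) \<xi> = 0" for k
      by (rule pderivative_eq[OF has_derivative_const])
    then have "(\<Sum>k\<in>UNIV. pderivative i (\<lambda>y. w y * H y $ i $ k * u $ k) \<xi>)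
        = (\<Sum>k\<in>UNIV. pderivative i (\<lambda>x. w x * H x $ i $ k) \<xi> * u $ k)"
      by (simp add: pderivative_mult[OF G_diff const])
    finally show ?thesis .
  qed
  ultimately have "(\<Sum>i\<in>UNIV. \<Sum>k\<in>UNIV. pderivative i (\<lambda>x. w x * H x $ i $ k) \<xi> * u $ k) = 2 * w \<xi>"
    using dK_axis by simp
  then show ?thesis
    unfolding sum_distrib_right by (subst sum.swap) (simp add: u_def)
qed

lemma set_integral_cong_AE_integrable:
  fixes g h :: "'a \<Rightarrow> real"
  assumes "set_integrable M S g" "set_integrable M S h" "AE x in M. x \<in> S \<longrightarrow> g x = h x"
  shows "(LINT x:S|M. g x) = (LINT x:S|M. h x)"
  unfolding set_lebesgue_integral_def
proof (rule integral_cong_AE)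
  show "AE x in M. indicator S x *\<^sub>R g x = indicator S x *\<^sub>R h x"
    using assms(3) by eventually_elim (auto simp: indicator_def)
qed (use assms(1,2) in \<open>auto simp: set_integrable_def\<close>)

text \<open>
  The divergence theorem for the field \<open>V\<^sub>k = \<phi> \<Sum>\<^sub>i \<partial>\<^sub>i G\<^sub>i\<^sub>k - \<Sum>\<^sub>i G\<^sub>i\<^sub>k \<partial>\<^sub>i \<phi>\<close> with \<open>G = w H\<close>.  In its divergence the
  terms with one derivative on each factor cancel by the symmetry of \<open>G\<close>; on the facets only the flux of
  the divergence of \<open>G\<close> survives.
\<close>

theorem Hessian_integration_by_parts:
  fixes L :: "'d::finite \<Rightarrow> 'n::finite affine_fun" and H :: "real ^ 'n \<Rightarrow> real ^ 'n ^ 'n"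
  assumes L: "labelled_rational_Delzant \<Lambda> L"
    and U: "open U" "Delta L \<subseteq> U"
    and H: "\<And>i k. Ck_on 2 U (\<lambda>x. H x $ i $ k)" and w: "Ck_on 2 U w" and \<phi>: "Ck_on 2 U \<phi>"
    and sym: "\<And>x i k. x \<in> interior (Delta L) \<Longrightarrow> H x $ i $ k = H x $ k $ i"
    and null: "\<And>j x. x \<in> facet L j \<Longrightarrow> H x *v normal_vec L j = 0"
    and der: "\<And>j \<xi>. \<xi> \<in> facet L j \<Longrightarrow> ((\<lambda>x. normal_vec L j \<bullet> (H x *v normal_vec L j))
                  has_derivative (\<lambda>h. (2 *\<^sub>R normal_vec L j) \<bullet> h)) (at \<xi>)"
    and \<rho>: "continuous_on (Delta L) \<rho>"
    and pde: "\<And>x. x \<in> interior (Delta L) \<Longrightarrow>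
      - (\<Sum>i\<in>UNIV. \<Sum>j\<in>UNIV. pderivative j (pderivative i (\<lambda>y. w y * H y $ i $ j)) x) = \<rho> x"
  shows "2 * boundary_integral L (\<lambda>x. \<phi> x * w x) - (LINT x:Delta L|lborel. \<phi> x * \<rho> x)
    = (LINT x:Delta L|lborel. w x * (\<Sum>i\<in>UNIV. \<Sum>j\<in>UNIV. H x $ i $ j * pderivative j (pderivative i \<phi>) x))"
proof -
  note bounded = Delzant_facts(1)[OF L] and nz = Delzant_facts(4)[OF L]
    and generic = Delzant_facts(5)[OF L]
  have cpt: "compact (Delta L)"
    using bounded closed_Delta by (simp add: compact_eq_bounded_closed)
  define G where "G i k x = w x * H x $ i $ k" for i k x
  have G2: "Ck_on (Suc (Suc 0)) U (G i k)" for i k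
    using Ck_on_mult[OF U(1) w H] by (simp add: G_def[abs_def] numeral_2_eq_2)
  then have G1: "Ck_on (Suc 0) U (pderivative l (G i k))" and G1': "Ck_on (Suc 0) U (G i k)" for i k l
    by (auto intro: Ck_on_pderivative Ck_on_SucD simp del: Ck_on.simps)
  have \<phi>2: "Ck_on (Suc (Suc 0)) U \<phi>" using \<phi> by (simp only: numeral_2_eq_2)
  then have \<phi>1: "Ck_on (Suc 0) U (pderivative l \<phi>)" and \<phi>1': "Ck_on (Suc 0) U \<phi>" for l
    by (auto intro: Ck_on_pderivative Ck_on_SucD simp del: Ck_on.simps)
  define V where "V k x = \<phi> x * (\<Sum>i\<in>UNIV. pderivative i (G i k) x)
      - (\<Sum>i\<in>UNIV. G i k x * pderivative i \<phi> x)" for k x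
  have V: "Ck_on 1 U (V k)" for k
    unfolding V_def[abs_def] One_nat_def
    by (intro Ck_on_diff Ck_on_mult Ck_on_sum U(1) \<phi>1 \<phi>1' G1 G1')
  define Q where "Q x = w x * (\<Sum>i\<in>UNIV. \<Sum>j\<in>UNIV. H x $ i $ j * pderivative j (pderivative i \<phi>) x)" for x
  have w_cont: "continuous_on U w" and H_cont: "continuous_on U (\<lambda>x. H x $ i $ k)"
    and \<phi>_cont: "continuous_on U \<phi>" for i k
    using w H \<phi> by (auto intro: Ck_on_continuous)
  have "continuous_on U (pderivative j (pderivative i \<phi>))" for i j
    using \<phi>2 by simp
  then have Q_cont: "continuous_on (Delta L) Q"
    unfolding Q_def by (intro continuous_on_subset[OF _ U(2)] continuous_intros w_cont H_cont)
  have \<phi>_cont': "continuous_on (Delta L) \<phi>" and w_cont': "continuous_on (Delta L) w"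
    using continuous_on_subset[OF _ U(2)] \<phi>_cont w_cont by auto

  have div_V: "(\<Sum>k\<in>UNIV. pderivative k (V k) x) = - (\<phi> x * \<rho> x) - Q x"
    if x: "x \<in> interior (Delta L)" for x
  proof -
    have xU: "x \<in> U" using x interior_subset U(2) by blast
    note d = Ck_on_differentiable[OF _ U(1) xU]
    have dG: "G i k differentiable (at x)" and ddG: "pderivative l (G i k) differentiable (at x)"
      and d\<phi>: "\<phi> differentiable (at x)" and dd\<phi>: "pderivative l \<phi> differentiable (at x)" for i k l
      using d[OF G1'] d[OF G1] d[OF \<phi>1'] d[OF \<phi>1] by auto
    have G_sym: "pderivative k (G i k) x = pderivative k (G k i) x" for i k
      by (rule pderivative_cong[OF open_interior x]) (simp add: G_def sym)
    have "pderivative k (V k) x = \<phi> x * (\<Sum>i\<in>UNIV. pderivative k (pderivative i (G i k)) x)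
        + pderivative k \<phi> x * (\<Sum>i\<in>UNIV. pderivative i (G i k) x)
        - (\<Sum>i\<in>UNIV. G i k x * pderivative k (pderivative i \<phi>) x
            + pderivative k (G i k) x * pderivative i \<phi> x)" for k
      unfolding V_def[abs_def]
      by (simp add: pderivative_diff pderivative_mult pderivative_sum
          differentiable_mult differentiable_sum dG ddG d\<phi> dd\<phi>)
    then have "(\<Sum>k\<in>UNIV. pderivative k (V k) x) =
        \<phi> x * (\<Sum>k\<in>UNIV. \<Sum>i\<in>UNIV. pderivative k (pderivative i (G i k)) x)
        + (\<Sum>k\<in>UNIV. \<Sum>i\<in>UNIV. pderivative k \<phi> x * pderivative i (G i k) x)
        - (\<Sum>k\<in>UNIV. \<Sum>i\<in>UNIV. G i k x * pderivative k (pderivative i \<phi>) x)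
        - (\<Sum>k\<in>UNIV. \<Sum>i\<in>UNIV. pderivative k (G i k) x * pderivative i \<phi> x)"
      by (simp add: sum.distrib sum_subtractf sum_distrib_left)
    also have "(\<Sum>k\<in>UNIV. \<Sum>i\<in>UNIV. pderivative k (pderivative i (G i k)) x) = - \<rho> x"
      using pde[OF x] unfolding G_def[abs_def] by (subst sum.swap) simp
    also have "(\<Sum>k\<in>UNIV. \<Sum>i\<in>UNIV. G i k x * pderivative k (pderivative i \<phi>) x) = Q x"
      unfolding Q_def G_def by (subst sum.swap) (simp add: sum_distrib_left mult.assoc)
    also have "(\<Sum>k\<in>UNIV. \<Sum>i\<in>UNIV. pderivative k (G i k) x * pderivative i \<phi> x)
        = (\<Sum>k\<in>UNIV. \<Sum>i\<in>UNIV. pderivative k \<phi> x * pderivative i (G i k) x)"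
      by (subst sum.swap) (simp add: G_sym mult.commute)
    finally show ?thesis by simp
  qed

  have "continuous_on (Delta L) (\<lambda>x. \<Sum>k\<in>UNIV. pderivative k (V k) x)"
    using V by (intro continuous_on_sum) (auto intro: continuous_on_subset[OF _ U(2)])
  then have div_int: "set_integrable lborel (Delta L) (\<lambda>x. \<Sum>k\<in>UNIV. pderivative k (V k) x)"
    unfolding set_integrable_def by (rule borel_integrable_compact[OF cpt])
  have \<phi>\<rho>_int: "set_integrable lborel (Delta L) (\<lambda>x. - (\<phi> x * \<rho> x))"
    and Q_int: "set_integrable lborel (Delta L) Q"
    unfolding set_integrable_def
    by (intro borel_integrable_compact[OF cpt] continuous_intros \<phi>_cont' \<rho> Q_cont)+
  have "(LINT x:Delta L|lborel. \<Sum>k\<in>UNIV. pderivative k (V k) x)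
      = (LINT x:Delta L|lborel. - (\<phi> x * \<rho> x) - Q x)"
  proof (rule set_integral_cong_AE_integrable[OF div_int set_integral_diff(1)[OF \<phi>\<rho>_int Q_int]])
    show "AE x in lborel. x \<in> Delta L \<longrightarrow> (\<Sum>k\<in>UNIV. pderivative k (V k) x) = - (\<phi> x * \<rho> x) - Q x"
      using AE_interior_Delta[of L, OF nz] by eventually_elim (simp add: div_V)
  qed
  also have "\<dots> = (LINT x:Delta L|lborel. - (\<phi> x * \<rho> x)) - (LINT x:Delta L|lborel. Q x)"
    by (rule set_integral_diff(2)[OF \<phi>\<rho>_int Q_int])
  also have "(LINT x:Delta L|lborel. - (\<phi> x * \<rho> x)) = - (LINT x:Delta L|lborel. \<phi> x * \<rho> x)"
    by (simp add: set_lebesgue_integral_def)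
  finally have lhs: "(LINT x:Delta L|lborel. \<Sum>k\<in>UNIV. pderivative k (V k) x)
      = - (LINT x:Delta L|lborel. \<phi> x * \<rho> x) - (LINT x:Delta L|lborel. Q x)" .

  have facet_flux: "(\<Sum>k\<in>UNIV. V k x * fst (L j) $ k) = 2 * (\<phi> x * w x)"
    if x: "x \<in> facet L j" "\<And>k. k \<noteq> j \<Longrightarrow> 0 < aff (L k) x" for x j
  proof -
    have xU: "x \<in> U" using x(1) U(2) by (auto simp: facet_def)
    have H1: "Ck_on 1 U (\<lambda>x. H x $ i $ k)" and w1: "Ck_on 1 U w" for i k
      using H w unfolding One_nat_def numeral_2_eq_2 by (auto intro: Ck_on_SucD simp del: Ck_on.simps)
    have flux: "(\<Sum>k\<in>UNIV. (\<Sum>i\<in>UNIV. pderivative i (G i k) x) * normal_vec L j $ k) = 2 * w x"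
      unfolding G_def[abs_def]
      by (rule boundary_flux[OF nz U(1) xU H1 w1 null der x]) (use x in auto)
    have "(\<Sum>k\<in>UNIV. (\<Sum>i\<in>UNIV. G i k x * pderivative i \<phi> x) * normal_vec L j $ k)
        = (\<Sum>i\<in>UNIV. w x * pderivative i \<phi> x * (H x *v normal_vec L j) $ i)"
      unfolding sum_distrib_right matrix_vector_mult_def G_def
      by (subst sum.swap) (simp add: sum_distrib_left mult_ac)
    also have "\<dots> = 0" by (simp add: null[OF x(1)])
    finally have "(\<Sum>k\<in>UNIV. (\<Sum>i\<in>UNIV. G i k x * pderivative i \<phi> x) * normal_vec L j $ k) = 0" .
    moreover have "(\<Sum>k\<in>UNIV. V k x * fst (L j) $ k)
      = \<phi> x * (\<Sum>k\<in>UNIV. (\<Sum>i\<in>UNIV. pderivative i (G i k) x) * normal_vec L j $ k)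
        - (\<Sum>k\<in>UNIV. (\<Sum>i\<in>UNIV. G i k x * pderivative i \<phi> x) * normal_vec L j $ k)"
      unfolding V_def normal_vec_def
      by (simp add: sum_subtractf left_diff_distrib mult.assoc sum_distrib_left[of "\<phi> x"
          "\<lambda>k. (\<Sum>i\<in>UNIV. pderivative i (G i k) x) * fst (L j) $ k"])
    ultimately show ?thesis using flux by simp
  qed
  have "(LINT x:facet L j|hyperplane_measure (L j). \<Sum>k\<in>UNIV. V k x * fst (L j) $ k)
      = 2 * (LINT x:facet L j|hyperplane_measure (L j). \<phi> x * w x)" for j
  proof -
    have cf: "compact (facet L j)"
      using compact_Int_closed[OF cpt closed_facet[of L j]] by (simp add: facet_def Int_absorb1 inf.absorb2)
    have sub: "facet L j \<subseteq> Delta L" by (auto simp: facet_def)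
    have "continuous_on (facet L j) (\<lambda>x. \<Sum>k\<in>UNIV. V k x * fst (L j) $ k)"
      by (rule continuous_on_subset[of U])
        (use V sub U(2) in \<open>auto intro!: continuous_intros intro: Ck_on_continuous simp del: Ck_on.simps\<close>)
    moreover have "continuous_on (facet L j) (\<lambda>x. 2 * (\<phi> x * w x))"
      using \<phi>_cont' w_cont' sub by (intro continuous_intros) (auto intro: continuous_on_subset)
    ultimately have "(LINT x:facet L j|hyperplane_measure (L j). \<Sum>k\<in>UNIV. V k x * fst (L j) $ k)
      = (LINT x:facet L j|hyperplane_measure (L j). 2 * (\<phi> x * w x))"
    proof (intro set_integral_cong_AE_integrable set_integrable_hyperplane_measure cf)
      have "AE x in hyperplane_measure (L j). \<forall>k. k \<noteq> j \<longrightarrow> aff (L k) x \<noteq> 0"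
        unfolding AE_all_countable using generic by auto
      then show "AE x in hyperplane_measure (L j). x \<in> facet L j \<longrightarrow>
          (\<Sum>k\<in>UNIV. V k x * fst (L j) $ k) = 2 * (\<phi> x * w x)"
      proof eventually_elim
        case (elim x)
        show ?case
        proof
          assume x: "x \<in> facet L j"
          then have "0 < aff (L k) x" if "k \<noteq> j" for k
            using elim that by (auto simp: facet_def Delta_def less_le)
          with x show "(\<Sum>k\<in>UNIV. V k x * fst (L j) $ k) = 2 * (\<phi> x * w x)"
            by (rule facet_flux)
        qed
      qed
    qed auto
    then show ?thesis by simp
  qed
  then have "(LINT x:Delta L|lborel. \<Sum>k\<in>UNIV. pderivative k (V k) x)
      = - (2 * boundary_integral L (\<lambda>x. \<phi> x * w x))"
    using divergence_theorem_Delta[OF bounded nz generic U V]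
    by (simp add: boundary_integral_def sum_distrib_left)
  with lhs show ?thesis by (simp add: Q_def)
qed

section \<open>Smoothing a maximum of affine functions\<close>

text \<open>
  The weights of the Gibbs distribution on \<open>A\<close> with energies \<open>- aff p x\<close> at inverse temperature \<open>\<beta>\<close>.
\<close>

definition softmax :: "real \<Rightarrow> 'n::finite affine_fun set \<Rightarrow> 'n affine_fun \<Rightarrow> real ^ 'n \<Rightarrow> real" where
  "softmax \<beta> A p x = exp (\<beta> * aff p x) / (\<Sum>q\<in>A. exp (\<beta> * aff q x))"

definition smooth_max :: "real \<Rightarrow> 'n::finite affine_fun set \<Rightarrow> real ^ 'n \<Rightarrow> real" where
  "smooth_max \<beta> A x = ln (\<Sum>p\<in>A. exp (\<beta> * aff p x)) / \<beta>"

definition mean_slope :: "real \<Rightarrow> 'n::finite affine_fun set \<Rightarrow> real ^ 'n \<Rightarrow> real ^ 'n" where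
  "mean_slope \<beta> A x = (\<Sum>q\<in>A. softmax \<beta> A q x *\<^sub>R fst q)"

text \<open>
  The trace of the Hessian of \<open>smooth_max\<close>, which is \<open>\<beta>\<close> times the covariance of the slopes under the
  weights \<open>softmax\<close>.
\<close>

definition laplacian_smooth_max :: "real \<Rightarrow> 'n::finite affine_fun set \<Rightarrow> real ^ 'n \<Rightarrow> real" where
  "laplacian_smooth_max \<beta> A x = \<beta> * (\<Sum>p\<in>A. softmax \<beta> A p x * (norm (fst p - mean_slope \<beta> A x))\<^sup>2)"

locale smoothed_max =
  fixes \<beta> :: real and A :: "'n::finite affine_fun set"
  assumes A: "finite A" "A \<noteq> {}" and pos: "0 < \<beta>"
begin

lemma partition_pos: "0 < (\<Sum>q\<in>A. exp (\<beta> * aff q x))"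
  using A by (intro sum_pos) auto

lemma softmax_nonneg: "0 \<le> softmax \<beta> A p x"
  using partition_pos[of x] by (simp add: softmax_def)

lemma sum_softmax: "(\<Sum>p\<in>A. softmax \<beta> A p x) = 1"
  using partition_pos[of x] by (simp add: softmax_def flip: sum_divide_distrib)

lemma smooth_max_has_derivative:
  "(smooth_max \<beta> A has_derivative (\<lambda>h. mean_slope \<beta> A x \<bullet> h)) (at x)"
proof -
  have "(smooth_max \<beta> A has_derivative
      (\<lambda>h. (\<Sum>p\<in>A. exp (\<beta> * aff p x) * (\<beta> * (fst p \<bullet> h))) / (\<Sum>p\<in>A. exp (\<beta> * aff p x)) / \<beta>)) (at x)"
    unfolding smooth_max_def[abs_def]
    using partition_pos[of x] pos by (auto intro!: derivative_eq_intros simp: divide_inverse mult_ac)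
  then show ?thesis
    by (rule has_derivative_eq_rhs)
      (use pos in \<open>simp add: mean_slope_def softmax_def inner_sum_left sum_divide_distrib fun_eq_iff\<close>)
qed

lemma softmax_has_derivative:
  "(softmax \<beta> A p has_derivative
     (\<lambda>h. \<beta> * softmax \<beta> A p x * ((fst p - mean_slope \<beta> A x) \<bullet> h))) (at x)"
proof -
  define Z where "Z x = (\<Sum>q\<in>A. exp (\<beta> * aff q x))" for x
  have Z: "0 < Z x" unfolding Z_def by (rule partition_pos)
  define S where "S h = (\<Sum>q\<in>A. exp (\<beta> * aff q x) * (\<beta> * (fst q \<bullet> h)))" for h
  have Z_der: "(Z has_derivative S) (at x)"
    unfolding Z_def[abs_def] S_def[abs_def] by (auto intro!: derivative_eq_intros simp: mult_ac)
  have S: "S h = \<beta> * Z x * (mean_slope \<beta> A x \<bullet> h)" for h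
    using Z by (simp add: S_def mean_slope_def softmax_def Z_def[symmetric] inner_sum_left sum_distrib_left mult_ac)
  have "((\<lambda>x. exp (\<beta> * aff p x) / Z x) has_derivative
      (\<lambda>h. (exp (\<beta> * aff p x) * (\<beta> * (fst p \<bullet> h)) * Z x - exp (\<beta> * aff p x) * S h) / (Z x * Z x))) (at x)"
    using Z by (auto intro!: derivative_eq_intros Z_der simp: mult_ac)
  then show ?thesis
    unfolding softmax_def[abs_def] Z_def[symmetric]
    by (rule has_derivative_eq_rhs)
      (use Z in \<open>simp add: S fun_eq_iff inner_diff_left field_simps\<close>)
qed

lemma Ck_on_softmax: "open U \<Longrightarrow> Ck_on k U (softmax \<beta> A p)"
proof (induction k arbitrary: p)
  case 0
  then show ?case
    by (auto intro!: has_derivative_continuous[OF softmax_has_derivative] simp: continuous_on_eq_continuous_at)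
next
  case (Suc k)
  have "Ck_on k U (\<lambda>x. \<beta> * softmax \<beta> A p x * (fst p \<bullet> axis i 1 - (\<Sum>q\<in>A. softmax \<beta> A q x * (fst q \<bullet> axis i 1))))" for i
    by (intro Ck_on_mult Ck_on_diff Ck_on_sum Ck_on_const Suc)
  then have "Ck_on k U (\<lambda>x. \<beta> * softmax \<beta> A p x * ((fst p - mean_slope \<beta> A x) \<bullet> axis i 1))" for i
    by (simp add: mean_slope_def inner_diff_left inner_sum_left)
  then show ?case
    by (intro Ck_on_SucI[OF Suc.prems softmax_has_derivative])
qed

lemma pderivative_smooth_max:
  "pderivative i (smooth_max \<beta> A) = (\<lambda>x. \<Sum>p\<in>A. softmax \<beta> A p x * fst p $ i)"
  by (simp add: fun_eq_iff pderivative_eq[OF smooth_max_has_derivative] mean_slope_def inner_sum_left inner_axis)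

lemma Ck_on_smooth_max: "open U \<Longrightarrow> Ck_on k U (smooth_max \<beta> A)"
proof (rule Ck_on_SucD)
  assume U: "open U"
  then have "smooth_max \<beta> A differentiable_on U"
    by (auto simp: differentiable_on_eq_differentiable_at differentiable_def intro: smooth_max_has_derivative)
  then show "Ck_on (Suc k) U (smooth_max \<beta> A)"
    by (auto simp: pderivative_smooth_max intro!: Ck_on_sum Ck_on_mult Ck_on_const Ck_on_softmax U)
qed

lemma sum_centered_slopes: "(\<Sum>p\<in>A. softmax \<beta> A p x *\<^sub>R (fst p - mean_slope \<beta> A x)) = 0"
proof -
  have "(\<Sum>p\<in>A. softmax \<beta> A p x *\<^sub>R mean_slope \<beta> A x) = mean_slope \<beta> A x"
    by (simp add: sum_softmax flip: scaleR_sum_left)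
  then show ?thesis
    by (simp add: scaleR_diff_right sum_subtractf mean_slope_def)
qed

text \<open>
  Differentiating the weights produces the centred slopes \<open>p - mean_slope\<close> on one side only; since their
  weighted sum is \<open>0\<close>, the mean slope may be subtracted on the other side too, and the result is visibly
  nonnegative when \<open>M\<close> is.
\<close>

lemma Hessian_smooth_max:
  fixes M :: "real ^ 'n ^ 'n"
  shows "(\<Sum>i\<in>UNIV. \<Sum>j\<in>UNIV. M $ i $ j * pderivative j (pderivative i (smooth_max \<beta> A)) x)
    = \<beta> * (\<Sum>p\<in>A. softmax \<beta> A p x * ((fst p - mean_slope \<beta> A x) \<bullet> (M *v (fst p - mean_slope \<beta> A x))))"
proof -
  let ?b = "\<lambda>p. fst p - mean_slope \<beta> A x"
  have "((\<lambda>x. \<Sum>p\<in>A. softmax \<beta> A p x * fst p $ i) has_derivative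
      (\<lambda>h. \<Sum>p\<in>A. \<beta> * softmax \<beta> A p x * (?b p \<bullet> h) * fst p $ i)) (at x)" for i
    by (intro has_derivative_sum has_derivative_mult_left softmax_has_derivative)
  then have "pderivative j (pderivative i (smooth_max \<beta> A)) x
      = (\<Sum>p\<in>A. \<beta> * softmax \<beta> A p x * ?b p $ j * fst p $ i)" for i j
    unfolding pderivative_smooth_max by (subst pderivative_eq, assumption) (simp add: inner_axis)
  then have "(\<Sum>i\<in>UNIV. \<Sum>j\<in>UNIV. M $ i $ j * pderivative j (pderivative i (smooth_max \<beta> A)) x)
      = (\<Sum>i\<in>UNIV. \<Sum>j\<in>UNIV. \<Sum>p\<in>A. M $ i $ j * (\<beta> * softmax \<beta> A p x * ?b p $ j * fst p $ i))"
    by (simp only: sum_distrib_left)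
  also have "\<dots> = (\<Sum>i\<in>UNIV. \<Sum>p\<in>A. \<Sum>j\<in>UNIV. M $ i $ j * (\<beta> * softmax \<beta> A p x * ?b p $ j * fst p $ i))"
    by (rule sum.cong[OF refl], rule sum.swap)
  also have "\<dots> = (\<Sum>p\<in>A. \<Sum>i\<in>UNIV. \<Sum>j\<in>UNIV. M $ i $ j * (\<beta> * softmax \<beta> A p x * ?b p $ j * fst p $ i))"
    by (rule sum.swap)
  also have "\<dots> = \<beta> * (\<Sum>p\<in>A. softmax \<beta> A p x * (fst p \<bullet> (M *v ?b p)))"
    unfolding inner_Sum_mult matrix_vector_mult_def
    by (simp add: sum_distrib_left mult_ac)
  also have "(\<Sum>p\<in>A. softmax \<beta> A p x * (fst p \<bullet> (M *v ?b p)))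
      = (\<Sum>p\<in>A. softmax \<beta> A p x * (?b p \<bullet> (M *v ?b p)))
        + mean_slope \<beta> A x \<bullet> (M *v (\<Sum>p\<in>A. softmax \<beta> A p x *\<^sub>R ?b p))"
    by (simp add: linear_sum[OF matrix_vector_mul_linear] inner_sum_right inner_diff_left right_diff_distrib
        sum_subtractf matrix_vector_mult_scaleR)
  finally show ?thesis by (simp add: sum_centered_slopes)
qed

lemma laplacian_smooth_max_nonneg: "0 \<le> laplacian_smooth_max \<beta> A x"
  using pos by (auto simp: laplacian_smooth_max_def intro!: mult_nonneg_nonneg sum_nonneg softmax_nonneg)

lemma Hessian_smooth_max_ge:
  assumes "\<And>v. \<kappa> * (norm v)\<^sup>2 \<le> v \<bullet> (M *v v)"
  shows "\<kappa> * laplacian_smooth_max \<beta> A x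
    \<le> (\<Sum>i\<in>UNIV. \<Sum>j\<in>UNIV. M $ i $ j * pderivative j (pderivative i (smooth_max \<beta> A)) x)"
proof -
  have "\<kappa> * laplacian_smooth_max \<beta> A x = \<beta> * (\<Sum>p\<in>A. softmax \<beta> A p x * (\<kappa> * (norm (fst p - mean_slope \<beta> A x))\<^sup>2))"
    by (simp add: laplacian_smooth_max_def sum_distrib_left mult_ac)
  also have "\<dots> \<le> \<beta> * (\<Sum>p\<in>A. softmax \<beta> A p x * ((fst p - mean_slope \<beta> A x) \<bullet> (M *v (fst p - mean_slope \<beta> A x))))"
    using pos by (intro mult_left_mono sum_mono softmax_nonneg assms) auto
  finally show ?thesis by (simp only: Hessian_smooth_max)
qed

lemma continuous_on_softmax: "continuous_on S (softmax \<beta> A p)"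
  using Ck_on_continuous[OF Ck_on_softmax[OF open_UNIV]] by (rule continuous_on_subset) simp

lemma continuous_on_smooth_max: "continuous_on S (smooth_max \<beta> A)"
  using Ck_on_continuous[OF Ck_on_smooth_max[OF open_UNIV]] by (rule continuous_on_subset) simp

lemma continuous_on_laplacian_smooth_max: "continuous_on S (laplacian_smooth_max \<beta> A)"
  unfolding laplacian_smooth_max_def mean_slope_def by (intro continuous_intros continuous_on_softmax)

lemma Max_le_smooth_max: "Max ((\<lambda>p. aff p x) ` A) \<le> smooth_max \<beta> A x"
  and smooth_max_le: "smooth_max \<beta> A x \<le> Max ((\<lambda>p. aff p x) ` A) + ln (card A) / \<beta>"
proof -
  let ?M = "Max ((\<lambda>p. aff p x) ` A)"
  have "?M \<in> (\<lambda>p. aff p x) ` A"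
    using A by (intro Max_in) auto
  then obtain p where p: "p \<in> A" "?M = aff p x"
    by blast
  have "exp (\<beta> * ?M) \<le> (\<Sum>q\<in>A. exp (\<beta> * aff q x))"
    using p A(1) member_le_sum[of p A "\<lambda>q. exp (\<beta> * aff q x)"] by simp
  then have "\<beta> * ?M \<le> ln (\<Sum>q\<in>A. exp (\<beta> * aff q x))"
    using ln_mono[of "exp (\<beta> * ?M)" "\<Sum>q\<in>A. exp (\<beta> * aff q x)"] partition_pos[of x] by simp
  then show "?M \<le> smooth_max \<beta> A x"
    using pos by (simp add: smooth_max_def pos_le_divide_eq mult.commute)
  have "(\<Sum>q\<in>A. exp (\<beta> * aff q x)) \<le> (\<Sum>q\<in>A. exp (\<beta> * ?M))"
    using pos A(1) by (intro sum_mono) auto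
  then have "ln (\<Sum>q\<in>A. exp (\<beta> * aff q x)) \<le> ln (card A * exp (\<beta> * ?M))"
    using partition_pos[of x] A by (intro ln_mono) (auto simp: card_gt_0_iff)
  also have "\<dots> = ln (card A) + \<beta> * ?M"
    using A by (simp add: ln_mult card_gt_0_iff)
  finally show "smooth_max \<beta> A x \<le> ?M + ln (card A) / \<beta>"
    using pos by (simp add: smooth_max_def field_simps)
qed

text \<open>
  On the segment from \<open>x - h\<close> to \<open>x + h\<close> the function is convex, so its second difference is at most the
  difference of the derivatives at the ends, that is, the integral of the second derivative.  The
  latter is at most \<open>(norm h)\<^sup>2\<close> times the trace of the Hessian.
\<close>

lemma second_difference_le_laplacian:
  "ennreal (smooth_max \<beta> A (x + h) + smooth_max \<beta> A (x - h) - 2 * smooth_max \<beta> A x)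
    \<le> (\<integral>\<^sup>+s. ennreal ((norm h)\<^sup>2 * laplacian_smooth_max \<beta> A (x + s *\<^sub>R h)) * indicator {-1..1} s \<partial>lborel)"
proof -
  define \<gamma> where "\<gamma> s = smooth_max \<beta> A (x + s *\<^sub>R h)" for s
  define \<gamma>1 where "\<gamma>1 s = (\<Sum>p\<in>A. softmax \<beta> A p (x + s *\<^sub>R h) * (fst p \<bullet> h))" for s
  define \<gamma>2 where "\<gamma>2 s = \<beta> * (\<Sum>p\<in>A. softmax \<beta> A p (x + s *\<^sub>R h) * ((fst p - mean_slope \<beta> A (x + s *\<^sub>R h)) \<bullet> h)\<^sup>2)" for s
  have \<gamma>: "(\<gamma> has_real_derivative \<gamma>1 s) (at s)" for s
    using has_real_derivative_along_line[where e=h and t=s and x=x, OF smooth_max_has_derivative]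
    by (simp add: \<gamma>_def[abs_def] \<gamma>1_def mean_slope_def inner_sum_left)
  have \<gamma>1: "(\<gamma>1 has_real_derivative \<gamma>2 s) (at s)" for s
  proof -
    let ?y = "x + s *\<^sub>R h"
    let ?b = "\<lambda>p. fst p - mean_slope \<beta> A ?y"
    have "(\<gamma>1 has_real_derivative
        (\<Sum>p\<in>A. \<beta> * softmax \<beta> A p ?y * (?b p \<bullet> h) * (fst p \<bullet> h))) (at s)"
      unfolding \<gamma>1_def[abs_def]
      by (intro DERIV_sum DERIV_cmult_right has_real_derivative_along_line softmax_has_derivative)
    also have "(\<Sum>p\<in>A. \<beta> * softmax \<beta> A p ?y * (?b p \<bullet> h) * (fst p \<bullet> h))
        = \<gamma>2 s + \<beta> * ((mean_slope \<beta> A ?y \<bullet> h) * ((\<Sum>p\<in>A. softmax \<beta> A p ?y *\<^sub>R ?b p) \<bullet> h))"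
      by (simp add: \<gamma>2_def inner_sum_left inner_diff_left sum_distrib_left power2_eq_square
          algebra_simps flip: sum.distrib)
    finally show ?thesis by (simp add: sum_centered_slopes)
  qed
  have \<gamma>2_nonneg: "0 \<le> \<gamma>2 s" for s
    using pos by (auto simp: \<gamma>2_def intro!: mult_nonneg_nonneg sum_nonneg softmax_nonneg)
  have \<gamma>1_mono: "\<gamma>1 s \<le> \<gamma>1 t" if "s \<le> t" for s t
    using DERIV_nonneg_imp_nondecreasing[OF that] \<gamma>1 \<gamma>2_nonneg by blast
  have "\<gamma> 1 - \<gamma> 0 \<le> \<gamma>1 1"
    using MVT2[of 0 1 \<gamma> \<gamma>1] \<gamma> \<gamma>1_mono by fastforce
  moreover have "\<gamma>1 (-1) \<le> \<gamma> 0 - \<gamma> (-1)"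
    using MVT2[of "-1" 0 \<gamma> \<gamma>1] \<gamma> \<gamma>1_mono by fastforce
  ultimately have "\<gamma> 1 + \<gamma> (-1) - 2 * \<gamma> 0 \<le> \<gamma>1 1 - \<gamma>1 (-1)" by simp
  then have "ennreal (\<gamma> 1 + \<gamma> (-1) - 2 * \<gamma> 0) \<le> ennreal (\<gamma>1 1 - \<gamma>1 (-1))"
    by (rule ennreal_leI)
  also have "\<dots> = (\<integral>\<^sup>+s. ennreal (\<gamma>2 s) * indicator {-1..1} s \<partial>lborel)"
  proof (rule nn_integral_FTC_Icc[symmetric])
    have "continuous_on UNIV \<gamma>2"
      unfolding \<gamma>2_def mean_slope_def
      by (intro continuous_intros continuous_on_compose2[OF continuous_on_softmax]) auto
    then show "\<gamma>2 \<in> borel_measurable borel" by (rule borel_measurable_continuous_onI)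
  qed (use \<gamma>1 \<gamma>2_nonneg in auto)
  also have "\<dots> \<le> (\<integral>\<^sup>+s. ennreal ((norm h)\<^sup>2 * laplacian_smooth_max \<beta> A (x + s *\<^sub>R h)) * indicator {-1..1} s \<partial>lborel)"
  proof (intro nn_integral_mono mult_right_mono ennreal_leI)
    fix s
    have "((fst p - mean_slope \<beta> A (x + s *\<^sub>R h)) \<bullet> h)\<^sup>2 \<le> (norm (fst p - mean_slope \<beta> A (x + s *\<^sub>R h)))\<^sup>2 * (norm h)\<^sup>2" for p
      using power_mono[OF Cauchy_Schwarz_ineq2[of "fst p - mean_slope \<beta> A (x + s *\<^sub>R h)" h], of 2]
      by (simp add: power_mult_distrib)
    then have "\<gamma>2 s \<le> \<beta> * (\<Sum>p\<in>A. softmax \<beta> A p (x + s *\<^sub>R h) *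
        ((norm (fst p - mean_slope \<beta> A (x + s *\<^sub>R h)))\<^sup>2 * (norm h)\<^sup>2))"
      unfolding \<gamma>2_def using pos by (intro mult_left_mono sum_mono softmax_nonneg) auto
    also have "\<dots> = (norm h)\<^sup>2 * laplacian_smooth_max \<beta> A (x + s *\<^sub>R h)"
      by (simp add: laplacian_smooth_max_def sum_distrib_left mult_ac)
    finally show "\<gamma>2 s \<le> (norm h)\<^sup>2 * laplacian_smooth_max \<beta> A (x + s *\<^sub>R h)" .
  qed simp
  finally show ?thesis by (simp add: \<gamma>_def)
qed

text \<open>
  Tonelli's theorem and translation invariance; the factor \<open>2\<close> is the length of the parameter interval.
\<close>

lemma second_difference_integral_le:
  assumes B: "B \<in> sets borel" and K: "K \<in> sets borel"
    and sub: "\<And>x s. x \<in> B \<Longrightarrow> -1 \<le> s \<Longrightarrow> s \<le> 1 \<Longrightarrow> x + s *\<^sub>R h \<in> K"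
  shows "(\<integral>\<^sup>+x. ennreal (smooth_max \<beta> A (x + h) + smooth_max \<beta> A (x - h) - 2 * smooth_max \<beta> A x) * indicator B x \<partial>lborel)
    \<le> ennreal (2 * (norm h)\<^sup>2) * (\<integral>\<^sup>+x. ennreal (laplacian_smooth_max \<beta> A x) * indicator K x \<partial>lborel)"
proof -
  note [measurable] = B K
  have [measurable]: "laplacian_smooth_max \<beta> A \<in> borel_measurable borel"
    by (rule borel_measurable_continuous_onI[OF continuous_on_laplacian_smooth_max])
  have "(\<integral>\<^sup>+x. ennreal (smooth_max \<beta> A (x + h) + smooth_max \<beta> A (x - h) - 2 * smooth_max \<beta> A x) * indicator B x \<partial>lborel)
    \<le> (\<integral>\<^sup>+x. (\<integral>\<^sup>+s. ennreal ((norm h)\<^sup>2 * laplacian_smooth_max \<beta> A (x + s *\<^sub>R h)) * indicator {-1..1} s \<partial>lborel) * indicator B x \<partial>lborel)"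
    by (intro nn_integral_mono mult_right_mono second_difference_le_laplacian) simp
  also have "\<dots> = (\<integral>\<^sup>+x. \<integral>\<^sup>+s. ennreal ((norm h)\<^sup>2 * laplacian_smooth_max \<beta> A (x + s *\<^sub>R h)) * indicator {-1..1} s * indicator B x \<partial>lborel \<partial>lborel)"
    by (intro nn_integral_cong nn_integral_multc[symmetric]) measurable
  also have "\<dots> = (\<integral>\<^sup>+s. \<integral>\<^sup>+x. ennreal ((norm h)\<^sup>2 * laplacian_smooth_max \<beta> A (x + s *\<^sub>R h)) * indicator {-1..1} s * indicator B x \<partial>lborel \<partial>lborel)"
    by (rule lborel_pair.Fubini') measurable
  also have "\<dots> \<le> (\<integral>\<^sup>+s. \<integral>\<^sup>+x. ennreal ((norm h)\<^sup>2) * indicator {-1..1} s * (ennreal (laplacian_smooth_max \<beta> A (x + s *\<^sub>R h)) * indicator K (x + s *\<^sub>R h)) \<partial>lborel \<partial>lborel)"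
    using sub by (intro nn_integral_mono) (auto simp: indicator_def ennreal_mult laplacian_smooth_max_nonneg)
  also have "\<dots> = (\<integral>\<^sup>+s. ennreal ((norm h)\<^sup>2) * indicator {-1..1} s * (\<integral>\<^sup>+x. ennreal (laplacian_smooth_max \<beta> A x) * indicator K x \<partial>lborel) \<partial>(lborel :: real measure))"
  proof (rule nn_integral_cong)
    fix s :: real
    have "(\<integral>\<^sup>+x. ennreal (laplacian_smooth_max \<beta> A x) * indicator K x \<partial>lborel)
        = (\<integral>\<^sup>+x. ennreal (laplacian_smooth_max \<beta> A x) * indicator K x \<partial>distr lborel borel ((+) (s *\<^sub>R h)))"
      by (simp add: lborel_distr_plus)
    also have "\<dots> = (\<integral>\<^sup>+x. ennreal (laplacian_smooth_max \<beta> A (x + s *\<^sub>R h)) * indicator K (x + s *\<^sub>R h) \<partial>lborel)"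
      by (subst nn_integral_distr) (auto simp: add.commute)
    finally show "(\<integral>\<^sup>+x. ennreal ((norm h)\<^sup>2) * indicator {-1..1} s * (ennreal (laplacian_smooth_max \<beta> A (x + s *\<^sub>R h)) * indicator K (x + s *\<^sub>R h)) \<partial>lborel)
        = ennreal ((norm h)\<^sup>2) * indicator {-1..1} s * (\<integral>\<^sup>+x. ennreal (laplacian_smooth_max \<beta> A x) * indicator K x \<partial>lborel)"
      by (simp add: nn_integral_cmult)
  qed
  also have "\<dots> = (\<integral>\<^sup>+s. ennreal ((norm h)\<^sup>2) * indicator {-1..1} s \<partial>(lborel :: real measure)) * (\<integral>\<^sup>+x. ennreal (laplacian_smooth_max \<beta> A x) * indicator K x \<partial>lborel)"
    by (rule nn_integral_multc) measurable
  also have "(\<integral>\<^sup>+s. ennreal ((norm h)\<^sup>2) * indicator {-1..1} s \<partial>(lborel :: real measure)) = ennreal (2 * (norm h)\<^sup>2)"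
    by (subst nn_integral_cmult_indicator) (simp_all add: ennreal_mult mult.commute)
  finally show ?thesis .
qed

end

section \<open>Passing to the limit\<close>

lemma set_integral_uniform_limit:
  fixes g :: "nat \<Rightarrow> 'a \<Rightarrow> real"
  assumes g: "\<And>n. set_integrable M S (\<lambda>x. g n x * \<omega> x)"
    and \<Phi>: "set_integrable M S (\<lambda>x. \<Phi> x * \<omega> x)" and \<omega>: "set_integrable M S \<omega>"
    and bound: "\<And>n x. x \<in> S \<Longrightarrow> \<bar>g n x - \<Phi> x\<bar> \<le> \<epsilon> n" and \<epsilon>: "\<epsilon> \<longlonglongrightarrow> 0"
  shows "(\<lambda>n. LINT x:S|M. g n x * \<omega> x) \<longlonglongrightarrow> (LINT x:S|M. \<Phi> x * \<omega> x)"
proof -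
  let ?C = "\<integral>x. \<bar>indicator S x * \<omega> x\<bar> \<partial>M"
  have \<omega>': "integrable M (\<lambda>x. indicator S x * \<omega> x)" using \<omega> by (simp add: set_integrable_def)
  have "\<bar>(LINT x:S|M. g n x * \<omega> x) - (LINT x:S|M. \<Phi> x * \<omega> x)\<bar> \<le> \<epsilon> n * ?C" for n
  proof -
    have "(LINT x:S|M. g n x * \<omega> x) - (LINT x:S|M. \<Phi> x * \<omega> x)
        = (\<integral>x. indicator S x * (g n x * \<omega> x - \<Phi> x * \<omega> x) \<partial>M)"
      unfolding set_lebesgue_integral_def right_diff_distrib
      by (subst Bochner_Integration.integral_diff)
        (use g[of n] \<Phi> in \<open>simp_all add: set_integrable_def\<close>)
    also have "\<bar>\<dots>\<bar> \<le> (\<integral>x. \<epsilon> n * \<bar>indicator S x * \<omega> x\<bar> \<partial>M)"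
    proof -
      have int: "integrable M (\<lambda>x. indicator S x * (g n x * \<omega> x - \<Phi> x * \<omega> x))"
        unfolding right_diff_distrib
        by (rule Bochner_Integration.integrable_diff) (use g[of n] \<Phi> in \<open>simp_all add: set_integrable_def\<close>)
      have "\<bar>indicator S x * (g n x * \<omega> x - \<Phi> x * \<omega> x)\<bar> \<le> \<epsilon> n * \<bar>indicator S x * \<omega> x\<bar>" for x
      proof (cases "x \<in> S")
        case True
        then have "\<bar>g n x - \<Phi> x\<bar> * \<bar>\<omega> x\<bar> \<le> \<epsilon> n * \<bar>\<omega> x\<bar>"
          by (intro mult_right_mono bound) auto
        moreover have "\<bar>g n x * \<omega> x - \<Phi> x * \<omega> x\<bar> = \<bar>g n x - \<Phi> x\<bar> * \<bar>\<omega> x\<bar>"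
          by (metis abs_mult left_diff_distrib)
        ultimately show ?thesis using True by simp
      qed simp
      then have "(\<integral>x. \<bar>indicator S x * (g n x * \<omega> x - \<Phi> x * \<omega> x)\<bar> \<partial>M)
          \<le> (\<integral>x. \<epsilon> n * \<bar>indicator S x * \<omega> x\<bar> \<partial>M)"
        by - (rule integral_mono[OF integrable_abs[OF int] integrable_mult_right[OF integrable_abs[OF \<omega>']]], assumption)
      then show ?thesis by (rule order_trans[OF integral_abs_bound])
    qed
    also have "\<dots> = \<epsilon> n * ?C" by (rule Bochner_Integration.integral_mult_right_zero)
    finally show ?thesis .
  qed
  then have "\<forall>\<^sub>F n in sequentially.
      norm ((LINT x:S|M. g n x * \<omega> x) - (LINT x:S|M. \<Phi> x * \<omega> x)) \<le> \<epsilon> n * ?C"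
    unfolding real_norm_def by (intro always_eventually allI)
  moreover have "(\<lambda>n. \<epsilon> n * ?C) \<longlonglongrightarrow> 0"
    by (rule tendsto_mult_left_zero[OF \<epsilon>])
  ultimately have "(\<lambda>n. (LINT x:S|M. g n x * \<omega> x) - (LINT x:S|M. \<Phi> x * \<omega> x)) \<longlonglongrightarrow> 0"
    by (rule Lim_null_comparison)
  then show ?thesis by (rule LIM_zero_cancel)
qed

lemma Futaki_uniform_limit:
  fixes L :: "'d::finite \<Rightarrow> 'n::finite affine_fun"
  assumes cpt: "compact (Delta L)"
    and f: "continuous_on (Delta L) f" "\<And>x. x \<in> Delta L \<Longrightarrow> 0 < f x"
    and g: "\<And>n. continuous_on (Delta L) (g n)" and \<Phi>: "continuous_on (Delta L) \<Phi>"
    and bound: "\<And>n x. x \<in> Delta L \<Longrightarrow> \<bar>g n x - \<Phi> x\<bar> \<le> \<epsilon> n" and \<epsilon>: "\<epsilon> \<longlonglongrightarrow> 0"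
  shows "(\<lambda>n. Futaki L f (g n)) \<longlonglongrightarrow> Futaki L f \<Phi>"
proof -
  define \<omega> where "\<omega> N x = 1 / f x ^ N" for N x
  have \<omega>: "continuous_on (Delta L) (\<omega> N)" for N
  proof -
    have "f x ^ N \<noteq> 0" if "x \<in> Delta L" for x using f(2)[OF that] by simp
    then show ?thesis
      unfolding \<omega>_def by (intro continuous_on_divide continuous_on_power continuous_on_const f(1)) auto
  qed
  have div: "h x / f x ^ N = h x * \<omega> N x" for h N x by (simp add: \<omega>_def)
  have int: "set_integrable lborel (Delta L) h" if "continuous_on (Delta L) h" for h :: "real ^ 'n \<Rightarrow> real"
    unfolding set_integrable_def by (rule borel_integrable_compact[OF cpt that])
  have cf: "compact (facet L j)" for j
    using compact_Int_closed[OF cpt closed_facet[of L j]] by (simp add: facet_def inf.absorb2)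
  have sub: "facet L j \<subseteq> Delta L" for j by (auto simp: facet_def)
  have int': "set_integrable (hyperplane_measure (L j)) (facet L j) h"
    if "continuous_on (Delta L) h" for j and h :: "real ^ 'n \<Rightarrow> real"
    by (rule set_integrable_hyperplane_measure[OF cf continuous_on_subset[OF that sub]])
  have 1: "(\<lambda>n. LINT x:Delta L|lborel. g n x * \<omega> N x) \<longlonglongrightarrow> (LINT x:Delta L|lborel. \<Phi> x * \<omega> N x)" for N
    by (rule set_integral_uniform_limit[OF int int int bound \<epsilon>])
      (intro continuous_on_mult g \<Phi> \<omega>)+
  have 2: "(\<lambda>n. LINT x:facet L j|hyperplane_measure (L j). g n x * \<omega> N x)
      \<longlonglongrightarrow> (LINT x:facet L j|hyperplane_measure (L j). \<Phi> x * \<omega> N x)" for N j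
  proof (rule set_integral_uniform_limit[OF int' int' int' _ \<epsilon>])
    fix n x assume "x \<in> facet L j"
    then show "\<bar>g n x - \<Phi> x\<bar> \<le> \<epsilon> n" using bound sub by blast
  qed (intro continuous_on_mult g \<Phi> \<omega>)+
  show ?thesis
    unfolding Futaki_def boundary_integral_def div
    by (intro tendsto_diff tendsto_mult tendsto_const tendsto_sum 1 2)
qed

lemma continuous_on_Max_aff:
  assumes "finite A" "A \<noteq> {}"
  shows "continuous_on S (\<lambda>x. Max ((\<lambda>p. aff p x) ` A))"
  using assms
proof (induction A rule: finite_ne_induct)
  case (insert p A)
  then have "(\<lambda>x. Max ((\<lambda>p. aff p x) ` insert p A)) = (\<lambda>x. max (aff p x) (Max ((\<lambda>p. aff p x) ` A)))"
    by (auto simp: fun_eq_iff)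
  then show ?case using insert by (auto intro!: continuous_on_max continuous_on_aff)
qed (simp add: continuous_on_aff)

lemma aff_reflect: "aff p (x + h) + aff p (x - h) = 2 * aff p x"
  by (simp add: aff_def inner_simps)

text \<open>
  Let \<open>p\<close> attain the maximum at an interior point.  The difference of the maximum and \<open>p\<close> is nonnegative,
  and where it vanishes the midpoint condition forces it to vanish at all nearby points as well.  Its
  zero set is thus open and closed in the connected interior.
\<close>

lemma midpoint_affine_imp_affine:
  fixes S :: "(real ^ 'n::finite) set"
  defines "m \<equiv> \<lambda>A x. Max ((\<lambda>p. aff p x) ` (A :: 'n affine_fun set))"
  assumes A: "finite A" "A \<noteq> {}" and S: "convex S" "interior S \<noteq> {}"
    and mid: "\<And>x h. x \<in> interior S \<Longrightarrow> x + h \<in> interior S \<Longrightarrow> x - h \<in> interior S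
      \<Longrightarrow> m A (x + h) + m A (x - h) = 2 * m A x"
  shows "affine_on S (m A)"
proof -
  obtain y where y: "y \<in> interior S" using S(2) by blast
  have "m A y \<in> (\<lambda>p. aff p y) ` A" unfolding m_def using A by (intro Max_in) auto
  then obtain p where p: "p \<in> A" "m A y = aff p y" by blast
  define Z where "Z = {x \<in> interior S. m A x - aff p x = 0}"
  have ge: "aff p x \<le> m A x" for x
    unfolding m_def using A p(1) by (intro Max_ge) auto
  have cont: "continuous_on T (\<lambda>x. m A x - aff p x)" for T
    unfolding m_def by (intro continuous_intros continuous_on_Max_aff A)
  have "closedin (top_of_set (interior S)) Z"
    unfolding Z_def by (rule continuous_closedin_preimage_constant[OF cont])
  moreover have "openin (top_of_set (interior S)) Z"
    unfolding openin_contains_ball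
  proof (intro conjI ballI)
    fix x assume x: "x \<in> Z"
    then have "x \<in> interior S" by (simp add: Z_def)
    then obtain r where r: "0 < r" "ball x r \<subseteq> interior S"
      using open_interior open_contains_ball by blast
    have "z \<in> Z" if z: "z \<in> ball x r" for z
    proof -
      have "x - (z - x) \<in> ball x r" using z by (simp add: dist_norm norm_minus_commute)
      then have "m A (x + (z - x)) + m A (x - (z - x)) = 2 * m A x"
        using z r x by (intro mid) (auto simp: Z_def)
      moreover have "aff p (x + (z - x)) + aff p (x - (z - x)) = 2 * aff p x"
        by (rule aff_reflect)
      ultimately have "m A z - aff p z = 0"
        using ge[of "x + (z - x)"] ge[of "x - (z - x)"] x by (simp add: Z_def)
      then show ?thesis using z r by (auto simp: Z_def)
    qed
    then show "\<exists>e>0. ball x e \<inter> interior S \<subseteq> Z" using r by blast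
  qed (auto simp: Z_def)
  moreover have "Z \<noteq> {}" using y p by (auto simp: Z_def)
  moreover have "connected (interior S)"
    using S(1) by (intro convex_connected convex_interior)
  ultimately have "Z = interior S" by (auto simp: connected_clopen)
  then have "interior S \<subseteq> {x. m A x - aff p x = 0}" by (auto simp: Z_def)
  moreover have "closed {x. m A x - aff p x = 0}"
    by (intro closed_Collect_eq cont continuous_on_const)
  ultimately have "closure (interior S) \<subseteq> {x. m A x - aff p x = 0}"
    by (rule closure_minimal)
  then have "\<forall>x\<in>S. m A x = aff p x"
    using convex_closure_interior[OF S] closure_subset[of S] by auto
  then show ?thesis unfolding affine_on_def by blast
qed

text \<open>
  If the second difference of the maximum at \<open>x0\<close> were positive, it would be bounded below by a positive
  constant on a ball \<open>B\<close> around \<open>x0\<close>, and so would those of its uniform approximations.  Their integrals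
  over \<open>B\<close> are however bounded by the integrals of the Laplacians over the set \<open>K\<close> swept out by the
  translates of \<open>B\<close> along the segment, and these tend to \<open>0\<close>.
\<close>

lemma vanishing_laplacian_imp_midpoint:
  fixes A :: "'n::finite affine_fun set" and x0 h :: "real ^ 'n"
  defines "m \<equiv> \<lambda>x. Max ((\<lambda>p. aff p x) ` A)"
  assumes A: "finite A" "A \<noteq> {}"
    and I: "open I" "convex I" "x0 + h \<in> I" "x0 - h \<in> I"
    and laplacian: "\<And>K. compact K \<Longrightarrow> K \<subseteq> I \<Longrightarrow> \<exists>\<kappa>>0. \<forall>n.
      ennreal \<kappa> * (\<integral>\<^sup>+x. ennreal (laplacian_smooth_max (real (Suc n)) A x) * indicator K x \<partial>lborel) \<le> ennreal (F n)"
    and F: "\<And>n. 0 \<le> F n" "F \<longlonglongrightarrow> 0"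
  shows "m (x0 + h) + m (x0 - h) = 2 * m x0"
proof (rule ccontr)
  define D where "D x = m (x + h) + m (x - h) - 2 * m x" for x
  assume "\<not> ?thesis"
  then have "D x0 \<noteq> 0" by (simp add: D_def)
  moreover have "0 \<le> D x0"
  proof -
    have "m x0 \<in> (\<lambda>p. aff p x0) ` A" unfolding m_def using A by (intro Max_in) auto
    then obtain p where p: "p \<in> A" "m x0 = aff p x0" by blast
    have "aff p x \<le> m x" for x
      unfolding m_def using A p(1) by (intro Max_ge) auto
    from this[of "x0 + h"] this[of "x0 - h"] show ?thesis
      using aff_reflect[of p x0 h] p by (simp add: D_def)
  qed
  ultimately have D0: "0 < D x0" by simp
  have m_cont: "continuous_on UNIV m" unfolding m_def by (rule continuous_on_Max_aff[OF A])
  have "continuous_on UNIV D"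
    unfolding D_def by (intro continuous_intros continuous_on_compose2[OF m_cont]) auto
  then have "open {x. D x0 / 2 < D x}"
    by (intro open_Collect_less continuous_on_const)
  moreover have "x0 \<in> {x. D x0 / 2 < D x}" using D0 by simp
  ultimately obtain r1 where r1: "0 < r1" "ball x0 r1 \<subseteq> {x. D x0 / 2 < D x}"
    by (rule openE)
  obtain r2 where r2: "0 < r2" "cball (x0 + h) r2 \<subseteq> I"
    using I(1,3) open_contains_cball by blast
  obtain r3 where r3: "0 < r3" "cball (x0 - h) r3 \<subseteq> I"
    using I(1,4) open_contains_cball by blast
  define r where "r = Min {r1, r2, r3}"
  have r: "0 < r" "r \<le> r1" "r \<le> r2" "r \<le> r3" using r1 r2 r3 by (auto simp: r_def)
  define K where "K = (\<lambda>(s, z). z + s *\<^sub>R h) ` ({-1..1} \<times> cball x0 r)"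
  have "compact K"
    unfolding K_def by (intro compact_continuous_image compact_Times compact_cball compact_Icc)
      (auto simp: case_prod_beta intro!: continuous_intros)
  \<comment> \<open>A point of \<open>K\<close> is a convex combination of the points \<open>z + h\<close> and \<open>z - h\<close> near the ends of the segment.\<close>
  have "K \<subseteq> I"
  proof
    fix y assume "y \<in> K"
    then obtain s z where sz: "-1 \<le> s" "s \<le> 1" "z \<in> cball x0 r" "y = z + s *\<^sub>R h"
      by (auto simp: K_def)
    have "z + h \<in> I" "z - h \<in> I"
      using sz(3) r r2(2) r3(2) by (auto simp: subset_iff dist_norm)
    then have "((1 + s) / 2) *\<^sub>R (z + h) + ((1 - s) / 2) *\<^sub>R (z - h) \<in> I"
      using I(2) sz(1,2) by (intro convexD) (auto simp: field_simps)
    also have "((1 + s) / 2) *\<^sub>R (z + h) + ((1 - s) / 2) *\<^sub>R (z - h)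
        = (((1 + s) / 2) + ((1 - s) / 2)) *\<^sub>R z + (((1 + s) / 2) - ((1 - s) / 2)) *\<^sub>R h"
      by (simp only: scaleR_add_right scaleR_diff_right scaleR_add_left scaleR_diff_left) simp
    also have "\<dots> = y" by (simp add: sz(4) field_simps)
    finally show "y \<in> I" .
  qed
  with laplacian[OF \<open>compact K\<close>] obtain \<kappa> where \<kappa>: "0 < \<kappa>" "\<And>n.
      ennreal \<kappa> * (\<integral>\<^sup>+x. ennreal (laplacian_smooth_max (real (Suc n)) A x) * indicator K x \<partial>lborel) \<le> ennreal (F n)"
    by blast
  define B where "B = ball x0 r"
  define v where "v = measure lborel B"
  have v: "0 < v" "emeasure lborel B = ennreal v"
    using content_ball_pos[OF r(1), of x0] emeasure_lborel_ball_finite[of x0 r]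
    by (auto simp: v_def B_def emeasure_eq_ennreal_measure less_top)
  \<comment> \<open>Replacing the maximum by its approximation raises the subtracted middle value by at most \<open>ln (card A) / (n + 1)\<close>, counted twice, and does not lower the end values.\<close>
  define e where "e n = 2 * (ln (card A) / real (Suc n))" for n
  have "(D x0 / 2 - e n) * v * \<kappa> \<le> 2 * (norm h)\<^sup>2 * F n" for n
  proof -
    interpret smoothed_max "real (Suc n)" A by unfold_locales (use A in auto)
    let ?d = "\<lambda>x. smooth_max (real (Suc n)) A (x + h) + smooth_max (real (Suc n)) A (x - h)
        - 2 * smooth_max (real (Suc n)) A x"
    let ?E = "\<integral>\<^sup>+x. ennreal (laplacian_smooth_max (real (Suc n)) A x) * indicator K x \<partial>lborel"
    have "ennreal (D x0 / 2 - e n) * ennreal v = (\<integral>\<^sup>+x. ennreal (D x0 / 2 - e n) * indicator B x \<partial>lborel)"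
      by (simp add: B_def nn_integral_cmult_indicator flip: v(2))
    also have "\<dots> \<le> (\<integral>\<^sup>+x. ennreal (?d x) * indicator B x \<partial>lborel)"
    proof (intro nn_integral_mono)
      fix x
      have "D x0 / 2 - e n \<le> ?d x" if "x \<in> B"
      proof -
        have "x \<in> ball x0 r1" using that r by (auto simp: B_def)
        then have "D x0 / 2 < D x" using r1(2) by blast
        then show ?thesis
          using Max_le_smooth_max[of "x + h"] Max_le_smooth_max[of "x - h"] smooth_max_le[of x]
          unfolding D_def[of x] m_def e_def by linarith
      qed
      then show "ennreal (D x0 / 2 - e n) * indicator B x \<le> ennreal (?d x) * indicator B x"
        by (auto simp: indicator_def intro: ennreal_leI)
    qed
    also have "\<dots> \<le> ennreal (2 * (norm h)\<^sup>2) * ?E"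
    proof (rule second_difference_integral_le)
      show "x + s *\<^sub>R h \<in> K" if "x \<in> B" "-1 \<le> s" "s \<le> 1" for x s
        using that unfolding K_def B_def by (intro image_eqI[of _ _ "(s, x)"]) auto
    qed (use \<open>compact K\<close> in \<open>auto simp: B_def borel_compact\<close>)
    finally have "ennreal \<kappa> * (ennreal (D x0 / 2 - e n) * ennreal v)
        \<le> ennreal \<kappa> * (ennreal (2 * (norm h)\<^sup>2) * ?E)"
      by (rule mult_left_mono) simp
    also have "\<dots> = ennreal (2 * (norm h)\<^sup>2) * (ennreal \<kappa> * ?E)" by (simp add: mult_ac)
    also have "\<dots> \<le> ennreal (2 * (norm h)\<^sup>2) * ennreal (F n)"
      by (intro mult_left_mono \<kappa>(2)) simp
    finally have le: "ennreal ((D x0 / 2 - e n) * v * \<kappa>) \<le> ennreal (2 * (norm h)\<^sup>2 * F n)"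
      using v(1) \<kappa>(1) F(1)[of n] by (simp add: ennreal_mult' ennreal_mult'' mult_ac)
    have "0 \<le> 2 * (norm h)\<^sup>2 * F n" using F(1)[of n] by simp
    with le show ?thesis by (simp add: ennreal_le_iff)
  qed
  moreover have "(\<lambda>n. (D x0 / 2 - e n) * v * \<kappa>) \<longlonglongrightarrow> (D x0 / 2 - 2 * (ln (card A) * 0)) * v * \<kappa>"
    unfolding e_def divide_inverse by (intro tendsto_intros LIMSEQ_inverse_real_of_nat)
  moreover have "(\<lambda>n. 2 * (norm h)\<^sup>2 * F n) \<longlonglongrightarrow> 2 * (norm h)\<^sup>2 * 0"
    by (intro tendsto_intros F(2))
  ultimately have "(D x0 / 2 - 2 * (ln (card A) * 0)) * v * \<kappa> \<le> 2 * (norm h)\<^sup>2 * 0"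
    by (intro LIMSEQ_le) auto
  then show False
    using D0 v(1) \<kappa>(1) by (simp add: mult_le_0_iff)
qed

text \<open>
  The minimum of the quadratic forms over \<open>K\<close> times the unit sphere, extended by homogeneity.
\<close>

lemma uniformly_positive_definite:
  fixes M :: "real ^ 'n::finite \<Rightarrow> real ^ 'n ^ 'n"
  assumes K: "compact K" and M: "\<And>i j. continuous_on K (\<lambda>x. M x $ i $ j)"
    and pos: "\<And>x v. x \<in> K \<Longrightarrow> v \<noteq> 0 \<Longrightarrow> 0 < v \<bullet> (M x *v v)"
  shows "\<exists>\<kappa>>0. \<forall>x\<in>K. \<forall>v. \<kappa> * (norm v)\<^sup>2 \<le> v \<bullet> (M x *v v)"
proof (cases "K = {}")
  case False
  define q where "q = (\<lambda>(x, v). v \<bullet> (M x *v v))"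
  let ?T = "K \<times> sphere (0 :: real ^ 'n) 1"
  have q_eq: "q = (\<lambda>z. \<Sum>i\<in>UNIV. \<Sum>j\<in>UNIV. snd z $ i * (M (fst z) $ i $ j * snd z $ j))"
    by (auto simp: q_def inner_Sum_mult matrix_vector_mult_def sum_distrib_left)
  have "continuous_on ?T q"
    unfolding q_eq
    by (intro continuous_intros continuous_on_compose2[OF M]) auto
  moreover have "compact ?T" by (intro compact_Times K compact_sphere)
  moreover have "?T \<noteq> {}" using False by auto
  ultimately obtain z where z: "z \<in> ?T" "\<And>y. y \<in> ?T \<Longrightarrow> q z \<le> q y"
    using continuous_attains_inf by metis
  have "0 < q z" using z(1) by (auto simp: q_def intro!: pos)
  moreover have "q z * (norm v)\<^sup>2 \<le> v \<bullet> (M x *v v)" if x: "x \<in> K" for x v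
  proof (cases "v = 0")
    case False
    define e where "e = (1 / norm v) *\<^sub>R v"
    have v: "v = norm v *\<^sub>R e" using False by (simp add: e_def)
    have "q z \<le> e \<bullet> (M x *v e)"
      using z(2)[of "(x, e)"] x False by (simp add: q_def e_def)
    then have "q z * (norm v)\<^sup>2 \<le> (e \<bullet> (M x *v e)) * (norm v)\<^sup>2"
      by (rule mult_right_mono) simp
    also have "\<dots> = v \<bullet> (M x *v v)"
      by (subst (2 3) v) (simp add: matrix_vector_mult_scaleR power2_eq_square)
    finally show ?thesis .
  qed simp
  ultimately show ?thesis by blast
qed (auto intro: exI[of _ 1])

section \<open>K-polystability\<close>

lemma smooth_on_Ck: "smooth_on U g \<Longrightarrow> Ck_on k U g"
  by (simp add: smooth_on_def)

lemma HH_symmetric: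
  assumes U: "open U" "x \<in> U" and u: "smooth_on U u"
    and pos: "\<And>v. v \<noteq> 0 \<Longrightarrow> 0 < v \<bullet> (Hess u x *v v)"
  shows "HH u x $ i $ j = HH u x $ j $ i"
proof -
  have "transpose (Hess u x) = Hess u x"
    using pderivative_commute[OF U(1) smooth_on_Ck[OF u] U(2)]
    by (simp add: transpose_def Hess_def vec_eq_iff)
  then have "transpose (HH u x) = HH u x"
    unfolding HH_def using pos by (rule symmetric_matrix_inv)
  then have "transpose (HH u x) $ j $ i = HH u x $ j $ i" by simp
  then show ?thesis by (simp add: transpose_def)
qed

text \<open>
  What the positivity condition on the faces amounts to for the largest face: no facet contains the
  polytope, so \<open>H\<close> is positive definite in the interior.
\<close>

lemma Delta_as_its_own_face:
  fixes L :: "'d::finite \<Rightarrow> 'n::finite affine_fun"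
  assumes L: "labelled_rational_Delzant \<Lambda> L"
  shows "rel_interior (Delta L) = interior (Delta L)" "normal_span L (Delta L) = {0}"
proof -
  note int = Delzant_facts(3)[OF L] and nz = Delzant_facts(4)[OF L]
  show "rel_interior (Delta L) = interior (Delta L)"
    using int by (rule rel_interior_nonempty_interior)
  obtain y where "y \<in> interior (Delta L)" using int by blast
  then have "y \<in> Delta L" using interior_subset by blast
  moreover have "y \<notin> facet L j" for j
  proof -
    have "0 < aff (L j) y" using \<open>y \<in> interior (Delta L)\<close> by (simp add: interior_Delta[OF nz])
    then show ?thesis by (simp add: facet_def)
  qed
  ultimately have "{normal_vec L j | j. Delta L \<subseteq> facet L j} = {}" by blast
  then show "normal_span L (Delta L) = {0}" by (simp add: normal_span_def)
qed

lemma potentials_extension: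
  assumes "u \<in> potentials L"
  obtains U H where "open U" "Delta L \<subseteq> U" "\<And>i j. smooth_on U (\<lambda>x. H x $ i $ j)"
    "\<And>x. x \<in> interior (Delta L) \<Longrightarrow> H x = HH u x"
    "\<And>j \<xi>. \<xi> \<in> facet L j \<Longrightarrow> H \<xi> *v normal_vec L j = 0"
    "\<And>j \<xi>. \<xi> \<in> facet L j \<Longrightarrow> ((\<lambda>x. normal_vec L j \<bullet> (H x *v normal_vec L j))
                  has_derivative (\<lambda>h. (2 *\<^sub>R normal_vec L j) \<bullet> h)) (at \<xi>)"
    "\<And>F \<xi> v. F face_of Delta L \<Longrightarrow> \<xi> \<in> rel_interior F \<Longrightarrow> v \<notin> normal_span L F
        \<Longrightarrow> 0 < v \<bullet> (H \<xi> *v v)"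
proof -
  obtain U H where "open U" "Delta L \<subseteq> U" and H: "\<forall>i j. smooth_on U (\<lambda>x. H x $ i $ j)"
    "\<forall>x\<in>interior (Delta L). H x = HH u x"
    and facets: "\<forall>j. \<forall>\<xi>\<in>facet L j. H \<xi> *v normal_vec L j = 0 \<and>
      ((\<lambda>x. normal_vec L j \<bullet> (H x *v normal_vec L j))
        has_derivative (\<lambda>h. (2 *\<^sub>R normal_vec L j) \<bullet> h)) (at \<xi>)"
    and faces: "\<forall>F. F face_of Delta L \<longrightarrow>
      (\<forall>\<xi>\<in>rel_interior F. \<forall>v. v \<notin> normal_span L F \<longrightarrow> 0 < v \<bullet> (H \<xi> *v v))"
    using assms unfolding potentials_def mem_Collect_eq by (elim exE conjE) (rule that)
  from this(1,2) show thesis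
  proof (rule that)
    show "smooth_on U (\<lambda>x. H x $ i $ j)" for i j using H(1) by (elim allE)
    show "H x = HH u x" if "x \<in> interior (Delta L)" for x using H(2) that by (rule bspec)
    show "H \<xi> *v normal_vec L j = 0" "((\<lambda>x. normal_vec L j \<bullet> (H x *v normal_vec L j))
        has_derivative (\<lambda>h. (2 *\<^sub>R normal_vec L j) \<bullet> h)) (at \<xi>)" if "\<xi> \<in> facet L j" for j \<xi>
      using bspec[OF spec[OF facets] that] by (rule conjunct1, rule conjunct2)
    show "0 < v \<bullet> (H \<xi> *v v)"
      if "F face_of Delta L" "\<xi> \<in> rel_interior F" "v \<notin> normal_span L F" for F \<xi> v
      using faces that by blast
  qed
qed

theorem corollary3:
  fixes \<Lambda> :: "(real ^ 'n::finite) set"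
    and L :: "'d::finite \<Rightarrow> 'n affine_fun"
    and f :: "real ^ 'n \<Rightarrow> real"
  assumes "CARD('n) \<ge> 2"
    and "is_lattice \<Lambda>"
    and "labelled_rational_Delzant \<Lambda> L"
    and "affine_on UNIV f"
    and "\<forall>x\<in>Delta L. 0 < f x"
    and "\<exists>u\<in>potentials L. \<forall>x\<in>interior (Delta L).
           - (\<Sum>i\<in>UNIV. \<Sum>j\<in>UNIV.
                pderivative j (pderivative i
                  (\<lambda>y. 1 / f y ^ (2 * CARD('n) - 1) * HH u y $ i $ j)) x)
           = c_const L f / f x ^ (2 * CARD('n) + 1)"
  shows "K_polystable L f"
  unfolding K_polystable_def
proof (intro allI impI)
  fix \<phi> assume \<phi>: "PL_convex_on (Delta L) \<phi>"
  note L = assms(3)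
  note nz = Delzant_facts(4)[OF L]
  have cpt: "compact (Delta L)"
    using Delzant_facts(1)[OF L] closed_Delta by (simp add: compact_eq_bounded_closed)
  define I where "I = interior (Delta L)"
  have I: "open I" "convex I" "I \<subseteq> Delta L" "I \<noteq> {}"
    using Delzant_facts(2,3)[OF L] interior_subset[of "Delta L"] by (simp_all add: I_def convex_interior)
  obtain a where "\<forall>x. f x = aff a x" using assms(4) unfolding affine_on_def by blast
  then have f: "f = aff a" by (intro ext) (erule spec)
  have f_pos: "0 < f x" if "x \<in> Delta L" for x using assms(5) that by blast
  define w where "w x = 1 / f x ^ (2 * CARD('n) - 1)" for x
  obtain u where u_pot: "u \<in> potentials L" and pde: "\<forall>x\<in>I.
      - (\<Sum>i\<in>UNIV. \<Sum>j\<in>UNIV. pderivative j (pderivative i (\<lambda>y. w y * HH u y $ i $ j)) x)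
      = c_const L f / f x ^ (2 * CARD('n) + 1)"
    using assms(6)[folded I_def w_def] by (rule bexE)
  from u_pot have u: "smooth_on I u" "\<And>x v. x \<in> I \<Longrightarrow> v \<noteq> 0 \<Longrightarrow> 0 < v \<bullet> (Hess u x *v v)"
    by (simp_all add: potentials_def I_def)
  obtain U H where U: "open U" "Delta L \<subseteq> U" and H: "\<And>i j. smooth_on U (\<lambda>x. H x $ i $ j)"
    and H_eq: "\<And>x. x \<in> I \<Longrightarrow> H x = HH u x"
    and null: "\<And>j \<xi>. \<xi> \<in> facet L j \<Longrightarrow> H \<xi> *v normal_vec L j = 0"
    and der: "\<And>j \<xi>. \<xi> \<in> facet L j \<Longrightarrow> ((\<lambda>x. normal_vec L j \<bullet> (H x *v normal_vec L j))
                  has_derivative (\<lambda>h. (2 *\<^sub>R normal_vec L j) \<bullet> h)) (at \<xi>)"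
    and face: "\<And>F \<xi> v. F face_of Delta L \<Longrightarrow> \<xi> \<in> rel_interior F \<Longrightarrow> v \<notin> normal_span L F
        \<Longrightarrow> 0 < v \<bullet> (H \<xi> *v v)"
    by (rule potentials_extension[OF u_pot, folded I_def]) (rule that; assumption?)
  have H_pos: "0 < v \<bullet> (H x *v v)" if "x \<in> I" "v \<noteq> 0" for x v
    using face[OF face_of_refl[OF Delzant_facts(2)[OF L]], of x v] that Delta_as_its_own_face[OF L]
    by (simp add: I_def)
  \<comment> \<open>The extension of \<open>H\<close> may reach beyond the half-space where \<open>f\<close> is positive, and \<open>w\<close> is singular on its boundary.\<close>
  define U' where "U' = U \<inter> {x. 0 < f x}"
  have U': "open U'" "Delta L \<subseteq> U'"
    using U f_pos open_Collect_less[OF continuous_on_const continuous_on_aff, of 0 a]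
    by (auto simp: U'_def f)
  have H2: "Ck_on 2 U' (\<lambda>x. H x $ i $ j)" for i j
    by (rule Ck_on_subset[OF smooth_on_Ck[OF H]]) (auto simp: U'_def)
  have w2: "Ck_on 2 U' w"
    using Ck_on_inverse_aff_power[of U' a 2 "2 * CARD('n) - 1"] U'(1)
    by (simp add: U'_def f w_def[abs_def] divide_inverse power_inverse)
  have sym: "H x $ i $ j = H x $ j $ i" if "x \<in> I" for x i j
    unfolding H_eq[OF that] using HH_symmetric[OF I(1) that u(1)] u(2)[OF that] by blast
  have pde_H: "- (\<Sum>i\<in>UNIV. \<Sum>j\<in>UNIV. pderivative j (pderivative i (\<lambda>y. w y * H y $ i $ j)) x)
      = c_const L f / f x ^ (2 * CARD('n) + 1)" if x: "x \<in> I" for x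
  proof -
    have "pderivative j (pderivative i (\<lambda>y. w y * H y $ i $ j)) x
        = pderivative j (pderivative i (\<lambda>y. w y * HH u y $ i $ j)) x" for i j
      by (rule pderivative_cong[OF I(1) x], rule pderivative_cong[OF I(1)]) (auto simp: H_eq)
    then show ?thesis using bspec[OF pde x] by simp
  qed
  have f_cont: "continuous_on (Delta L) f" by (simp add: f continuous_on_aff)
  have f_ne: "f x ^ N \<noteq> 0" if "x \<in> Delta L" for x N using f_pos[OF that] by simp
  \<comment> \<open>The basic identity: the Futaki functional as a weighted integral of the Hessian.\<close>
  have Futaki_Hessian: "Futaki L f g
      = (LINT x:Delta L|lborel. w x * (\<Sum>i\<in>UNIV. \<Sum>j\<in>UNIV. H x $ i $ j * pderivative j (pderivative i g) x))"
    if g: "Ck_on 2 UNIV g" for g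
  proof -
    have \<rho>: "continuous_on (Delta L) (\<lambda>x. c_const L f / f x ^ (2 * CARD('n) + 1))"
      using f_ne by (intro continuous_on_divide continuous_on_const continuous_on_power f_cont) auto
    have "(LINT x:Delta L|lborel. g x * (c_const L f / f x ^ (2 * CARD('n) + 1)))
        = (LINT x:Delta L|lborel. c_const L f * (g x / f x ^ (2 * CARD('n) + 1)))"
      by (simp add: mult.commute)
    also have "\<dots> = c_const L f * (LINT x:Delta L|lborel. g x / f x ^ (2 * CARD('n) + 1))"
      by (rule set_integral_mult_right)
    finally have "Futaki L f g = 2 * boundary_integral L (\<lambda>x. g x * w x)
        - (LINT x:Delta L|lborel. g x * (c_const L f / f x ^ (2 * CARD('n) + 1)))"
      by (simp add: Futaki_def w_def)
    also have "\<dots> = (LINT x:Delta L|lborel. w x * (\<Sum>i\<in>UNIV. \<Sum>j\<in>UNIV. H x $ i $ j * pderivative j (pderivative i g) x))"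
      by (rule Hessian_integration_by_parts[OF L U' H2 w2 Ck_on_subset[OF g] _ null der \<rho>])
        (auto simp: sym pde_H I_def[symmetric])
    finally show ?thesis .
  qed
  \<comment> \<open>The smooth convex approximations \<open>g n\<close> of the piecewise affine function.\<close>
  obtain A where A: "finite A" "A \<noteq> {}" and \<phi>_eq: "\<And>x. x \<in> Delta L \<Longrightarrow> \<phi> x = Max ((\<lambda>p. aff p x) ` A)"
    using \<phi> by (auto simp: PL_convex_on_def)
  define m where "m x = Max ((\<lambda>p. aff p x) ` A)" for x
  have m_cont: "continuous_on S m" for S
    unfolding m_def by (rule continuous_on_Max_aff[OF A])
  have Futaki_m: "Futaki L f \<phi> = Futaki L f m"
  proof -
    have "indicator (Delta L) x *\<^sub>R (\<phi> x / c) = indicator (Delta L) x *\<^sub>R (m x / c)"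
      "indicator (facet L j) x *\<^sub>R (\<phi> x / c) = indicator (facet L j) x *\<^sub>R (m x / c)" for x c j
      using \<phi>_eq by (auto simp: indicator_def m_def facet_def)
    then show ?thesis
      by (simp only: Futaki_def boundary_integral_def set_lebesgue_integral_def)
  qed
  define g where "g n = smooth_max (real (Suc n)) A" for n
  define Q where "Q n x = w x * (\<Sum>i\<in>UNIV. \<Sum>j\<in>UNIV. H x $ i $ j * pderivative j (pderivative i (g n)) x)" for n x
  have sm: "smoothed_max (real (Suc n)) A" for n
    by unfold_locales (use A in auto)
  have g2: "Ck_on 2 UNIV (g n)" for n
    unfolding g_def by (rule smoothed_max.Ck_on_smooth_max[OF sm open_UNIV])
  have Futaki_g: "Futaki L f (g n) = (LINT x:Delta L|lborel. Q n x)" for n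
    unfolding Q_def by (rule Futaki_Hessian[OF g2])
  have limit: "(\<lambda>n. Futaki L f (g n)) \<longlonglongrightarrow> Futaki L f m"
  proof (rule Futaki_uniform_limit[OF cpt f_cont f_pos _ m_cont])
    show "continuous_on (Delta L) (g n)" for n
      unfolding g_def by (rule smoothed_max.continuous_on_smooth_max[OF sm])
    show "\<bar>g n x - m x\<bar> \<le> ln (card A) * inverse (real (Suc n))" for n x
      using smoothed_max.Max_le_smooth_max[OF sm, of x n] smoothed_max.smooth_max_le[OF sm, of n x]
      by (simp add: g_def m_def divide_inverse)
    show "(\<lambda>n. ln (card A) * inverse (real (Suc n))) \<longlonglongrightarrow> 0"
      by (rule tendsto_mult_right_zero[OF LIMSEQ_inverse_real_of_nat])
  qed
  have Q_ge: "\<kappa> * laplacian_smooth_max (real (Suc n)) A x \<le> Q n x"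
    if "\<And>v. \<kappa> * (norm v)\<^sup>2 \<le> v \<bullet> ((w x *\<^sub>R H x) *v v)" for \<kappa> n x
  proof -
    have "Q n x = (\<Sum>i\<in>UNIV. \<Sum>j\<in>UNIV. (w x *\<^sub>R H x) $ i $ j * pderivative j (pderivative i (g n)) x)"
      by (simp add: Q_def sum_distrib_left mult.assoc)
    with smoothed_max.Hessian_smooth_max_ge[OF sm that, of n] show ?thesis
      by (simp only: g_def)
  qed
  have w_pos: "0 < w x" if "x \<in> Delta L" for x
    using f_pos[OF that] by (simp add: w_def)
  have wH_pos: "0 < v \<bullet> ((w x *\<^sub>R H x) *v v)" if "x \<in> I" "v \<noteq> 0" for x v
    using H_pos[OF that] w_pos[of x] I(3) that(1)
    by (auto simp: scaleR_matrix_vector_assoc[symmetric])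
  have Q_nonneg: "0 \<le> Q n x" if "x \<in> I" for n x
  proof -
    have "0 * laplacian_smooth_max (real (Suc n)) A x \<le> Q n x"
      by (rule Q_ge) (use wH_pos[OF that] in \<open>metis inner_zero_left less_eq_real_def mult_zero_left\<close>)
    then show ?thesis by simp
  qed
  have w_cont: "continuous_on (Delta L) w" and H_cont: "continuous_on (Delta L) (\<lambda>x. H x $ i $ j)" for i j
    using Ck_on_continuous[OF w2] Ck_on_continuous[OF H2] U'(2) by (auto intro: continuous_on_subset)
  have Q_int: "set_integrable lborel (Delta L) (Q n)" for n
  proof -
    have "continuous_on UNIV (pderivative j (pderivative i (g n)))" for i j
      using g2[of n] by (simp add: numeral_2_eq_2)
    then have "continuous_on (Delta L) (Q n)"
      unfolding Q_def by (intro continuous_intros w_cont H_cont) (auto intro: continuous_on_subset)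
    then show ?thesis unfolding set_integrable_def by (rule borel_integrable_compact[OF cpt])
  qed
  have AE_I: "AE x in lborel. x \<in> Delta L \<longleftrightarrow> x \<in> I"
    unfolding I_def by (rule AE_interior_Delta[OF nz])
  have AE_Q: "AE x in lborel. 0 \<le> indicator (Delta L) x *\<^sub>R Q n x" for n
    using AE_I by eventually_elim (auto simp: indicator_def Q_nonneg)
  have Futaki_g_nonneg: "0 \<le> Futaki L f (g n)" for n
    unfolding Futaki_g set_lebesgue_integral_def using AE_Q by (rule integral_nonneg_AE)
  show "0 \<le> Futaki L f \<phi> \<and> (Futaki L f \<phi> = 0 \<longrightarrow> affine_on (Delta L) \<phi>)"
  proof
    show "0 \<le> Futaki L f \<phi>"
      unfolding Futaki_m using limit by (rule LIMSEQ_le_const) (use Futaki_g_nonneg in blast)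
    show "Futaki L f \<phi> = 0 \<longrightarrow> affine_on (Delta L) \<phi>"
    proof
      assume "Futaki L f \<phi> = 0"
      then have to_0: "(\<lambda>n. Futaki L f (g n)) \<longlonglongrightarrow> 0"
        using limit by (simp add: Futaki_m)
      \<comment> \<open>On a compact set in the interior \<open>w H\<close> is at least some \<open>\<kappa> > 0\<close>, so the Futaki invariants control the Laplacians there.\<close>
      have laplacian_bound: "\<exists>\<kappa>>0. \<forall>n. ennreal \<kappa> * (\<integral>\<^sup>+x. ennreal (laplacian_smooth_max (real (Suc n)) A x) * indicator K x \<partial>lborel)
          \<le> ennreal (Futaki L f (g n))" if K: "compact K" "K \<subseteq> I" for K
      proof -
        have "continuous_on K (\<lambda>x. (w x *\<^sub>R H x) $ i $ j)" for i j
          using K(2) I(3) w_cont H_cont[of i j]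
          by (auto intro!: continuous_on_mult intro: continuous_on_subset)
        then have "\<exists>\<kappa>>0. \<forall>x\<in>K. \<forall>v. \<kappa> * (norm v)\<^sup>2 \<le> v \<bullet> ((w x *\<^sub>R H x) *v v)"
          by (rule uniformly_positive_definite[OF K(1)]) (use K(2) wH_pos in blast)
        then obtain \<kappa> where \<kappa>: "0 < \<kappa>" "\<And>x v. x \<in> K \<Longrightarrow> \<kappa> * (norm v)\<^sup>2 \<le> v \<bullet> ((w x *\<^sub>R H x) *v v)"
          by blast
        have "ennreal \<kappa> * (\<integral>\<^sup>+x. ennreal (laplacian_smooth_max (real (Suc n)) A x) * indicator K x \<partial>lborel)
            \<le> ennreal (Futaki L f (g n))" for n
        proof -
          interpret smoothed_max "real (Suc n)" A by (rule sm)
          have [measurable]: "laplacian_smooth_max (real (Suc n)) A \<in> borel_measurable borel"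
            by (rule borel_measurable_continuous_onI[OF continuous_on_laplacian_smooth_max])
          have [measurable]: "K \<in> sets borel"
            using K(1) by (rule borel_compact)
          have "ennreal \<kappa> * (\<integral>\<^sup>+x. ennreal (laplacian_smooth_max (real (Suc n)) A x) * indicator K x \<partial>lborel)
              = (\<integral>\<^sup>+x. ennreal \<kappa> * (ennreal (laplacian_smooth_max (real (Suc n)) A x) * indicator K x) \<partial>lborel)"
            by (rule nn_integral_cmult[symmetric]) measurable
          also have "\<dots> \<le> (\<integral>\<^sup>+x. ennreal (indicator (Delta L) x *\<^sub>R Q n x) \<partial>lborel)"
          proof (rule nn_integral_mono)
            fix x
            show "ennreal \<kappa> * (ennreal (laplacian_smooth_max (real (Suc n)) A x) * indicator K x)
                \<le> ennreal (indicator (Delta L) x *\<^sub>R Q n x)"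
            proof (cases "x \<in> K")
              case True
              then have "x \<in> Delta L" using K(2) I(3) by blast
              then show ?thesis
                using True Q_ge[OF \<kappa>(2)[OF True]] \<kappa>(1) laplacian_smooth_max_nonneg[of x]
                by (auto simp: ennreal_mult[symmetric] intro: ennreal_leI simp del: of_nat_Suc)
            qed simp
          qed
          also have "\<dots> = ennreal (\<integral>x. indicator (Delta L) x *\<^sub>R Q n x \<partial>lborel)"
            using Q_int[of n] AE_Q by (intro nn_integral_eq_integral) (auto simp: set_integrable_def)
          also have "\<dots> = ennreal (Futaki L f (g n))"
            by (simp add: Futaki_g set_lebesgue_integral_def)
          finally show ?thesis .
        qed
        then show ?thesis using \<kappa>(1) by blast
      qed
      have "affine_on (Delta L) m"
        unfolding m_def
      proof (rule midpoint_affine_imp_affine[OF A Delzant_facts(2,3)[OF L]])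
        fix x h assume "x \<in> interior (Delta L)" "x + h \<in> interior (Delta L)" "x - h \<in> interior (Delta L)"
        then show "Max ((\<lambda>p. aff p (x + h)) ` A) + Max ((\<lambda>p. aff p (x - h)) ` A) = 2 * Max ((\<lambda>p. aff p x) ` A)"
          by (intro vanishing_laplacian_imp_midpoint[OF A I(1,2) _ _ laplacian_bound Futaki_g_nonneg to_0])
            (auto simp: I_def)
      qed
      then show "affine_on (Delta L) \<phi>"
        using \<phi>_eq by (auto simp: affine_on_def m_def)
    qed
  qed
qed

end
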